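(* There is a polynomial-time constant-factor approximation algorithm for the weighted cardinality constrained multiple-round stochastic matching problem.
   Context: Weighted cardinality constrained multiple-round stochastic matching. An instance consists of an undirected graph $G=(V,E)$, a weight $w_e\ge0$ and probability $p_e\in[0,1]$ for each edge, a positive integer patience $t_v$ for each vertex, and positive integers $k$ and $C$. Each edge is independently present with probability $p_e$, revealed only when probed. A (possibly adaptive) strategy proceeds in at most $k$ rounds; in each round it simultaneously probes a set of edges forming a matching of size at most $C$, where each probed edge $(i,j)$ must not have been probed before, and $i$ and $j$ must each be unmatched and involved in fewer than $t_i$ (resp. $t_j$) previous probes. A probed edge that is present is irrevocably added to the matching (its endpoints become matched). The objective is the expected total weight of matched edges; an $\alpha$-approximation achieves at least $1/\alpha$ times the maximum expected value of any adaptive strategy in this model. *)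

theory Defs
  imports "HOL-Probability.Probability" "HOL-Library.Log_Nat"
    "HOL-Computational_Algebra.Polynomial"
begin

section \<open>The stochastic matching problem\<close>

text \<open>
  The vertex set is \<open>{0..<n}\<close>. An undirected edge between \<open>u\<close> and \<open>v\<close> is represented by the
  ordered pair with the smaller endpoint first, so that edges can be encoded as program data.
\<close>

type_synonym edge = "nat \<times> nat"

definition endpoints :: "edge \<Rightarrow> nat set" where
  "endpoints e = {fst e, snd e}"

text \<open>
  Weights and probabilities are rational since an instance is an input to an algorithm. Only the
  values of \<open>weight\<close> and \<open>present_prob\<close> on \<open>edges\<close>, and of \<open>patience\<close> below \<open>num_verts\<close>, matter.
\<close>

record matching_instance =
  num_verts :: nat
  edges :: "edge list"
  weight :: "edge \<Rightarrow> rat"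
  present_prob :: "edge \<Rightarrow> rat"
  patience :: "nat \<Rightarrow> nat"
  rounds :: nat
  capacity :: nat

definition valid_instance :: "matching_instance \<Rightarrow> bool" where
  "valid_instance I \<longleftrightarrow>
     distinct (edges I) \<and>
     (\<forall>(u, v) \<in> set (edges I). u < v \<and> v < num_verts I) \<and>
     (\<forall>e \<in> set (edges I). 0 \<le> weight I e \<and> 0 \<le> present_prob I e \<and> present_prob I e \<le> 1) \<and>
     (\<forall>v < num_verts I. 0 < patience I v) \<and>
     0 < rounds I \<and> 0 < capacity I"

definition matching :: "edge set \<Rightarrow> bool" where
  "matching M \<longleftrightarrow> (\<forall>e \<in> M. \<forall>f \<in> M. e \<noteq> f \<longrightarrow> endpoints e \<inter> endpoints f = {})"

text \<open>
  A history lists the rounds played so far in chronological order; a round lists the edges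
  probed, each with the answer whether it is present. A strategy maps the current history to the
  edges probed simultaneously in the next round; the empty list means that it stops.
\<close>

type_synonym history = "(edge \<times> bool) list list"
type_synonym strategy = "history \<Rightarrow> edge list"

definition probed_edges :: "history \<Rightarrow> edge set" where
  "probed_edges h = fst ` set (concat h)"

definition matched_edges :: "history \<Rightarrow> edge set" where
  "matched_edges h = {e. (e, True) \<in> set (concat h)}"

definition matched_vertex :: "history \<Rightarrow> nat \<Rightarrow> bool" where
  "matched_vertex h v \<longleftrightarrow> (\<exists>e \<in> matched_edges h. v \<in> endpoints e)"

definition num_probes :: "history \<Rightarrow> nat \<Rightarrow> nat" where
  "num_probes h v = length (filter (\<lambda>(e, b). v \<in> endpoints e) (concat h))"

definition legal_round :: "matching_instance \<Rightarrow> history \<Rightarrow> edge list \<Rightarrow> bool" where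
  "legal_round I h M \<longleftrightarrow>
     distinct M \<and> set M \<subseteq> set (edges I) \<and>
     matching (set M) \<and> length M \<le> capacity I \<and>
     (\<forall>e \<in> set M. e \<notin> probed_edges h \<and>
        (\<forall>v \<in> endpoints e. \<not> matched_vertex h v \<and> num_probes h v < patience I v))"

text \<open>\<open>play \<sigma> X j\<close> is the history after at most \<open>j\<close> rounds when \<open>X\<close> tells which edges are present.\<close>

fun play :: "strategy \<Rightarrow> (edge \<Rightarrow> bool) \<Rightarrow> nat \<Rightarrow> history" where
  "play \<sigma> X 0 = []"
| "play \<sigma> X (Suc j) =
     (let h = play \<sigma> X j; M = \<sigma> h
      in if M = [] then h else h @ [map (\<lambda>e. (e, X e)) M])"

definition edge_pmf :: "matching_instance \<Rightarrow> (edge \<Rightarrow> bool) pmf" where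
  "edge_pmf I =
     Pi_pmf (set (edges I)) False (\<lambda>e. bernoulli_pmf (real_of_rat (present_prob I e)))"

definition reachable :: "matching_instance \<Rightarrow> strategy \<Rightarrow> history set" where
  "reachable I \<sigma> = {play \<sigma> X j | X j. X \<in> set_pmf (edge_pmf I) \<and> j < rounds I}"

definition feasible :: "matching_instance \<Rightarrow> strategy \<Rightarrow> bool" where
  "feasible I \<sigma> \<longleftrightarrow> (\<forall>h \<in> reachable I \<sigma>. legal_round I h (\<sigma> h))"

definition total_weight :: "matching_instance \<Rightarrow> history \<Rightarrow> real" where
  "total_weight I h = (\<Sum>e \<in> matched_edges h. real_of_rat (weight I e))"

definition expected_weight :: "matching_instance \<Rightarrow> strategy \<Rightarrow> real" where
  "expected_weight I \<sigma> =
     measure_pmf.expectation (edge_pmf I) (\<lambda>X. total_weight I (play \<sigma> X (rounds I)))"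

definition optimum :: "matching_instance \<Rightarrow> real" where
  "optimum I = (SUP \<sigma> \<in> {\<sigma>. feasible I \<sigma>}. expected_weight I \<sigma>)"

lemma finite_matched_edges: "finite (matched_edges h)"
proof -
  have "matched_edges h \<subseteq> fst ` set (concat h)"
    unfolding matched_edges_def by force
  then show ?thesis by (rule finite_subset) simp
qed

lemma matched_edges_play:
  assumes "feasible I \<sigma>" "X \<in> set_pmf (edge_pmf I)" "j \<le> rounds I"
  shows "matched_edges (play \<sigma> X j) \<subseteq> set (edges I)"
  using assms(3)
proof (induction j)
  case 0
  then show ?case by (simp add: matched_edges_def)
next
  case (Suc j)
  have "legal_round I (play \<sigma> X j) (\<sigma> (play \<sigma> X j))"
    using assms(1,2) Suc.prems Suc_le_eq unfolding feasible_def reachable_def by blast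
  then have "set (\<sigma> (play \<sigma> X j)) \<subseteq> set (edges I)"
    by (simp add: legal_round_def)
  then show ?case
    using Suc by (auto simp: Let_def matched_edges_def)
qed

lemma finite_edge_pmf: "finite (set_pmf (edge_pmf I))"
proof -
  have "set_pmf (edge_pmf I) \<subseteq> PiE_dflt (set (edges I)) False (\<lambda>_. UNIV)"
    unfolding edge_pmf_def using set_Pi_pmf_subset[OF finite_set]
    by (fastforce simp: PiE_dflt_def)
  moreover have "finite (PiE_dflt (set (edges I)) False (\<lambda>_. UNIV :: bool set))"
    by (intro finite_PiE_dflt) auto
  ultimately show ?thesis by (rule finite_subset)
qed

lemma expected_weight_bound:
  assumes "valid_instance I" "feasible I \<sigma>"
  shows "expected_weight I \<sigma> \<le> (\<Sum>e \<in> set (edges I). real_of_rat (weight I e))"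
  unfolding expected_weight_def
proof (rule measure_pmf.integral_le_const)
  show "integrable (measure_pmf (edge_pmf I)) (\<lambda>X. total_weight I (play \<sigma> X (rounds I)))"
    by (rule integrable_measure_pmf_finite[OF finite_edge_pmf])
  show "AE X in measure_pmf (edge_pmf I). total_weight I (play \<sigma> X (rounds I))
          \<le> (\<Sum>e \<in> set (edges I). real_of_rat (weight I e))"
    unfolding AE_measure_pmf_iff total_weight_def
    using assms matched_edges_play[OF assms(2)]
    by (auto intro!: sum_mono2 simp: valid_instance_def)
qed

lemma expected_weight_le_optimum:
  assumes "valid_instance I" "feasible I \<sigma>"
  shows "expected_weight I \<sigma> \<le> optimum I"
  unfolding optimum_def
  by (rule cSUP_upper)
    (use assms expected_weight_bound in \<open>auto simp: bdd_above_def\<close>)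

lemma feasible_stop: "feasible I (\<lambda>_. [])"
  by (simp add: feasible_def legal_round_def matching_def)

lemma optimum_nonneg:
  assumes "valid_instance I"
  shows "0 \<le> optimum I"
proof -
  have "play (\<lambda>_. []) X j = []" for X j
    by (induction j) auto
  then have "expected_weight I (\<lambda>_. []) = 0"
    by (simp add: expected_weight_def total_weight_def matched_edges_def)
  then show ?thesis
    using expected_weight_le_optimum[OF assms feasible_stop] by simp
qed


section \<open>Programs and their running time\<close>

text \<open>
  The machine model is a first-order functional language on binary trees with integer leaves.
  The running time counts bit operations up to a polynomial: every evaluated node is charged at
  least the bit size of its value, so the time bounds the size of every intermediate result, and
  running times are polynomially related to those of Turing machines (as for a RAM with
  arithmetic under the logarithmic cost criterion).
\<close>

datatype val = Num int | Node val val

primrec val_size :: "val \<Rightarrow> nat" where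
  "val_size (Num i) = 1 + floorlog 2 (nat \<bar>i\<bar>)"
| "val_size (Node a b) = 1 + val_size a + val_size b"

datatype expr =
    Var nat
  | Lit int
  | MkPair expr expr
  | Fst expr
  | Snd expr
  | IsPair expr
  | Plus expr expr
  | Minus expr expr
  | Times expr expr
  | Div expr expr
  | Less expr expr
  | IfNonzero expr expr expr
  | LetIn expr expr
  | Call nat expr

text \<open>
  A program is a list of mutually recursive unary function bodies. Variables are de Bruijn
  indices into the environment, so that \<open>LetIn\<close> binds index \<open>0\<close> in its second argument. Function
  \<open>0\<close> is the entry point. Ill-typed operations and unbound indices have no derivation.
\<close>

type_synonym program = "expr list"

abbreviation truth_val :: "bool \<Rightarrow> val" where
  "truth_val b \<equiv> Num (of_bool b)"

inductive eval :: "program \<Rightarrow> val list \<Rightarrow> expr \<Rightarrow> val \<Rightarrow> nat \<Rightarrow> bool" for P where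
  Var: "i < length env \<Longrightarrow> eval P env (Var i) (env ! i) (1 + val_size (env ! i))"
| Lit: "eval P env (Lit i) (Num i) (1 + val_size (Num i))"
| MkPair: "eval P env a v s \<Longrightarrow> eval P env b w t \<Longrightarrow>
    eval P env (MkPair a b) (Node v w) (s + t + val_size (Node v w))"
| Fst: "eval P env a (Node v w) t \<Longrightarrow> eval P env (Fst a) v (t + val_size v)"
| Snd: "eval P env a (Node v w) t \<Longrightarrow> eval P env (Snd a) w (t + val_size w)"
| IsPair: "eval P env a v t \<Longrightarrow>
    eval P env (IsPair a) (truth_val (\<exists>x y. v = Node x y)) (t + 2)"
| Plus: "eval P env a (Num i) s \<Longrightarrow> eval P env b (Num j) t \<Longrightarrow>
    eval P env (Plus a b) (Num (i + j)) (s + t + val_size (Num (i + j)))"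
| Minus: "eval P env a (Num i) s \<Longrightarrow> eval P env b (Num j) t \<Longrightarrow>
    eval P env (Minus a b) (Num (i - j)) (s + t + val_size (Num (i - j)))"
| Times: "eval P env a (Num i) s \<Longrightarrow> eval P env b (Num j) t \<Longrightarrow>
    eval P env (Times a b) (Num (i * j)) (s + t + val_size (Num (i * j)))"
| Div: "eval P env a (Num i) s \<Longrightarrow> eval P env b (Num j) t \<Longrightarrow>
    eval P env (Div a b) (Num (i div j)) (s + t + val_size (Num (i div j)))"
| Less: "eval P env a (Num i) s \<Longrightarrow> eval P env b (Num j) t \<Longrightarrow>
    eval P env (Less a b) (truth_val (i < j)) (s + t + 2)"
| IfTrue: "eval P env a (Num i) s \<Longrightarrow> i \<noteq> 0 \<Longrightarrow> eval P env b v t \<Longrightarrow>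
    eval P env (IfNonzero a b c) v (s + t + 1)"
| IfFalse: "eval P env a (Num i) s \<Longrightarrow> i = 0 \<Longrightarrow> eval P env c v t \<Longrightarrow>
    eval P env (IfNonzero a b c) v (s + t + 1)"
| LetIn: "eval P env a v s \<Longrightarrow> eval P (v # env) b w t \<Longrightarrow> eval P env (LetIn a b) w (s + t + 1)"
| Call: "eval P env a v s \<Longrightarrow> f < length P \<Longrightarrow> eval P [v] (P ! f) w t \<Longrightarrow>
    eval P env (Call f a) w (s + t + 1)"

definition runs :: "program \<Rightarrow> val \<Rightarrow> val \<Rightarrow> nat \<Rightarrow> bool" where
  "runs P x y t \<longleftrightarrow> P \<noteq> [] \<and> eval P [x] (P ! 0) y t"

inductive_simps eval_simps:
  "eval P env (Var i) v t" "eval P env (Lit i) v t" "eval P env (MkPair a b) v t"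
  "eval P env (Fst a) v t" "eval P env (Snd a) v t" "eval P env (IsPair a) v t"
  "eval P env (Plus a b) v t" "eval P env (Minus a b) v t" "eval P env (Times a b) v t"
  "eval P env (Div a b) v t" "eval P env (Less a b) v t" "eval P env (IfNonzero a b c) v t"
  "eval P env (LetIn a b) v t" "eval P env (Call f a) v t"

lemma eval_iff:
  "eval P env e v t \<Longrightarrow> eval P env e v' t' \<longleftrightarrow> v' = v \<and> t' = t"
  by (induction arbitrary: v' t' rule: eval.induct) (auto simp: eval_simps)

lemma eval_deterministic:
  assumes "eval P env e v t" "eval P env e v' t'"
  shows "v = v' \<and> t = t'"
  using assms(2) unfolding eval_iff[OF assms(1)] by simp

lemma eval_size_le_time: "eval P env e v t \<Longrightarrow> val_size v \<le> t"
  by (induction rule: eval.induct) (auto simp: floorlog_def)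


section \<open>Encoding of instances, coin flips and histories\<close>

definition enc_nat :: "nat \<Rightarrow> val" where
  "enc_nat n = Num (int n)"

definition enc_rat :: "rat \<Rightarrow> val" where
  "enc_rat q = Node (Num (fst (quotient_of q))) (Num (snd (quotient_of q)))"

definition enc_list :: "('a \<Rightarrow> val) \<Rightarrow> 'a list \<Rightarrow> val" where
  "enc_list f xs = foldr (\<lambda>x v. Node (f x) v) xs (Num 0)"

definition enc_edge :: "edge \<Rightarrow> val" where
  "enc_edge e = Node (enc_nat (fst e)) (enc_nat (snd e))"

definition enc_instance :: "matching_instance \<Rightarrow> val" where
  "enc_instance I =
     Node (enc_nat (num_verts I))
    (Node (enc_list (\<lambda>e. Node (enc_edge e)
                          (Node (enc_rat (weight I e)) (enc_rat (present_prob I e)))) (edges I))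
    (Node (enc_list (\<lambda>v. enc_nat (patience I v)) [0..<num_verts I])
    (Node (enc_nat (rounds I)) (enc_nat (capacity I)))))"

definition enc_history :: "history \<Rightarrow> val" where
  "enc_history = enc_list (enc_list (\<lambda>(e, b). Node (enc_edge e) (truth_val b)))"

definition enc_input :: "matching_instance \<Rightarrow> bool list \<Rightarrow> history \<Rightarrow> val" where
  "enc_input I r h = Node (enc_instance I) (Node (enc_list truth_val r) (enc_history h))"

definition instance_size :: "matching_instance \<Rightarrow> nat" where
  "instance_size I = val_size (enc_instance I)"

lemma enc_list_inj: "inj f \<Longrightarrow> inj (enc_list f)"
proof (rule injI)
  fix xs ys assume f: "inj f" and eq: "enc_list f xs = enc_list f ys"
  from eq show "xs = ys"
  proof (induction xs arbitrary: ys)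
    case Nil
    then show ?case by (cases ys) (auto simp: enc_list_def)
  next
    case (Cons x xs)
    then show ?case using f by (cases ys) (auto simp: enc_list_def inj_eq)
  qed
qed

lemma enc_edge_inj: "inj enc_edge"
  by (rule injI) (auto simp: enc_edge_def enc_nat_def prod_eq_iff)


section \<open>Randomized polynomial-time approximation algorithms\<close>

text \<open>
  An algorithm is a program \<open>P\<close> together with a polynomial \<open>Q\<close> giving the number of fair coins
  flipped in advance. Given the instance, the coins and the history, the program computes the
  next round. Fixing the coins turns it into a strategy.
\<close>

definition coin_seqs :: "nat poly \<Rightarrow> matching_instance \<Rightarrow> bool list set" where
  "coin_seqs Q I = {r. length r = poly Q (instance_size I)}"

definition strategy_of :: "program \<Rightarrow> matching_instance \<Rightarrow> bool list \<Rightarrow> strategy" where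
  "strategy_of P I r h = (THE M. \<exists>t. runs P (enc_input I r h) (enc_list enc_edge M) t)"

lemma strategy_of_eqI:
  assumes "runs P (enc_input I r h) (enc_list enc_edge M) t"
  shows "strategy_of P I r h = M"
  unfolding strategy_of_def
proof (rule the_equality)
  show "\<exists>t. runs P (enc_input I r h) (enc_list enc_edge M) t"
    using assms by blast
next
  fix M' assume "\<exists>t. runs P (enc_input I r h) (enc_list enc_edge M') t"
  then have "enc_list enc_edge M' = enc_list enc_edge M"
    using assms eval_deterministic unfolding runs_def by blast
  then show "M' = M"
    using enc_list_inj[OF enc_edge_inj] by (simp add: inj_eq)
qed

text \<open>
  The time bound is for a single round. As every round but the last probes a new edge, it yields
  a polynomial bound on the total time even if the binary number \<open>rounds I\<close> is exponential.
\<close>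

definition polynomial_time :: "program \<Rightarrow> nat poly \<Rightarrow> bool" where
  "polynomial_time P Q \<longleftrightarrow>
     (\<exists>T :: nat poly. \<forall>I. valid_instance I \<longrightarrow>
        (\<forall>r \<in> coin_seqs Q I. \<forall>h \<in> reachable I (strategy_of P I r).
           \<exists>M t. runs P (enc_input I r h) (enc_list enc_edge M) t
             \<and> t \<le> poly T (instance_size I)))"

text \<open>The expected weight is taken over both the coins and the presence of the edges.\<close>

definition approximation_algorithm :: "real \<Rightarrow> program \<Rightarrow> nat poly \<Rightarrow> bool" where
  "approximation_algorithm \<alpha> P Q \<longleftrightarrow>
     (\<forall>I. valid_instance I \<longrightarrow>
        (\<forall>r \<in> coin_seqs Q I. feasible I (strategy_of P I r)) \<and>
        measure_pmf.expectation (pmf_of_set (coin_seqs Q I))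
          (\<lambda>r. expected_weight I (strategy_of P I r)) \<ge> (1 / \<alpha>) * optimum I)"

end

theory Submission
  imports Defs
begin

text \<open>
  Let \<open>x e\<close> be the probability that an adaptive strategy probes \<open>e\<close>. Whether \<open>e\<close> is probed is
  independent of its presence, so the strategy earns \<open>\<Sum> w e * p e * x e\<close>, and \<open>x\<close> is a fractional
  solution of a packing problem: \<open>p\<close> has load at most \<open>1\<close> and the number of probes load at most
  \<open>min (patience v) k\<close> at every vertex \<open>v\<close>, and at most \<open>k * C\<close> edges are probed in total. These are
  three constraints per edge after adding up the first two, so a local-ratio algorithm on integers
  scaled by a common denominator \<open>D\<close> finds a set \<open>S\<close> of edges that uses at most about an eighth of
  every constraint and is worth a constant fraction of the fractional solution.

  A fair coin decides whether to work with the edges with \<open>p > 1/8\<close>, for which \<open>S\<close> is a matching, or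
  with the others, for which an edge of \<open>S\<close> meets in expectation at most \<open>1/2\<close> other present edges.
  In each round a greedy maximal matching of the remaining unblocked edges of \<open>S\<close> is probed. As \<open>S\<close>
  is sparse, an edge that is never blocked gets its turn within \<open>k\<close> rounds, whatever the answers;
  hence each edge of \<open>S\<close> is matched with probability at least \<open>p / 2\<close>.
\<close>

section \<open>Sparse packing by local ratio\<close>

text \<open>The local ratio method replaces solving a linear program, because the algorithm has to
  be run and timed in the tree language: it needs only integer comparisons, and its stack doubles as
  a dual solution. The threshold 1/8 serves two purposes. A waiting edge is delayed in three ways
  (probes at either endpoint, rounds of full capacity), each using at most an eighth of the
  available rounds, and 3/8 < 1. If all probabilities at a vertex are at most 1/8, this exceptional
  edge raises the sum there to at most 1/4; if all exceed 1/8, it must be the only edge. Hence the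
  split of the edges at 1/8. The final constant is 384 = 2 * (5 + 1) * 8 * 2 * 2: weak duality with
  capacities 2 + 2 + 1 = 5, selection from the stack, the schedule, the coin. Correctness and
  running time of the program are separate: symbolic evaluation shows that a result exists, and a
  syntactic analysis bounds the time of every derivation that exists.\<close>

locale sparse_packing =
  fixes R :: "'a \<Rightarrow> 'r set" and s :: "'r \<Rightarrow> 'a \<Rightarrow> int" and c :: "'a \<Rightarrow> int" and D :: int
begin

text \<open>Divided by \<open>D\<close>, this is the dual variable of \<open>r\<close>: a pushed
  item raises it by its gain at each of its resources.\<close>

definition amount :: "('a \<times> int) list \<Rightarrow> 'r \<Rightarrow> int" where
  "amount acc r = (\<Sum>(f, g)\<leftarrow>acc. if r \<in> R f then g else 0)"

definition price :: "('a \<times> int) list \<Rightarrow> 'a \<Rightarrow> int" where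
  "price acc e = (\<Sum>r\<in>R e. amount acc r * s r e)"

text \<open>The residual value of \<open>e\<close> once the current dual variables are charged,
  rounded down so that all numbers stay integers.\<close>

definition gain :: "('a \<times> int) list \<Rightarrow> 'a \<Rightarrow> int" where
  "gain acc e = (D * c e - price acc e) div D"

text \<open>The test against \<open>c e\<close> bounds the size of a pushed gain by that of its
  item, whatever \<open>acc\<close> contains; the time analysis of the loop relies on it.\<close>

definition push :: "('a \<times> int) list \<Rightarrow> 'a \<Rightarrow> ('a \<times> int) list" where
  "push acc e = (if 0 < gain acc e \<and> gain acc e \<le> c e then (e, gain acc e) # acc else acc)"

definition load :: "'a list \<Rightarrow> 'r \<Rightarrow> int" where
  "load S r = (\<Sum>f\<leftarrow>S. if r \<in> R f then s r f else 0)"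

text \<open>The load is tested before the insertion, so one item may carry a resource past the
  threshold.\<close>

definition pick :: "'a list \<Rightarrow> 'a \<times> int \<Rightarrow> 'a list" where
  "pick S p = (if \<forall>r \<in> R (fst p). 8 * load S r < D then fst p # S else S)"

definition stack :: "'a list \<Rightarrow> ('a \<times> int) list" where
  "stack es = foldl push [] es"

text \<open>The head of the stack is the item pushed last, so this fold unwinds in reverse order of
  pushing, as local ratio requires.\<close>

definition selection :: "'a list \<Rightarrow> 'a list" where
  "selection es = foldl pick [] (stack es)"

definition total :: "('a \<times> int) list \<Rightarrow> int" where
  "total acc = (\<Sum>(f, g)\<leftarrow>acc. g)"

lemma amount_Nil [simp]: "amount [] r = 0"
  and amount_Cons [simp]: "amount ((f, g) # acc) r = (if r \<in> R f then g else 0) + amount acc r"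
  by (simp_all add: amount_def)

lemma load_Nil [simp]: "load [] r = 0"
  and load_Cons [simp]: "load (f # S) r = (if r \<in> R f then s r f else 0) + load S r"
  by (simp_all add: load_def)

lemma total_Nil [simp]: "total [] = 0"
  and total_Cons [simp]: "total ((f, g) # acc) = g + total acc"
  by (simp_all add: total_def)

lemma stack_snoc: "stack (es @ [e]) = push (stack es) e"
  by (simp add: stack_def)

end

locale sparse_packing_nonneg = sparse_packing R s c D
  for R :: "'a \<Rightarrow> 'r set" and s :: "'r \<Rightarrow> 'a \<Rightarrow> int" and c :: "'a \<Rightarrow> int" and D :: int +
  assumes finite_R [simp]: "finite (R e)" and s_nonneg: "0 \<le> s r e" and D_pos: "0 < D"
begin

lemma load_nonneg: "0 \<le> load S r"
  by (induction S) (auto simp: s_nonneg)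

lemma price_Cons:
  "price ((f, g) # acc) e = g * (\<Sum>r\<in>R e. if r \<in> R f then s r e else 0) + price acc e"
  by (simp add: price_def distrib_right sum.distrib sum_distrib_left)
     (rule sum.cong, auto)

text \<open>Double counting of the pairs of an item of \<open>S\<close> and a resource it shares
  with \<open>f\<close>. It relates prices to the loads that \<open>pick\<close> tests.\<close>

lemma sum_price_Cons:
  "(\<Sum>h\<leftarrow>S. price ((f, g) # acc) h) = g * (\<Sum>r\<in>R f. load S r) + (\<Sum>h\<leftarrow>S. price acc h)"
proof (induction S)
  case (Cons h S)
  have "(\<Sum>r\<in>R h. if r \<in> R f then s r h else 0) = (\<Sum>r\<in>R f. if r \<in> R h then s r h else 0)"
    by (simp add: sum.inter_restrict[symmetric] Int_commute)
  with Cons show ?case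
    by (simp add: price_Cons sum.distrib algebra_simps)
qed simp

lemma stack_props:
  "\<forall>(f, g) \<in> set (stack es). 0 < g \<and> g \<le> c f \<and> f \<in> set es"
  by (induction es rule: rev_induct) (auto simp: stack_snoc stack_def push_def)

lemma amount_nonneg: "(\<forall>(f, g) \<in> set acc. 0 \<le> g) \<Longrightarrow> 0 \<le> amount acc r"
  by (induction acc) auto

lemma price_nonneg: "(\<forall>(f, g) \<in> set acc. 0 \<le> g) \<Longrightarrow> 0 \<le> price acc e"
  unfolding price_def by (intro sum_nonneg mult_nonneg_nonneg amount_nonneg s_nonneg)

lemma stack_nonneg: "\<forall>(f, g) \<in> set (stack es). 0 \<le> g"
  using stack_props[of es] by force

lemma gain_le: "gain (stack es) e \<le> c e"
proof -
  have "gain (stack es) e \<le> (D * c e) div D"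
    unfolding gain_def using price_nonneg[OF stack_nonneg] D_pos by (intro zdiv_mono1) auto
  then show ?thesis using D_pos by simp
qed

section \<open>The value of the selection against the gains on the stack\<close>

lemma gain_upper: "D * gain acc e \<le> D * c e - price acc e"
  using pos_mod_sign[OF D_pos, of "D * c e - price acc e"]
    mult_div_mod_eq[of D "D * c e - price acc e"]
  unfolding gain_def by linarith

lemma gain_lower: "D * c e - price acc e < D * gain acc e + D"
  using pos_mod_bound[OF D_pos, of "D * c e - price acc e"]
    mult_div_mod_eq[of D "D * c e - price acc e"]
  unfolding gain_def by linarith

text \<open>Keeps for each entry the inequality that held when it was pushed, so that an induction
  can remove entries from the head.\<close>

inductive priced :: "('a \<times> int) list \<Rightarrow> bool" where
  Nil: "priced []"
| Cons: "priced acc \<Longrightarrow> 0 < g \<Longrightarrow> D * g + price acc e \<le> D * c e \<Longrightarrow> priced ((e, g) # acc)"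

lemma priced_stack: "priced (stack es)"
proof (induction es rule: rev_induct)
  case (snoc e es)
  then show ?case
    using gain_upper[of "stack es" e] by (auto simp: stack_snoc push_def intro!: priced.intros)
qed (simp add: stack_def priced.Nil)

text \<open>Invariant of the unwinding, scaled by \<open>8 * D\<close>: \<open>S\<close> counts with
  its value minus the prices due to entries still to come, and every such entry promises an eighth
  of its gain. A picked item has residual value at least \<open>g\<close>. A refused one has a
  resource filled to \<open>D / 8\<close> by \<open>S\<close>, so removing its entry from the prices
  of \<open>S\<close> frees at least \<open>g / 8\<close>.\<close>

lemma pick_value:
  assumes "priced acc"
  shows "8 * D * (\<Sum>f\<leftarrow>S. c f) - 8 * (\<Sum>f\<leftarrow>S. price acc f) + D * total acc
           \<le> 8 * D * (\<Sum>f\<leftarrow>foldl pick S acc. c f)"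
  using assms
proof (induction acc arbitrary: S)
  case Nil
  then show ?case by (induction S) (auto simp: price_def)
next
  case (Cons acc g e)
  show ?case
  proof (cases "\<forall>r \<in> R e. 8 * load S r < D")
    case True
    have "0 \<le> g * (\<Sum>r\<in>R e. load S r)"
      using Cons.hyps by (intro mult_nonneg_nonneg sum_nonneg load_nonneg) auto
    moreover have "0 < D * g" using Cons.hyps D_pos by simp
    ultimately show ?thesis
      using Cons.IH[of "e # S"] Cons.hyps True
      unfolding sum_price_Cons by (simp add: pick_def algebra_simps)
  next
    case False
    then obtain r where r: "r \<in> R e" "D \<le> 8 * load S r" by force
    have "load S r \<le> (\<Sum>r\<in>R e. load S r)"
      using r by (intro member_le_sum load_nonneg) auto
    then have "g * D \<le> g * (8 * (\<Sum>r\<in>R e. load S r))"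
      using r Cons.hyps by (intro mult_left_mono) auto
    with Cons.IH[of S] False show ?thesis
      unfolding sum_price_Cons by (auto simp add: pick_def algebra_simps)
  qed
qed

lemma selection_value: "total (stack es) \<le> 8 * (\<Sum>f\<leftarrow>selection es. c f)"
proof -
  have "D * total (stack es) \<le> D * (8 * (\<Sum>f\<leftarrow>selection es. c f))"
    using pick_value[OF priced_stack, of "[]" es] by (simp add: selection_def algebra_simps)
  then show ?thesis using D_pos by (simp add: mult_le_cancel_left)
qed

section \<open>Weak duality for fractional solutions\<close>

definition mass :: "('a \<times> int) list \<Rightarrow> 'a \<Rightarrow> int" where
  "mass acc e = (\<Sum>(f, g)\<leftarrow>acc. if f = e then g else 0)"

lemma mass_Nil [simp]: "mass [] e = 0"
  and mass_Cons [simp]: "mass ((f, g) # acc) e = (if f = e then g else 0) + mass acc e"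
  by (simp_all add: mass_def)

lemma mass_nonneg: "(\<forall>(f, g) \<in> set acc. 0 \<le> g) \<Longrightarrow> 0 \<le> mass acc e"
  by (induction acc) auto

lemma price_mono:
  assumes "0 \<le> g"
  shows "price acc e \<le> price ((f, g) # acc) e"
  unfolding price_Cons using assms by (simp add: sum_nonneg s_nonneg)

text \<open>Dual feasibility up to rounding, with \<open>mass\<close> as the dual variable of the
  constraint \<open>x e \<le> 1\<close>. It holds when \<open>e\<close> is processed, where rounding
  the gain down loses less than \<open>D\<close>, and it persists because later pushes only raise
  prices and masses.\<close>

lemma stack_covers:
  "\<forall>e \<in> set es. D * c e \<le> price (stack es) e + D * mass (stack es) e + D"
proof (induction es rule: rev_induct)
  case (snoc a es)
  have m: "0 \<le> mass (stack es) a" by (rule mass_nonneg[OF stack_nonneg])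
  have new: "D * c a \<le> price (push (stack es) a) a + D * mass (push (stack es) a) a + D"
  proof (cases "0 < gain (stack es) a")
    case True
    then have "price (stack es) a \<le> price (push (stack es) a) a"
      by (auto simp: push_def intro!: price_mono)
    moreover have "gain (stack es) a \<le> mass (push (stack es) a) a"
      using True gain_le m by (auto simp: push_def)
    then have "D * gain (stack es) a \<le> D * mass (push (stack es) a) a"
      using D_pos by simp
    ultimately show ?thesis using gain_lower[of a "stack es"] by simp
  next
    case False
    then have "D * gain (stack es) a \<le> 0" using D_pos by (simp add: mult_le_0_iff)
    moreover have "0 \<le> D * mass (stack es) a" using m D_pos by simp
    ultimately show ?thesis
      using gain_lower[of a "stack es"] False by (simp add: push_def)
  qed
  moreover have "D * c e \<le> price (push (stack es) a) e + D * mass (push (stack es) a) e + D"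
    if "e \<in> set es" for e
  proof -
    have "price (stack es) e \<le> price (push (stack es) a) e"
      by (auto simp: push_def intro!: price_mono)
    moreover have "D * mass (stack es) e \<le> D * mass (push (stack es) a) e"
      using D_pos by (auto simp: push_def)
    ultimately show ?thesis using snoc that by force
  qed
  ultimately show ?case by (auto simp: stack_snoc)
qed simp

text \<open>Exchanging the sums, an entry \<open>(f, g)\<close> contributes \<open>g\<close> times
  the use that \<open>x\<close> makes of the resources of \<open>f\<close>, and this use is at most
  \<open>m * D\<close>.\<close>

lemma sum_price_bound:
  fixes x :: "'a \<Rightarrow> real" and cap :: "'r \<Rightarrow> real"
  assumes "finite E"
    and "\<And>r. (\<Sum>e \<in> {e \<in> E. r \<in> R e}. real_of_int (s r e) * x e) \<le> cap r * D"
    and "\<forall>(f, g) \<in> set acc. 0 \<le> g \<and> (\<Sum>r\<in>R f. cap r) \<le> m"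
  shows "(\<Sum>e\<in>E. x e * real_of_int (price acc e)) \<le> m * D * total acc"
  using assms(3)
proof (induction acc)
  case Nil
  then show ?case by (simp add: price_def)
next
  case (Cons p acc)
  obtain f g where p: "p = (f, g)" by force
  have "(\<Sum>e\<in>E. x e * real_of_int (price (p # acc) e))
      = g * (\<Sum>e\<in>E. \<Sum>r\<in>R e. if r \<in> R f then real_of_int (s r e) * x e else 0)
          + (\<Sum>e\<in>E. x e * real_of_int (price acc e))"
    by (simp add: p price_Cons sum.distrib sum_distrib_left algebra_simps if_distrib cong: if_cong)
  also have "(\<Sum>e\<in>E. \<Sum>r\<in>R e. if r \<in> R f then real_of_int (s r e) * x e else 0)
      = (\<Sum>e\<in>E. \<Sum>r\<in>R f. if r \<in> R e then real_of_int (s r e) * x e else 0)"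
    by (rule sum.cong[OF refl]) (simp add: sum.inter_restrict[symmetric] Int_commute)
  also have "\<dots> = (\<Sum>r\<in>R f. \<Sum>e\<in>E. if r \<in> R e then real_of_int (s r e) * x e else 0)"
    by (rule sum.swap)
  also have "\<dots> = (\<Sum>r\<in>R f. \<Sum>e \<in> {e \<in> E. r \<in> R e}. real_of_int (s r e) * x e)"
    using assms(1) by (simp add: sum.inter_filter)
  finally have eq: "(\<Sum>e\<in>E. x e * real_of_int (price (p # acc) e))
      = g * (\<Sum>r\<in>R f. \<Sum>e \<in> {e \<in> E. r \<in> R e}. real_of_int (s r e) * x e)
          + (\<Sum>e\<in>E. x e * real_of_int (price acc e))" .
  have "(\<Sum>r\<in>R f. \<Sum>e \<in> {e \<in> E. r \<in> R e}. real_of_int (s r e) * x e) \<le> (\<Sum>r\<in>R f. cap r * D)"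
    by (intro sum_mono assms(2))
  also have "\<dots> \<le> m * D"
    using Cons.prems D_pos by (auto simp: p sum_distrib_right[symmetric])
  finally have "g * (\<Sum>r\<in>R f. \<Sum>e \<in> {e \<in> E. r \<in> R e}. real_of_int (s r e) * x e) \<le> g * (m * D)"
    using Cons.prems by (intro mult_left_mono) (auto simp: p)
  with Cons show ?case unfolding eq by (simp add: p algebra_simps)
qed

lemma sum_mass:
  assumes "finite E" "fst ` set acc \<subseteq> E"
  shows "(\<Sum>e\<in>E. mass acc e) = total acc"
  using assms(2)
proof (induction acc)
  case (Cons p acc)
  obtain f g where "p = (f, g)" by force
  with Cons assms(1) show ?case by (simp add: sum.distrib)
qed simp

text \<open>
  Weak duality: the amounts are a dual solution up to the rounding error of at most one per item,
  which is at most half the value of the item as nonzero values are at least two.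
\<close>

lemma fractional_value_le:
  fixes x :: "'a \<Rightarrow> real" and cap :: "'r \<Rightarrow> real"
  assumes x: "\<And>e. e \<in> set es \<Longrightarrow> 0 \<le> x e \<and> x e \<le> 1"
    and c: "\<And>e. e \<in> set es \<Longrightarrow> c e = 0 \<or> 2 \<le> c e"
    and cap: "\<And>r. (\<Sum>e \<in> {e \<in> set es. r \<in> R e}. real_of_int (s r e) * x e) \<le> cap r * D"
    and m: "\<And>e. e \<in> set es \<Longrightarrow> (\<Sum>r\<in>R e. cap r) \<le> m"
  shows "(\<Sum>e\<in>set es. x e * real_of_int (c e)) \<le> 2 * (m + 1) * total (stack es)"
proof -
  let ?S = "stack es"
  have D: "0 < real_of_int D" using D_pos by simp
  have "D * (x e * real_of_int (c e)) \<le> 2 * (x e * real_of_int (price ?S e)) + 2 * D * mass ?S e"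
      if e: "e \<in> set es" for e
  proof (cases "c e = 0")
    case True
    have "0 \<le> price ?S e" "0 \<le> mass ?S e"
      by (rule price_nonneg[OF stack_nonneg], rule mass_nonneg[OF stack_nonneg])
    with True x[OF e] D show ?thesis by simp
  next
    case False
    have "D * c e \<le> price ?S e + D * mass ?S e + D" using stack_covers e by auto
    moreover have "D * 2 \<le> D * c e" using c[OF e] False D_pos by (intro mult_left_mono) auto
    ultimately have "D * c e \<le> 2 * price ?S e + 2 * (D * mass ?S e)" by linarith
    then have "real_of_int (D * c e) \<le> real_of_int (2 * price ?S e + 2 * (D * mass ?S e))"
      by (simp only: of_int_le_iff)
    then have "x e * (D * c e) \<le> x e * (2 * price ?S e + 2 * (D * mass ?S e))"
      using x[OF e] by (intro mult_left_mono) auto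
    also have "\<dots> = 2 * (x e * real_of_int (price ?S e)) + x e * (2 * (D * mass ?S e))"
      by (simp add: algebra_simps)
    also have "x e * (2 * (D * mass ?S e)) \<le> 1 * real_of_int (2 * (D * mass ?S e))"
      using x[OF e] D_pos mass_nonneg[OF stack_nonneg, of es e] by (intro mult_right_mono) auto
    finally show ?thesis by (simp add: algebra_simps)
  qed
  then have "(\<Sum>e\<in>set es. D * (x e * real_of_int (c e)))
      \<le> (\<Sum>e\<in>set es. 2 * (x e * real_of_int (price ?S e)) + 2 * D * mass ?S e)"
    by (rule sum_mono)
  also have "\<dots>
      = 2 * (\<Sum>e\<in>set es. x e * real_of_int (price ?S e))
          + 2 * D * real_of_int (\<Sum>e\<in>set es. mass ?S e)"
    by (simp add: sum.distrib sum_distrib_left algebra_simps)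
  also have "(\<Sum>e\<in>set es. mass ?S e) = total ?S"
    by (rule sum_mass) (use stack_props[of es] in auto)
  also have "(\<Sum>e\<in>set es. x e * real_of_int (price ?S e)) \<le> m * D * total ?S"
    by (rule sum_price_bound[where cap = cap, OF finite_set cap])
       (use stack_props[of es] m in force)
  finally have "D * (\<Sum>e\<in>set es. x e * real_of_int (c e)) \<le> D * (2 * (m + 1) * total ?S)"
    by (simp add: sum_distrib_left algebra_simps)
  then show ?thesis using D by (simp only: mult_le_cancel_left_pos)
qed

section \<open>Distinctness and load of the selection\<close>

lemma distinct_stack:
  "distinct es \<Longrightarrow> distinct (map fst (stack es))"
proof (induction es rule: rev_induct)
  case (snoc a es)
  then show ?case using stack_props[of es] by (fastforce simp: stack_snoc push_def)
qed (simp add: stack_def)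

lemma foldl_pick_sublist:
  assumes "distinct (map fst acc)" "distinct S" "fst ` set acc \<inter> set S = {}"
  shows "distinct (foldl pick S acc) \<and> set (foldl pick S acc) \<subseteq> set S \<union> fst ` set acc"
  using assms
proof (induction acc arbitrary: S)
  case (Cons p acc)
  have "distinct (pick S p)" "fst ` set acc \<inter> set (pick S p) = {}"
    using Cons.prems by (auto simp: pick_def)
  moreover have "set (pick S p) \<subseteq> insert (fst p) (set S)"
    by (auto simp: pick_def)
  ultimately show ?case using Cons.IH[of "pick S p"] Cons.prems(1) by auto
qed simp

lemma
  assumes "distinct es"
  shows selection_distinct: "distinct (selection es)"
    and selection_subset: "set (selection es) \<subseteq> set es"
proof -
  have "fst ` set (stack es) \<subseteq> set es" using stack_props[of es] by auto
  then show "distinct (selection es)" "set (selection es) \<subseteq> set es"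
    using foldl_pick_sublist[OF distinct_stack[OF assms], of "[]"] by (auto simp: selection_def)
qed

text \<open>The witness is the latest picked item that uses \<open>r\<close>: the load without it is
  the load that passed the test in \<open>pick\<close>.\<close>

lemma foldl_pick_load:
  assumes "\<forall>r. (\<exists>f\<in>set S. r \<in> R f) \<longrightarrow> (\<exists>f\<in>set S. r \<in> R f \<and> 8 * (load S r - s r f) < D)"
    "(\<exists>f\<in>set (foldl pick S acc). r \<in> R f)"
  shows "\<exists>f\<in>set (foldl pick S acc). r \<in> R f \<and> 8 * (load (foldl pick S acc) r - s r f) < D"
  using assms
proof (induction acc arbitrary: S)
  case (Cons p acc)
  show ?case
    unfolding foldl.simps
  proof (rule Cons.IH)
    show "\<forall>r. (\<exists>f\<in>set (pick S p). r \<in> R f) \<longrightarrow>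
        (\<exists>f\<in>set (pick S p). r \<in> R f \<and> 8 * (load (pick S p) r - s r f) < D)"
    proof (cases "\<forall>r \<in> R (fst p). 8 * load S r < D")
      case True
      then have S: "pick S p = fst p # S" by (simp add: pick_def)
      show ?thesis
      proof (intro allI impI)
        fix r assume "\<exists>f\<in>set (pick S p). r \<in> R f"
        then show "\<exists>f\<in>set (pick S p). r \<in> R f \<and> 8 * (load (pick S p) r - s r f) < D"
          unfolding S using True Cons.prems(1) by (cases "r \<in> R (fst p)") auto
      qed
    next
      case False
      then have "pick S p = S" by (auto simp: pick_def)
      with Cons.prems(1) show ?thesis by simp
    qed
  qed (use Cons.prems in simp)
qed simp

lemma selection_load:
  assumes "\<exists>f\<in>set (selection es). r \<in> R f"
  shows "\<exists>f\<in>set (selection es). r \<in> R f \<and> 8 * (load (selection es) r - s r f) < D"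
  using foldl_pick_load[of "[]" "stack es" r] assms by (auto simp: selection_def)

end


section \<open>An upper bound on adaptive strategies\<close>

definition incident :: "nat \<Rightarrow> edge set" where
  "incident v = {e. v \<in> endpoints e}"

lemma probed_edges_Nil [simp]: "probed_edges [] = {}"
  and probed_edges_snoc [simp]:
    "probed_edges (h @ [map (\<lambda>e. (e, X e)) M]) = probed_edges h \<union> set M"
  by (force simp: probed_edges_def)+

lemma finite_probed_edges [simp]: "finite (probed_edges h)"
  by (simp add: probed_edges_def)

section \<open>Probing an edge is independent of its presence\<close>

lemma play_answers: "(e, b) \<in> set (concat (play \<sigma> X j)) \<Longrightarrow> b = X e"
  by (induction j) (auto simp: Let_def split: if_splits)

lemma matched_edges_eq: "matched_edges (play \<sigma> X j) = {e \<in> probed_edges (play \<sigma> X j). X e}"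
  using play_answers[of _ _ \<sigma> X j] by (force simp: matched_edges_def probed_edges_def)

text \<open>The strategy learns nothing about \<open>e\<close> before probing it, so the two plays
  agree up to that round, and from then on both have probed \<open>e\<close>.\<close>

lemma play_upd:
  "(e \<in> probed_edges (play \<sigma> X j) \<and> e \<in> probed_edges (play \<sigma> (X(e := b)) j))
    \<or> (e \<notin> probed_edges (play \<sigma> X j) \<and> play \<sigma> (X(e := b)) j = play \<sigma> X j)"
proof (induction j)
  case (Suc j)
  have mono: "probed_edges (play \<sigma> Y j) \<subseteq> probed_edges (play \<sigma> Y (Suc j))" for Y
    by (auto simp: Let_def)
  from Suc show ?case
  proof (elim disjE conjE)
    assume eq: "play \<sigma> (X(e := b)) j = play \<sigma> X j" and e: "e \<notin> probed_edges (play \<sigma> X j)"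
    show ?thesis
    proof (cases "e \<in> set (\<sigma> (play \<sigma> X j))")
      case True
      then have "\<sigma> (play \<sigma> X j) \<noteq> []" by auto
      with True show ?thesis by (simp add: Let_def eq del: fun_upd_apply)
    next
      case False
      then have "map (\<lambda>f. (f, (X(e := b)) f)) (\<sigma> (play \<sigma> X j))
          = map (\<lambda>f. (f, X f)) (\<sigma> (play \<sigma> X j))"
        by auto
      with False e show ?thesis by (simp add: Let_def eq del: fun_upd_apply map_eq_conv)
    qed
  qed (use mono in blast)
qed simp

lemma probed_edges_upd:
  "e \<in> probed_edges (play \<sigma> (X(e := b)) j) \<longleftrightarrow> e \<in> probed_edges (play \<sigma> X j)"
  using play_upd[of e \<sigma> X j b] by metis

lemma prob_pair_pmf_Times:
  "measure_pmf.prob (pair_pmf M N) (A \<times> B) = measure_pmf.prob M A * measure_pmf.prob N B"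
proof -
  \<comment> \<open>Restricting to the supports makes both factors countable, as the product rule
    demands.\<close>
  have "(A \<times> B) \<inter> set_pmf (pair_pmf M N) = (A \<inter> set_pmf M) \<times> (B \<inter> set_pmf N)" by auto
  then have "measure_pmf.prob (pair_pmf M N) (A \<times> B)
      = measure_pmf.prob (pair_pmf M N) ((A \<inter> set_pmf M) \<times> (B \<inter> set_pmf N))"
    by (metis measure_Int_set_pmf)
  also have "\<dots> = measure_pmf.prob M (A \<inter> set_pmf M) * measure_pmf.prob N (B \<inter> set_pmf N)"
    by (intro measure_pmf_prob_product countable_Int2 countable_set_pmf)
  finally show ?thesis by (simp add: measure_Int_set_pmf)
qed

text \<open>The distribution is the product of the bit of \<open>e\<close> and the remaining bits,
  and \<open>Q\<close> depends on the latter alone.\<close>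

lemma prob_present_indep:
  assumes I: "valid_instance I" and e: "e \<in> set (edges I)" and Q: "\<And>X b. Q (X(e := b)) = Q X"
  shows "measure_pmf.prob (edge_pmf I) {X. X e \<and> Q X}
    = real_of_rat (present_prob I e) * measure_pmf.prob (edge_pmf I) {X. Q X}"
proof -
  let ?B = "\<lambda>e. bernoulli_pmf (real_of_rat (present_prob I e))"
  let ?F = "Pi_pmf (set (edges I) - {e}) False ?B"
  let ?upd = "\<lambda>(y, f). f(e := y)"
  have "set (edges I) = insert e (set (edges I) - {e})" using e by auto
  then have "edge_pmf I = Pi_pmf (insert e (set (edges I) - {e})) False ?B"
    by (simp add: edge_pmf_def)
  also have "\<dots> = map_pmf ?upd (pair_pmf (?B e) ?F)"
    by (rule Pi_pmf_insert) auto
  finally have eq: "edge_pmf I = map_pmf ?upd (pair_pmf (?B e) ?F)" .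
  have "0 \<le> real_of_rat (present_prob I e)" "real_of_rat (present_prob I e) \<le> 1"
    using I e by (auto simp: valid_instance_def)
  then have B: "measure_pmf.prob (?B e) {True} = real_of_rat (present_prob I e)"
    by (simp add: measure_pmf_single)
  have vim: "?upd -` {X. X e \<and> Q X} = {True} \<times> {f. Q f}" "?upd -` {X. Q X} = UNIV \<times> {f. Q f}"
    using Q by auto
  have prod: "measure_pmf.prob (pair_pmf (?B e) ?F) (A \<times> {f. Q f})
      = measure_pmf.prob (?B e) A * measure_pmf.prob ?F {f. Q f}" for A
    by (rule prob_pair_pmf_Times)
  show ?thesis
    unfolding eq measure_map_pmf vim prod B by simp
qed

lemma prob_present:
  assumes "valid_instance I" "e \<in> set (edges I)"
  shows "measure_pmf.prob (edge_pmf I) {X. X e} = real_of_rat (present_prob I e)"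
  using prob_present_indep[OF assms, of "\<lambda>_. True"] by simp

lemma prob_present2:
  assumes "valid_instance I" "e \<in> set (edges I)" "f \<in> set (edges I)" "e \<noteq> f"
  shows "measure_pmf.prob (edge_pmf I) {X. X e \<and> X f}
    = real_of_rat (present_prob I e) * real_of_rat (present_prob I f)"
  using prob_present_indep[OF assms(1,2), of "\<lambda>X. X f"] prob_present[OF assms(1,3)] assms(4) by simp

lemma expectation_edge_pmf_mono:
  fixes f g :: "(edge \<Rightarrow> bool) \<Rightarrow> real"
  assumes "\<And>X. X \<in> set_pmf (edge_pmf I) \<Longrightarrow> f X \<le> g X"
  shows "measure_pmf.expectation (edge_pmf I) f \<le> measure_pmf.expectation (edge_pmf I) g"
  by (rule integral_mono_AE)
     (auto simp: AE_measure_pmf_iff assms intro!: integrable_measure_pmf_finite finite_edge_pmf)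

lemma expectation_edge_pmf_sum:
  fixes a :: "'a \<Rightarrow> real"
  assumes "finite A"
  shows "measure_pmf.expectation (edge_pmf I) (\<lambda>X. \<Sum>e\<in>A. a e * of_bool (Q e X))
    = (\<Sum>e\<in>A. a e * measure_pmf.prob (edge_pmf I) {X. Q e X})"
proof -
  have "measure_pmf.expectation (edge_pmf I) (\<lambda>X. of_bool (Q e X) :: real)
      = measure_pmf.prob (edge_pmf I) {X. Q e X}" for e
  proof -
    have "(\<lambda>X. of_bool (Q e X) :: real) = indicator {X. Q e X}"
      by (simp add: fun_eq_iff indicator_def)
    then show ?thesis by simp
  qed
  then show ?thesis
    by (simp add: Bochner_Integration.integral_sum integrable_measure_pmf_finite finite_edge_pmf)
qed

section \<open>Invariants of feasible plays\<close>

lemma card_incident_matching: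
  assumes "matching M"
  shows "card (M \<inter> incident v) \<le> 1"
proof -
  have "e = f" if "e \<in> M \<inter> incident v" "f \<in> M \<inter> incident v" for e f
    using assms that by (auto simp: matching_def incident_def)
  then show ?thesis
    by (metis card.infinite card_le_Suc0_iff_eq One_nat_def zero_le_one)
qed

lemma num_probes_eq:
  assumes "distinct (map fst (concat h))"
  shows "num_probes h v = card (probed_edges h \<inter> incident v)"
proof -
  have "num_probes h v = length (filter (\<lambda>e. v \<in> endpoints e) (map fst (concat h)))"
    by (simp add: num_probes_def filter_map o_def case_prod_unfold)
  also have "\<dots> = card (set (filter (\<lambda>e. v \<in> endpoints e) (map fst (concat h))))"
    using assms by (intro distinct_card[symmetric] distinct_filter) auto
  also have "set (filter (\<lambda>e. v \<in> endpoints e) (map fst (concat h))) = probed_edges h \<inter> incident v"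
    by (auto simp: probed_edges_def incident_def)
  finally show ?thesis .
qed

lemma legal_round_play:
  assumes "feasible I \<sigma>" "X \<in> set_pmf (edge_pmf I)" "j < rounds I"
  shows "legal_round I (play \<sigma> X j) (\<sigma> (play \<sigma> X j))"
  using assms unfolding feasible_def reachable_def by blast

text \<open>All that is needed about feasible plays: the counts become the packing constraints in
  expectation, while distinctness and the absence of empty rounds bound the size of an encoded
  history.\<close>

definition fair_history :: "matching_instance \<Rightarrow> nat \<Rightarrow> history \<Rightarrow> bool" where
  "fair_history I j h \<longleftrightarrow>
     distinct (map fst (concat h)) \<and> [] \<notin> set h \<and> probed_edges h \<subseteq> set (edges I) \<and>
     card (probed_edges h) \<le> j * capacity I \<and>
     (\<forall>v. card (probed_edges h \<inter> incident v) \<le> j \<and> card (matched_edges h \<inter> incident v) \<le> 1 \<and>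
        (v < num_verts I \<longrightarrow> card (probed_edges h \<inter> incident v) \<le> patience I v))"

lemma fair_history_play:
  assumes "feasible I \<sigma>" "X \<in> set_pmf (edge_pmf I)" "j \<le> rounds I"
  shows "fair_history I j (play \<sigma> X j)"
  using assms(3)
proof (induction j)
  case 0
  then show ?case by (simp add: fair_history_def matched_edges_def)
next
  case (Suc j)
  let ?h = "play \<sigma> X j"
  let ?M = "\<sigma> ?h"
  have IH: "fair_history I j ?h" using Suc by simp
  have legal: "legal_round I ?h ?M" using legal_round_play[OF assms(1,2)] Suc.prems by simp
  show ?case
  proof (cases "?M = []")
    case True
    with IH show ?thesis by (auto simp: fair_history_def intro: le_SucI trans_le_add2)
  next
    case False
    define h' where "h' = ?h @ [map (\<lambda>e. (e, X e)) ?M]"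
    have play: "play \<sigma> X (Suc j) = h'" using False by (simp add: h'_def Let_def)
    have M: "matching (set ?M)" "distinct ?M" "set ?M \<subseteq> set (edges I)" "length ?M \<le> capacity I"
      and new: "set ?M \<inter> probed_edges ?h = {}"
      and free: "\<And>e v. e \<in> set ?M \<Longrightarrow> v \<in> endpoints e \<Longrightarrow>
        \<not> matched_vertex ?h v \<and> num_probes ?h v < patience I v"
      using legal by (auto simp: legal_round_def)
    have probed: "probed_edges h' = probed_edges ?h \<union> set ?M" by (simp add: h'_def)
    have dist: "distinct (map fst (concat ?h))" using IH by (simp add: fair_history_def)
    have matched: "matched_edges h' \<subseteq> matched_edges ?h \<union> set ?M"
      by (auto simp: h'_def matched_edges_def)
    have inc: "card (probed_edges h' \<inter> incident v)
        = card (probed_edges ?h \<inter> incident v) + card (set ?M \<inter> incident v)" for v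
    proof -
      have "probed_edges h' \<inter> incident v
          = (probed_edges ?h \<inter> incident v) \<union> (set ?M \<inter> incident v)"
        unfolding probed by auto
      moreover have "(probed_edges ?h \<inter> incident v) \<inter> (set ?M \<inter> incident v) = {}" using new by auto
      ultimately show ?thesis by (simp add: card_Un_disjoint)
    qed
    have M1: "card (set ?M \<inter> incident v) \<le> 1" for v
      using M(1) by (rule card_incident_matching)
    have "distinct (map fst (concat h'))"
      using dist M(2) new by (auto simp: h'_def probed_edges_def o_def)
    moreover have "[] \<notin> set h'" using IH False by (simp add: h'_def fair_history_def)
    moreover have "probed_edges h' \<subseteq> set (edges I)"
      using IH M unfolding probed by (simp add: fair_history_def)
    moreover have "card (probed_edges h') \<le> Suc j * capacity I"
      using IH M new
      by (simp add: probed card_Un_disjoint Int_commute fair_history_def distinct_card)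
    moreover have "card (probed_edges h' \<inter> incident v) \<le> Suc j" for v
    proof -
      have "card (probed_edges ?h \<inter> incident v) \<le> j" using IH by (simp add: fair_history_def)
      then show ?thesis unfolding inc using M1[of v] by linarith
    qed
    moreover have "card (matched_edges h' \<inter> incident v) \<le> 1" for v
    proof (cases "set ?M \<inter> incident v = {}")
      case True
      then have "matched_edges h' \<inter> incident v \<subseteq> matched_edges ?h \<inter> incident v"
        using matched by auto
      then have "card (matched_edges h' \<inter> incident v) \<le> card (matched_edges ?h \<inter> incident v)"
        by (intro card_mono) (auto simp: finite_matched_edges)
      also have "\<dots> \<le> 1" using IH by (simp add: fair_history_def)
      finally show ?thesis .
    next
      case False
      \<comment> \<open>A round that touches \<open>v\<close> finds it unmatched, so every matched
        edge at \<open>v\<close> belongs to this one matching.\<close>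
      then have "\<not> matched_vertex ?h v" using free by (auto simp: incident_def)
      then have "matched_edges h' \<inter> incident v \<subseteq> set ?M \<inter> incident v"
        using matched by (auto simp: matched_vertex_def incident_def)
      then have "card (matched_edges h' \<inter> incident v) \<le> card (set ?M \<inter> incident v)"
        by (intro card_mono) auto
      also have "\<dots> \<le> 1" by (rule M1)
      finally show ?thesis .
    qed
    moreover have "card (probed_edges h' \<inter> incident v) \<le> patience I v" if "v < num_verts I" for v
    proof (cases "set ?M \<inter> incident v = {}")
      case True
      then show ?thesis using that IH by (simp add: inc fair_history_def)
    next
      case False
      then have "num_probes ?h v < patience I v" using free by (auto simp: incident_def)
      then show ?thesis unfolding inc num_probes_eq[OF dist] using M1[of v] by linarith
    qed
    ultimately show ?thesis unfolding play fair_history_def by simp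
  qed
qed

section \<open>The probing probabilities as a fractional packing\<close>

definition probe_prob :: "matching_instance \<Rightarrow> strategy \<Rightarrow> edge \<Rightarrow> real" where
  "probe_prob I \<sigma> e = measure_pmf.prob (edge_pmf I) {X. e \<in> probed_edges (play \<sigma> X (rounds I))}"

lemma prob_matched:
  assumes "valid_instance I" "e \<in> set (edges I)"
  shows "measure_pmf.prob (edge_pmf I) {X. X e \<and> e \<in> probed_edges (play \<sigma> X (rounds I))}
    = real_of_rat (present_prob I e) * probe_prob I \<sigma> e"
  unfolding probe_prob_def by (rule prob_present_indep[OF assms probed_edges_upd])

lemma sum_of_bool_card:
  "finite A \<Longrightarrow> (\<Sum>e\<in>A. 1 * of_bool (Q e)) = real (card {e \<in> A. Q e})"
  by (simp add: of_bool_def sum.If_cases Int_def)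

text \<open>Linearity of expectation turns a count that holds in every outcome into a linear
  constraint on probabilities.\<close>

lemma expected_card_le:
  assumes "finite A" "\<And>X. X \<in> set_pmf (edge_pmf I) \<Longrightarrow> real (card {e \<in> A. Q e X}) \<le> b"
  shows "(\<Sum>e\<in>A. measure_pmf.prob (edge_pmf I) {X. Q e X}) \<le> b"
proof -
  have "(\<Sum>e\<in>A. 1 * measure_pmf.prob (edge_pmf I) {X. Q e X})
      = measure_pmf.expectation (edge_pmf I) (\<lambda>X. \<Sum>e\<in>A. 1 * of_bool (Q e X))"
    by (rule expectation_edge_pmf_sum[OF assms(1), symmetric])
  also have "\<dots> \<le> measure_pmf.expectation (edge_pmf I) (\<lambda>_. b)"
    unfolding sum_of_bool_card[OF assms(1)] by (rule expectation_edge_pmf_mono[OF assms(2)])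
  finally show ?thesis by simp
qed

lemma expected_weight_eq:
  assumes "valid_instance I" "feasible I \<sigma>"
  shows "expected_weight I \<sigma>
    = (\<Sum>e\<in>set (edges I). real_of_rat (weight I e * present_prob I e) * probe_prob I \<sigma> e)"
proof -
  let ?P = "\<lambda>e X. X e \<and> e \<in> probed_edges (play \<sigma> X (rounds I))"
  have "total_weight I (play \<sigma> X (rounds I))
      = (\<Sum>e\<in>set (edges I). real_of_rat (weight I e) * of_bool (?P e X))"
    if "X \<in> set_pmf (edge_pmf I)" for X
  proof -
    have "probed_edges (play \<sigma> X (rounds I)) \<subseteq> set (edges I)"
      using fair_history_play[OF assms(2) that] by (simp add: fair_history_def)
    then show ?thesis
      by (auto simp: total_weight_def matched_edges_eq of_bool_def if_distrib sum.If_cases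
          cong: if_cong intro!: sum.cong)
  qed
  then have "expected_weight I \<sigma> = measure_pmf.expectation (edge_pmf I)
      (\<lambda>X. \<Sum>e\<in>set (edges I). real_of_rat (weight I e) * of_bool (?P e X))"
    unfolding expected_weight_def by (intro antisym expectation_edge_pmf_mono) auto
  also note expectation_edge_pmf_sum[OF finite_set]
  also have "(\<Sum>e\<in>set (edges I). real_of_rat (weight I e) *
        measure_pmf.prob (edge_pmf I) {X. ?P e X})
    = (\<Sum>e\<in>set (edges I). real_of_rat (weight I e) *
      (real_of_rat (present_prob I e) * probe_prob I \<sigma> e))"
    by (simp add: prob_matched[OF assms(1)])
  finally show ?thesis by (simp add: of_rat_mult mult.assoc)
qed

lemma probe_prob_matched:
  assumes "valid_instance I" "feasible I \<sigma>"
  shows "(\<Sum>e\<in>set (edges I) \<inter> incident v. real_of_rat (present_prob I e) * probe_prob I \<sigma> e) \<le> 1"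
proof -
  have "(\<Sum>e\<in>set (edges I) \<inter> incident v. real_of_rat (present_prob I e) * probe_prob I \<sigma> e)
     = (\<Sum>e\<in>set (edges I) \<inter> incident v.
         measure_pmf.prob (edge_pmf I) {X. X e \<and> e \<in> probed_edges (play \<sigma> X (rounds I))})"
    by (rule sum.cong) (auto simp: prob_matched[OF assms(1)])
  also have "\<dots> \<le> 1"
  proof (rule expected_card_le)
    fix X assume "X \<in> set_pmf (edge_pmf I)"
    from fair_history_play[OF assms(2) this, of "rounds I"]
    have "card (matched_edges (play \<sigma> X (rounds I)) \<inter> incident v) \<le> 1"
      by (simp add: fair_history_def)
    moreover have "card {e \<in> set (edges I) \<inter> incident v.
          X e \<and> e \<in> probed_edges (play \<sigma> X (rounds I))}
        \<le> card (matched_edges (play \<sigma> X (rounds I)) \<inter> incident v)"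
      by (intro card_mono) (auto simp: matched_edges_eq)
    ultimately show "real (card {e \<in> set (edges I) \<inter> incident v.
        X e \<and> e \<in> probed_edges (play \<sigma> X (rounds I))}) \<le> 1" by linarith
  qed simp
  finally show ?thesis .
qed

lemma probe_prob_incident:
  assumes "feasible I \<sigma>" "v < num_verts I"
  shows "(\<Sum>e\<in>set (edges I) \<inter> incident v. probe_prob I \<sigma> e) \<le> real (min (patience I v) (rounds I))"
  unfolding probe_prob_def
proof (rule expected_card_le)
  fix X assume "X \<in> set_pmf (edge_pmf I)"
  from fair_history_play[OF assms(1) this, of "rounds I"] assms(2)
  have "card (probed_edges (play \<sigma> X (rounds I)) \<inter> incident v) \<le> min (patience I v) (rounds I)"
    by (simp add: fair_history_def)
  moreover have "card {e \<in> set (edges I) \<inter> incident v. e \<in> probed_edges (play \<sigma> X (rounds I))}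
      \<le> card (probed_edges (play \<sigma> X (rounds I)) \<inter> incident v)"
    by (intro card_mono) auto
  ultimately show "real (card {e \<in> set (edges I) \<inter> incident v.
      e \<in> probed_edges (play \<sigma> X (rounds I))}) \<le> real (min (patience I v) (rounds I))" by linarith
qed simp

lemma probe_prob_total:
  assumes "feasible I \<sigma>"
  shows "(\<Sum>e\<in>set (edges I). probe_prob I \<sigma> e) \<le> real (rounds I * capacity I)"
  unfolding probe_prob_def
proof (rule expected_card_le)
  fix X assume "X \<in> set_pmf (edge_pmf I)"
  from fair_history_play[OF assms(1) this, of "rounds I"]
  have "card (probed_edges (play \<sigma> X (rounds I))) \<le> rounds I * capacity I"
    by (simp add: fair_history_def)
  moreover have "card {e \<in> set (edges I). e \<in> probed_edges (play \<sigma> X (rounds I))}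
      \<le> card (probed_edges (play \<sigma> X (rounds I)))"
    by (intro card_mono) auto
  ultimately show "real (card {e \<in> set (edges I). e \<in> probed_edges (play \<sigma> X (rounds I))})
      \<le> real (rounds I * capacity I)" by linarith
qed simp


section \<open>Greedy scheduling\<close>

definition overlap :: "edge \<Rightarrow> edge \<Rightarrow> bool" where
  "overlap e f \<longleftrightarrow> endpoints e \<inter> endpoints f \<noteq> {}"

text \<open>Patience is left out on purpose: the degree bound in \<open>sparse_schedule\<close>
  ensures that it is never exhausted.\<close>

definition blocked :: "history \<Rightarrow> edge \<Rightarrow> bool" where
  "blocked h e \<longleftrightarrow> (\<exists>(f, b) \<in> set (concat h). f = e \<or> b \<and> overlap e f)"

definition extend :: "history \<Rightarrow> nat \<Rightarrow> edge list \<Rightarrow> edge \<Rightarrow> edge list" where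
  "extend h C M e =
     (if blocked h e \<or> (\<exists>f \<in> set M. overlap e f) \<or> C \<le> length M then M else e # M)"

definition greedy :: "nat \<Rightarrow> edge list \<Rightarrow> strategy" where
  "greedy C S h = foldl (extend h C) [] S"

lemma overlap_iff: "overlap e f \<longleftrightarrow> f \<in> incident (fst e) \<or> f \<in> incident (snd e)"
  by (auto simp: overlap_def incident_def endpoints_def)

lemma overlap_refl: "overlap e e"
  by (simp add: overlap_def endpoints_def)

lemma matching_insert:
  assumes "matching M" "\<And>f. f \<in> M \<Longrightarrow> \<not> overlap e f"
  shows "matching (insert e M)"
  using assms by (simp add: matching_def overlap_def Int_commute)

lemma extend_props:
  assumes "distinct M" "matching (set M)" "length M \<le> C" "\<forall>e\<in>set M. \<not> blocked h e"
  shows "distinct (extend h C M e)" "matching (set (extend h C M e))" "length (extend h C M e) \<le> C"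
    "\<forall>e\<in>set (extend h C M e). \<not> blocked h e" "set (extend h C M e) \<subseteq> insert e (set M)"
    "set M \<subseteq> set (extend h C M e)" "length M \<le> length (extend h C M e)"
    "e \<in> set (extend h C M e) \<or> blocked h e \<or> (\<exists>f \<in> set M. overlap e f) \<or> C \<le> length M"
  using assms overlap_refl[of e] by (auto simp: extend_def intro: matching_insert)

text \<open>A reason for skipping an edge stays valid since the list only grows; this yields the
  maximality of the greedy matching.\<close>

lemma foldl_extend_props:
  fixes S :: "edge list"
  assumes "distinct M" "matching (set M)" "length M \<le> C" "\<forall>e\<in>set M. \<not> blocked h e"
  defines "M' \<equiv> foldl (extend h C) M S"
  shows "distinct M' \<and> matching (set M') \<and> length M' \<le> C \<and> (\<forall>e\<in>set M'. \<not> blocked h e) \<and>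
    set M' \<subseteq> set M \<union> set S \<and> set M \<subseteq> set M' \<and> length M \<le> length M' \<and>
    (\<forall>e\<in>set S. e \<in> set M' \<or> blocked h e \<or> (\<exists>f \<in> set M'. overlap e f) \<or> C \<le> length M')"
  using assms(1-4) unfolding M'_def
proof (induction S arbitrary: M)
  case (Cons e S)
  note E = extend_props[OF Cons.prems, of e]
  note IH = Cons.IH[OF E(1-4)]
  show ?case unfolding foldl.simps
  proof (intro conjI ballI)
    fix f assume "f \<in> set (e # S)"
    then show "f \<in> set (foldl (extend h C) (extend h C M e) S) \<or> blocked h f \<or>
        (\<exists>g\<in>set (foldl (extend h C) (extend h C M e) S). overlap f g) \<or>
        C \<le> length (foldl (extend h C) (extend h C M e) S)"
      using IH E(6-8) by (cases "f = e") (blast intro: le_trans, auto)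
  qed (use IH E(5-7) in auto)
qed simp

lemma greedy_props:
  shows greedy_distinct: "distinct (greedy C S h)"
    and greedy_matching: "matching (set (greedy C S h))"
    and greedy_length: "length (greedy C S h) \<le> C"
    and greedy_not_blocked: "e \<in> set (greedy C S h) \<Longrightarrow> \<not> blocked h e"
    and greedy_subset: "set (greedy C S h) \<subseteq> set S"
    and greedy_maximal: "e \<in> set S \<Longrightarrow> e \<in> set (greedy C S h) \<or> blocked h e
      \<or> (\<exists>f \<in> set (greedy C S h). overlap e f) \<or> C \<le> length (greedy C S h)"
  using foldl_extend_props[of "[]" C h S] by (auto simp: greedy_def matching_def)

lemma not_blocked:
  assumes "\<not> blocked h e"
  shows "e \<notin> probed_edges h" "v \<in> endpoints e \<Longrightarrow> \<not> matched_vertex h v"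
  using assms by (fastforce simp: blocked_def probed_edges_def matched_vertex_def matched_edges_def
      overlap_def)+

lemma probed_edges_greedy: "probed_edges (play (greedy C S) X j) \<subseteq> set S"
  using greedy_subset by (induction j) (auto simp: Let_def)

lemma distinct_play_greedy: "distinct (map fst (concat (play (greedy C S) X j)))"
proof (induction j)
  case (Suc j)
  let ?h = "play (greedy C S) X j"
  have "set (greedy C S ?h) \<inter> probed_edges ?h = {}"
    using not_blocked(1) greedy_not_blocked by blast
  with Suc show ?case
    using greedy_distinct[of C S ?h] by (auto simp: Let_def probed_edges_def o_def)
qed simp

text \<open>The interface between packing and scheduling. The \<open>+ 8\<close> in
  \<open>degree\<close> and \<open>size\<close> admits one edge beyond an eighth of the bound,
  namely the overshoot of the selection.\<close>

locale sparse_schedule =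
  fixes I :: matching_instance and S :: "edge list"
  assumes valid: "valid_instance I"
    and distinct_S: "distinct S"
    and S_subset: "set S \<subseteq> set (edges I)"
    and degree: "v < num_verts I \<Longrightarrow>
      8 * card (set S \<inter> incident v) < min (patience I v) (rounds I) + 8"
    and size: "8 * length S < rounds I * capacity I + 8"
    and sparse: "e \<in> set S \<Longrightarrow>
      (\<Sum>f \<in> {f \<in> set S. f \<noteq> e \<and> overlap e f}. real_of_rat (present_prob I f)) \<le> 1 / 2"
begin

lemma endpoints_less: "e \<in> set S \<Longrightarrow> v \<in> endpoints e \<Longrightarrow> v < num_verts I"
  using valid S_subset by (fastforce simp: valid_instance_def endpoints_def)

lemma capacity_pos: "0 < capacity I" and rounds_pos: "0 < rounds I"
  using valid by (auto simp: valid_instance_def)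

text \<open>An edge about to be probed has not been probed before, so the probed edges at its
  endpoint are a proper subset of those in \<open>S\<close>. By \<open>degree\<close> they number
  less than an eighth of the patience.\<close>

lemma feasible_greedy: "feasible I (greedy (capacity I) S)"
  unfolding feasible_def
proof
  let ?\<sigma> = "greedy (capacity I) S"
  fix h assume "h \<in> reachable I ?\<sigma>"
  then obtain X j where h: "h = play ?\<sigma> X j" by (auto simp: reachable_def)
  have "num_probes h v < patience I v" if "e \<in> set (?\<sigma> h)" "v \<in> endpoints e" for e v
  proof -
    have e: "e \<in> set S" "e \<notin> probed_edges h"
      using that greedy_subset greedy_not_blocked not_blocked(1) by blast+
    have "card (probed_edges h \<inter> incident v) < card (set S \<inter> incident v)"
      using e that(2) probed_edges_greedy[of "capacity I" S X j]
      by (intro psubset_card_mono) (auto simp: h incident_def)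
    moreover have "0 < patience I v"
      using valid endpoints_less[OF e(1) that(2)] by (simp add: valid_instance_def)
    ultimately show ?thesis
      using degree[OF endpoints_less[OF e(1) that(2)]]
      by (simp add: num_probes_eq h distinct_play_greedy)
  qed
  then show "legal_round I h (?\<sigma> h)"
    unfolding legal_round_def
    using greedy_distinct[of "capacity I" S h] greedy_matching[of "capacity I" S h]
      greedy_length[of "capacity I" S h] greedy_subset[of "capacity I" S h] S_subset
      not_blocked[OF greedy_not_blocked] by auto
qed

text \<open>
  While an edge stays unblocked, every round either probes another edge at one of its two
  endpoints or uses the full capacity.
\<close>

lemma waiting_time:
  assumes e: "e \<in> set S" and live: "\<And>i. i \<le> j \<Longrightarrow> \<not> blocked (play (greedy (capacity I) S) X i) e"
  defines "P \<equiv> probed_edges (play (greedy (capacity I) S) X j)"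
  shows "capacity I * j \<le> capacity I * card (P \<inter> incident (fst e))
    + capacity I * card (P \<inter> incident (snd e)) + card P"
  using live unfolding P_def
proof (induction j)
  case (Suc j)
  let ?C = "capacity I"
  let ?h = "play (greedy ?C S) X j"
  let ?M = "greedy ?C S ?h"
  let ?P = "probed_edges ?h"
  have "\<not> blocked ?h e" using Suc.prems[of j] by simp
  moreover have "e \<notin> set ?M"
  proof
    assume "e \<in> set ?M"
    then have "e \<in> probed_edges (play (greedy ?C S) X (Suc j))"
      by (auto simp: Let_def)
    with not_blocked(1)[OF Suc.prems] show False by blast
  qed
  ultimately have max: "(\<exists>f \<in> set ?M. overlap e f) \<or> ?C \<le> length ?M"
    using greedy_maximal[OF e] by blast
  then have "?M \<noteq> []" using capacity_pos by auto
  then have P': "probed_edges (play (greedy ?C S) X (Suc j)) = ?P \<union> set ?M"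
    by (simp add: Let_def)
  have disj: "?P \<inter> set ?M = {}"
    using not_blocked(1) greedy_not_blocked by blast
  have card_inc: "card ((?P \<union> set ?M) \<inter> incident v)
      = card (?P \<inter> incident v) + card (set ?M \<inter> incident v)"
    for v
    using disj
    by (simp add: Int_Un_distrib2 card_Un_disjoint Int_assoc Int_left_commute disjoint_iff)
  have card: "card (?P \<union> set ?M) = card ?P + length ?M"
    using disj by (simp add: card_Un_disjoint distinct_card greedy_distinct)
  have progress: "?C \<le> ?C * card (set ?M \<inter> incident (fst e))
      + ?C * card (set ?M \<inter> incident (snd e)) + length ?M"
    using max
  proof
    assume "\<exists>f \<in> set ?M. overlap e f"
    then obtain f where "f \<in> set ?M \<inter> incident (fst e) \<or> f \<in> set ?M \<inter> incident (snd e)"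
      by (auto simp: overlap_iff)
    then have "0 < card (set ?M \<inter> incident (fst e)) \<or> 0 < card (set ?M \<inter> incident (snd e))"
      by (auto simp: card_gt_0_iff)
    then show ?thesis
      by (auto simp: gr0_conv_Suc)
  qed simp
  have IH: "?C * j
      \<le> ?C * card (?P \<inter> incident (fst e)) + ?C * card (?P \<inter> incident (snd e)) + card ?P"
    using Suc by simp
  show ?case unfolding P' card_inc card using IH progress by (simp add: algebra_simps)
qed simp

text \<open>Otherwise \<open>e\<close> stays unblocked, as no overlapping edge is present, and
  \<open>waiting_time\<close> applies to all rounds. Each of its three terms is at most an eighth of
  \<open>rounds I * capacity I\<close>, so their sum is too small.\<close>

lemma probed_if_isolated:
  assumes e: "e \<in> set S" and alone: "\<And>f. f \<in> set S \<Longrightarrow> f \<noteq> e \<Longrightarrow> overlap e f \<Longrightarrow> \<not> X f"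
  shows "e \<in> probed_edges (play (greedy (capacity I) S) X (rounds I))"
proof (rule ccontr)
  let ?h = "play (greedy (capacity I) S) X"
  let ?P = "probed_edges (?h (rounds I))"
  assume not: "e \<notin> ?P"
  have mono: "probed_edges (?h i) \<subseteq> probed_edges (?h j)" if "i \<le> j" for i j
    using that by (induction rule: dec_induct) (auto simp: Let_def)
  have "\<not> blocked (?h i) e" if "i \<le> rounds I" for i
  proof
    assume "blocked (?h i) e"
    then obtain f b where f: "(f, b) \<in> set (concat (?h i))" "f = e \<or> b \<and> overlap e f"
      unfolding blocked_def by blast
    then have "f \<in> probed_edges (?h i)" by (force simp: probed_edges_def)
    then have "f \<noteq> e" "f \<in> set S" using not mono[OF that] probed_edges_greedy by blast+
    with f play_answers[OF f(1)] alone show False by blast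
  qed
  from waiting_time[OF e this]
  have wait: "capacity I * rounds I \<le> capacity I * card (?P \<inter> incident (fst e))
    + capacity I * card (?P \<inter> incident (snd e)) + card ?P" by simp
  \<comment> \<open>The inclusion is strict because \<open>e\<close> is missing; this one edge
    cancels the \<open>+ 8\<close> in \<open>size\<close> and, at each endpoint, in
    \<open>degree\<close>.\<close>
  have sub: "?P \<subset> set S" using not e probed_edges_greedy by blast
  then have "card ?P < length S"
    using psubset_card_mono[OF finite_set sub] distinct_card[OF distinct_S] by simp
  then have "8 * card ?P < rounds I * capacity I" using size by simp
  moreover have "8 * (capacity I * card (?P \<inter> incident v)) \<le> rounds I * capacity I"
    if "v \<in> endpoints e" for v
  proof -
    have "card (?P \<inter> incident v) < card (set S \<inter> incident v)"
      using sub e not that by (intro psubset_card_mono) (auto simp: incident_def)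
    then have "8 * card (?P \<inter> incident v) \<le> rounds I"
      using degree[OF endpoints_less[OF e that]] by simp
    then have "capacity I * (8 * card (?P \<inter> incident v)) \<le> capacity I * rounds I"
      by (rule mult_le_mono2)
    then show ?thesis by (simp add: algebra_simps)
  qed
  then have "8 * (capacity I * card (?P \<inter> incident (fst e))) \<le> rounds I * capacity I"
    "8 * (capacity I * card (?P \<inter> incident (snd e))) \<le> rounds I * capacity I"
    by (simp_all add: endpoints_def)
  moreover have "0 < rounds I * capacity I" using rounds_pos capacity_pos by simp
  ultimately show False using wait unfolding mult.commute[of "capacity I" "rounds I"] by linarith
qed

lemma weight_nonneg: "e \<in> set S \<Longrightarrow> 0 \<le> real_of_rat (weight I e)"
  and prob_nonneg: "e \<in> set S \<Longrightarrow> 0 \<le> real_of_rat (present_prob I e)"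
  using valid S_subset by (auto simp: valid_instance_def)

text \<open>In every outcome the indicator that \<open>e\<close> is matched is at least
  \<open>X e\<close> minus the number of pairs of \<open>e\<close> with an overlapping present edge
  of \<open>S\<close>, by \<open>probed_if_isolated\<close>. In expectation, by independence of two
  edges, this is \<open>p e\<close> times one minus the sum in \<open>sparse\<close>, hence at least
  \<open>p e / 2\<close>.\<close>

lemma expected_weight_greedy:
  "(\<Sum>e\<in>set S. real_of_rat (weight I e * present_prob I e)) / 2
     \<le> expected_weight I (greedy (capacity I) S)"
proof -
  let ?w = "\<lambda>e. real_of_rat (weight I e)" and ?p = "\<lambda>e. real_of_rat (present_prob I e)"
  let ?N = "\<lambda>e. {f \<in> set S. f \<noteq> e \<and> overlap e f}"
  let ?h = "\<lambda>X. play (greedy (capacity I) S) X (rounds I)"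
  let ?E = "measure_pmf.expectation (edge_pmf I)"
  let ?F = "\<lambda>X. \<Sum>e\<in>set S. ?w e * of_bool (X e)"
  let ?G = "\<lambda>X. \<Sum>(e, f)\<in>Sigma (set S) ?N. ?w e * of_bool (X e \<and> X f)"
  have int: "integrable (edge_pmf I) (f :: _ \<Rightarrow> real)" for f
    by (intro integrable_measure_pmf_finite finite_edge_pmf)
  have pair: "?p e * ?p f = measure_pmf.prob (edge_pmf I) {X. X e \<and> X f}"
    if "e \<in> set S" "f \<in> set S" "f \<noteq> e" for e f
  proof -
    have "e \<in> set (edges I)" "f \<in> set (edges I)" using that S_subset by blast+
    then show ?thesis using prob_present2[OF valid, of e f] that(3) by metis
  qed
  have "(\<Sum>e\<in>set S. ?w e * (?p e * (1 / 2))) \<le> (\<Sum>e\<in>set S. ?w e * (?p e * (1 - (\<Sum>f\<in>?N e. ?p f))))"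
    using sparse by (intro sum_mono mult_left_mono weight_nonneg prob_nonneg) force
  also have "\<dots> = (\<Sum>e\<in>set S. ?w e * ?p e) - (\<Sum>(e, f)\<in>Sigma (set S) ?N. ?w e * (?p e * ?p f))"
    by (simp add: sum.Sigma[symmetric] sum_distrib_left sum_subtractf algebra_simps)
  also have "(\<Sum>e\<in>set S. ?w e * ?p e) = (\<Sum>e\<in>set S. ?w e * measure_pmf.prob (edge_pmf I) {X. X e})"
    using S_subset by (intro sum.cong refl) (auto simp: prob_present[OF valid])
  also have "\<dots> = ?E ?F"
    by (rule expectation_edge_pmf_sum[symmetric]) simp
  also have "(\<Sum>(e, f)\<in>Sigma (set S) ?N. ?w e * (?p e * ?p f))
      = (\<Sum>q\<in>Sigma (set S) ?N. ?w (fst q) *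
          measure_pmf.prob (edge_pmf I) {X. X (fst q) \<and> X (snd q)})"
  proof (rule sum.cong[OF refl])
    fix q assume q: "q \<in> Sigma (set S) ?N"
    obtain e f where "q = (e, f)" by (cases q) (blast intro: that)
    then show "(case q of (e, f) \<Rightarrow> ?w e * (?p e * ?p f))
        = ?w (fst q) * measure_pmf.prob (edge_pmf I) {X. X (fst q) \<and> X (snd q)}"
      using q pair[of e f] by (simp del: split_paired_All)
  qed
  also have "\<dots> = ?E (\<lambda>X. \<Sum>q\<in>Sigma (set S) ?N. ?w (fst q) * of_bool (X (fst q) \<and> X (snd q)))"
    by (rule expectation_edge_pmf_sum[symmetric]) simp
  also have "\<dots> = ?E ?G" by (simp add: case_prod_unfold)
  also have "?E ?F - ?E ?G = ?E (\<lambda>X. ?F X - ?G X)"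
    by (rule Bochner_Integration.integral_diff[symmetric]) (rule int)+
  also have "\<dots> \<le> ?E (\<lambda>X. total_weight I (?h X))"
  proof (rule expectation_edge_pmf_mono)
    fix X
    have "?F X - ?G X = (\<Sum>e\<in>set S. ?w e * (of_bool (X e) - (\<Sum>f\<in>?N e. of_bool (X e \<and> X f))))"
      by (simp add: sum.Sigma[symmetric] sum_subtractf sum_distrib_left algebra_simps)
    also have "\<dots> \<le> (\<Sum>e\<in>set S. ?w e * of_bool (e \<in> matched_edges (?h X)))"
    proof (intro sum_mono mult_left_mono weight_nonneg)
      fix e assume e: "e \<in> set S"
      show "of_bool (X e) - (\<Sum>f\<in>?N e. of_bool (X e \<and> X f))
          \<le> (of_bool (e \<in> matched_edges (?h X)) :: real)"
      proof (cases "X e \<and> (\<forall>f\<in>?N e. \<not> X f)")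
        case True
        then have "e \<in> probed_edges (?h X)"
          by (intro probed_if_isolated[OF e]) blast
        then have "e \<in> matched_edges (?h X)" using True by (simp add: matched_edges_eq)
        then show ?thesis using True by simp
      next
        case False
        show ?thesis
        proof (cases "X e")
          case True
          with False obtain f where f: "f \<in> ?N e" "X f" by blast
          have "(1 :: real) = of_bool (X e \<and> X f)" using True f by simp
          also have "\<dots> \<le> (\<Sum>f\<in>?N e. of_bool (X e \<and> X f))"
            using f by (intro member_le_sum) auto
          finally show ?thesis using True by simp
        qed simp
      qed
    qed
    also have "\<dots> = (\<Sum>e\<in>matched_edges (?h X). ?w e)"
      using probed_edges_greedy[of "capacity I" S X "rounds I"]
      by (auto simp: matched_edges_eq of_bool_def if_distrib sum.If_cases cong: if_cong
          intro!: sum.cong)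
    finally show "?F X - ?G X \<le> total_weight I (?h X)" by (simp add: total_weight_def)
  qed
  finally show ?thesis
    by (simp add: expected_weight_def sum_divide_distrib of_rat_mult)
qed

end


section \<open>Symbolic evaluation and polynomial time\<close>

text \<open>The relation \<open>eval\<close> without its time, as a partial function, so that
  programs can be evaluated by rewriting.\<close>

definition value_of :: "program \<Rightarrow> val list \<Rightarrow> expr \<Rightarrow> val option" where
  "value_of P env e =
     (if \<exists>v t. eval P env e v t then Some (THE v. \<exists>t. eval P env e v t) else None)"

text \<open>Not unfolded by the simplifier: rewriting with \<open>value_of_simps\<close> stops at
  calls, so recursion cannot make it diverge, and each function is specified by its own
  lemma.\<close>

definition call_value :: "program \<Rightarrow> nat \<Rightarrow> val \<Rightarrow> val option" where
  "call_value P f x = (if f < length P then value_of P [x] (P ! f) else None)"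

lemma value_of_eq_Some: "value_of P env e = Some v \<longleftrightarrow> (\<exists>t. eval P env e v t)"
proof
  show "value_of P env e = Some v" if "\<exists>t. eval P env e v t"
  proof -
    have "(THE v. \<exists>t. eval P env e v t) = v"
      using that eval_deterministic by (intro the_equality) blast+
    with that show ?thesis by (auto simp: value_of_def)
  qed
  show "\<exists>t. eval P env e v t" if "value_of P env e = Some v"
  proof -
    from that obtain w t where w: "eval P env e w t"
      by (auto simp: value_of_def split: if_splits)
    then have "(THE v. \<exists>t. eval P env e v t) = w"
      using eval_deterministic by (intro the_equality) blast+
    with that w show ?thesis by (auto simp: value_of_def split: if_splits)
  qed
qed

definition on_nums :: "(int \<Rightarrow> int \<Rightarrow> val) \<Rightarrow> val option \<Rightarrow> val option \<Rightarrow> val option" where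
  "on_nums f x y = (case (x, y) of (Some (Num i), Some (Num j)) \<Rightarrow> Some (f i j) | _ \<Rightarrow> None)"

lemma on_nums_simps [simp]: "on_nums f (Some (Num i)) (Some (Num j)) = Some (f i j)"
  by (simp add: on_nums_def)

lemma on_nums_eq_Some:
  "on_nums f x y = Some v \<longleftrightarrow> (\<exists>i j. x = Some (Num i) \<and> y = Some (Num j) \<and> v = f i j)"
  by (auto simp: on_nums_def split: option.splits val.splits)

lemma option_eqI: "(\<And>v. x = Some v \<longleftrightarrow> y = Some v) \<Longrightarrow> x = y"
  by (cases x) (auto, metis option.exhaust)

lemma case_val_eq_Some:
  "(case w of Num i \<Rightarrow> f i | Node x y \<Rightarrow> g x y) = Some v \<longleftrightarrow>
    (\<exists>i. w = Num i \<and> f i = Some v) \<or> (\<exists>x y. w = Node x y \<and> g x y = Some v)"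
  by (cases w) auto

lemma value_of_simps [simp]:
  "value_of P env (Var i) = (if i < length env then Some (env ! i) else None)"
  "value_of P env (Lit n) = Some (Num n)"
  "value_of P env (MkPair a b) =
     Option.bind (value_of P env a) (\<lambda>x. Option.bind (value_of P env b) (\<lambda>y. Some (Node x y)))"
  "value_of P env (Fst a) =
     Option.bind (value_of P env a) (\<lambda>w. case w of Node x y \<Rightarrow> Some x | Num _ \<Rightarrow> None)"
  "value_of P env (Snd a) =
     Option.bind (value_of P env a) (\<lambda>w. case w of Node x y \<Rightarrow> Some y | Num _ \<Rightarrow> None)"
  "value_of P env (IsPair a) = Option.bind (value_of P env a)
     (\<lambda>w. case w of Node x y \<Rightarrow> Some (Num 1) | Num _ \<Rightarrow> Some (Num 0))"
  "value_of P env (Plus a b) = on_nums (\<lambda>i j. Num (i + j)) (value_of P env a) (value_of P env b)"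
  "value_of P env (Minus a b) = on_nums (\<lambda>i j. Num (i - j)) (value_of P env a) (value_of P env b)"
  "value_of P env (Times a b) = on_nums (\<lambda>i j. Num (i * j)) (value_of P env a) (value_of P env b)"
  "value_of P env (Div a b) = on_nums (\<lambda>i j. Num (i div j)) (value_of P env a) (value_of P env b)"
  "value_of P env (Less a b)
      = on_nums (\<lambda>i j. truth_val (i < j)) (value_of P env a) (value_of P env b)"
  "value_of P env (IfNonzero a b c) = Option.bind (value_of P env a)
     (\<lambda>w. case w of Num i \<Rightarrow> if i \<noteq> 0 then value_of P env b else value_of P env c | Node x y \<Rightarrow> None)"
  "value_of P env (LetIn a b) = Option.bind (value_of P env a) (\<lambda>x. value_of P (x # env) b)"
  "value_of P env (Call f a) = Option.bind (value_of P env a) (call_value P f)"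
proof -
  note rules = value_of_eq_Some on_nums_eq_Some bind_eq_Some_conv case_val_eq_Some option.inject
    option.distinct eval_simps
  show "value_of P env (Var i) = (if i < length env then Some (env ! i) else None)"
    by (rule option_eqI) (auto simp: rules)
  show "value_of P env (Lit n) = Some (Num n)"
    by (rule option_eqI) (auto simp: rules)
  show "value_of P env (IsPair a) = Option.bind (value_of P env a)
     (\<lambda>w. case w of Node x y \<Rightarrow> Some (Num 1) | Num _ \<Rightarrow> Some (Num 0))"
    by (rule option_eqI) (auto simp: rules; metis val.exhaust)
  show "value_of P env (IfNonzero a b c) = Option.bind (value_of P env a)
     (\<lambda>w. case w of Num i \<Rightarrow> if i \<noteq> 0 then value_of P env b else value_of P env c | Node x y \<Rightarrow> None)"
    by (rule option_eqI) (auto simp: rules split: if_splits; blast)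
  show "value_of P env (LetIn a b) = Option.bind (value_of P env a) (\<lambda>x. value_of P (x # env) b)"
    by (rule option_eqI) (simp only: rules, blast)
  show "value_of P env (Call f a) = Option.bind (value_of P env a) (call_value P f)"
    by (rule option_eqI) (auto simp: rules call_value_def split: if_splits; blast)
qed (rule option_eqI, simp only: value_of_eq_Some on_nums_eq_Some bind_eq_Some_conv case_val_eq_Some
    option.inject option.distinct eval_simps, blast)+

lemma call_value_nonloop: "f < length P \<Longrightarrow> P ! f = e \<Longrightarrow> call_value P f x = value_of P [x] e"
  by (simp add: call_value_def)

text \<open>A loop function has one argument \<open>Node c (Node a l)\<close>, made of a fixed
  context, an accumulator and the list still to be read.\<close>

definition Ctx :: expr where "Ctx = Fst (Var 0)"
definition Acc :: expr where "Acc = Fst (Snd (Var 0))"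
definition Rest :: expr where "Rest = Snd (Snd (Var 0))"

abbreviation Head :: expr where "Head \<equiv> Fst Rest"

lemma value_of_loop_vars [simp]:
  "value_of P [Node c (Node a l)] Ctx = Some c"
  "value_of P [Node c (Node a l)] Acc = Some a"
  "value_of P [Node c (Node a l)] Rest = Some l"
  by (simp_all add: Ctx_def Acc_def Rest_def)

text \<open>A left fold as tail recursion. All recursion in the program has this shape, so one
  induction for correctness and one for time suffice.\<close>

definition loop :: "nat \<Rightarrow> expr \<Rightarrow> expr" where
  "loop f step =
     IfNonzero (IsPair Rest) (Call f (MkPair Ctx (MkPair step (Snd Rest)))) Acc"

lemma enc_list_simps [simp]:
  "enc_list f [] = Num 0" "enc_list f (x # xs) = Node (f x) (enc_list f xs)"
  by (simp_all add: enc_list_def)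

lemma call_value_loop:
  assumes P: "f < length P" "P ! f = loop f step"
    and step: "\<And>a x l. x \<in> set xs \<Longrightarrow>
      value_of P [Node c (Node (ea a) (Node (ex x) l))] step = Some (ea (g a x))"
  shows "call_value P f (Node c (Node (ea a) (enc_list ex xs))) = Some (ea (foldl g a xs))"
  using step
proof (induction xs arbitrary: a)
  case Nil
  then show ?case by (simp add: call_value_nonloop[OF P] loop_def)
next
  case (Cons x xs)
  then show ?case
    by (subst call_value_nonloop[OF P]) (simp add: loop_def)
qed

section \<open>Bit sizes and polynomial running time\<close>

lemma poly_nat_mono: "m \<le> n \<Longrightarrow> poly p m \<le> poly p n" for p :: "nat poly"
  by (induction p) (auto intro!: add_mono mult_mono)

definition env_size :: "val list \<Rightarrow> nat" where
  "env_size env = (\<Sum>v\<leftarrow>env. val_size v)"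

lemma val_size_pos: "0 < val_size v"
  by (cases v) auto

lemma nat_abs_less_floorlog: "nat \<bar>i\<bar> < 2 ^ floorlog 2 (nat \<bar>i\<bar>)"
  by (rule floorlog_leD) auto

text \<open>The carry is paid by the extra unit that every leaf counts. Such bounds keep the charge
  for an arithmetic node within the time already spent on its operands.\<close>

lemma val_size_add: "val_size (Num (i + j)) \<le> val_size (Num i) + val_size (Num j)"
proof -
  define a b where "a = floorlog 2 (nat \<bar>i\<bar>)" and "b = floorlog 2 (nat \<bar>j\<bar>)"
  have "nat \<bar>i\<bar> < 2 ^ a" "nat \<bar>j\<bar> < 2 ^ b" unfolding a_def b_def by (rule nat_abs_less_floorlog)+
  moreover have "(2::nat) ^ a \<le> 2 ^ (a + b)" "(2::nat) ^ b \<le> 2 ^ (a + b)" by simp_all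
  ultimately have "nat \<bar>i + j\<bar> < 2 ^ (1 + a + b)" unfolding power_add power_one_right by linarith
  then have "floorlog 2 (nat \<bar>i + j\<bar>) \<le> 1 + a + b" by (intro floorlog_leI) simp_all
  then show ?thesis by (simp add: a_def b_def)
qed

lemma val_size_diff: "val_size (Num (i - j)) \<le> val_size (Num i) + val_size (Num j)"
  using val_size_add[of i "- j"] by simp

lemma val_size_mult: "val_size (Num (i * j)) \<le> val_size (Num i) + val_size (Num j)"
proof -
  define a b where "a = floorlog 2 (nat \<bar>i\<bar>)" and "b = floorlog 2 (nat \<bar>j\<bar>)"
  have "nat \<bar>i\<bar> < 2 ^ a" "nat \<bar>j\<bar> < 2 ^ b" unfolding a_def b_def by (rule nat_abs_less_floorlog)+
  then have "nat \<bar>i\<bar> * nat \<bar>j\<bar> < 2 ^ a * 2 ^ b" by (intro mult_strict_mono) auto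
  then have "nat \<bar>i * j\<bar> < 2 ^ (a + b)" by (simp add: abs_mult nat_mult_distrib power_add)
  then have "floorlog 2 (nat \<bar>i * j\<bar>) \<le> a + b" by (intro floorlog_leI) simp_all
  then show ?thesis by (simp add: a_def b_def)
qed

lemma val_size_mono: "\<bar>i\<bar> \<le> \<bar>j\<bar> \<Longrightarrow> val_size (Num i) \<le> val_size (Num j)"
  by (simp add: floorlog_mono)

lemma abs_div_le: "\<bar>i div j\<bar> \<le> \<bar>i\<bar>" for i j :: int
proof -
  consider "j = 0" | "0 < j" | "j < 0" by linarith
  then show ?thesis
  proof cases
    case 2
    show ?thesis
    proof (cases "0 \<le> i")
      case True
      with 2 have "i div j \<le> i div 1" by (intro zdiv_mono2) auto
      with True 2 show ?thesis by (simp add: pos_imp_zdiv_nonneg_iff)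
    next
      case False
      with 2 have "i div 1 \<le> i div j" by (intro zdiv_mono2_neg) auto
      moreover have "i div j < 0" using False 2 by (simp add: pos_imp_zdiv_neg_iff)
      ultimately show ?thesis by simp
    qed
  next
    case 3
    have eq: "i div j = (- i) div (- j)" by simp
    show ?thesis
    proof (cases "0 \<le> - i")
      case True
      with 3 have "(- i) div (- j) \<le> (- i) div 1" by (intro zdiv_mono2) auto
      moreover have "0 \<le> (- i) div (- j)" using True 3 by (subst pos_imp_zdiv_nonneg_iff) auto
      ultimately show ?thesis using True unfolding eq by simp
    next
      case False
      with 3 have "(- i) div 1 \<le> (- i) div (- j)" by (intro zdiv_mono2_neg) auto
      moreover have "(- i) div (- j) < 0" using False 3 by (subst pos_imp_zdiv_neg_iff) auto
      ultimately show ?thesis using False unfolding eq by simp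
    qed
  qed simp
qed

lemma val_size_div: "val_size (Num (i div j)) \<le> val_size (Num i)"
  by (rule val_size_mono[OF abs_div_le])

text \<open>Only derivations that exist are bounded. Nothing is claimed about termination or typing,
  so the analysis can follow the syntax.\<close>

definition ptime :: "program \<Rightarrow> expr \<Rightarrow> bool" where
  "ptime P e \<longleftrightarrow> (\<exists>T :: nat poly. \<forall>env v t. eval P env e v t \<longrightarrow> t \<le> poly T (env_size env))"

definition fun_ptime :: "program \<Rightarrow> nat \<Rightarrow> bool" where
  "fun_ptime P f \<longleftrightarrow> (\<exists>T :: nat poly. \<forall>x y t. eval P [x] (P ! f) y t \<longrightarrow> t \<le> poly T (val_size x))"

lemma ptimeI:
  assumes "\<And>env v t. eval P env e v t \<Longrightarrow> t \<le> poly T (env_size env)"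
  shows "ptime P e"
  using assms unfolding ptime_def by blast

lemma fun_ptimeI:
  assumes "ptime P (P ! f)"
  shows "fun_ptime P f"
proof -
  obtain T where "\<And>env v t. eval P env (P ! f) v t \<Longrightarrow> t \<le> poly T (env_size env)"
    using assms unfolding ptime_def by blast
  then have "eval P [x] (P ! f) y t \<Longrightarrow> t \<le> poly T (val_size x)" for x y t
    by (force simp: env_size_def)
  then show ?thesis unfolding fun_ptime_def by blast
qed

lemma ptime_Var: "ptime P (Var i)"
proof (rule ptimeI[where T = "[:1, 1:]"])
  fix env v t assume "eval P env (Var i) v t"
  then have "t = 1 + val_size (env ! i)" "i < length env" by (auto simp: eval_simps)
  moreover have "val_size (env ! i) \<le> env_size env" if "i < length env"
    unfolding env_size_def using that by (intro member_le_sum_list) auto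
  ultimately show "t \<le> poly [:1, 1:] (env_size env)" by simp
qed

lemma ptime_Lit: "ptime P (Lit i)"
  by (rule ptimeI[where T = "[:1 + val_size (Num i):]"]) (auto simp: eval_simps)

text \<open>The charge for the result is absorbed by doubling \<open>s\<close>, since a value is
  never larger than the time spent on it.\<close>

lemma ptime_unary:
  assumes "ptime P a"
    and "\<And>env v t. eval P env e v t \<Longrightarrow> \<exists>w s. eval P env a w s \<and> t \<le> 2 * s + 2"
  shows "ptime P e"
proof -
  obtain T where T: "\<And>env v t. eval P env a v t \<Longrightarrow> t \<le> poly T (env_size env)"
    using assms(1) unfolding ptime_def by blast
  show ?thesis
  proof (rule ptimeI[where T = "[:2:] * T + [:2:]"])
    fix env v t assume "eval P env e v t"
    from assms(2)[OF this] T show "t \<le> poly ([:2:] * T + [:2:]) (env_size env)"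
      by (force simp: algebra_simps)
  qed
qed

lemma ptime_Fst: "ptime P a \<Longrightarrow> ptime P (Fst a)"
  and ptime_Snd: "ptime P a \<Longrightarrow> ptime P (Snd a)"
  and ptime_IsPair: "ptime P a \<Longrightarrow> ptime P (IsPair a)"
  by (erule ptime_unary, fastforce simp: eval_simps dest: eval_size_le_time)+

lemma ptime_binary:
  assumes "ptime P a" "ptime P b"
    and "\<And>env v t. eval P env e v t \<Longrightarrow>
      \<exists>w s w' s'. eval P env a w s \<and> eval P env b w' s' \<and> t \<le> 2 * (s + s') + 2"
  shows "ptime P e"
proof -
  obtain T where T: "\<And>env v t. eval P env a v t \<Longrightarrow> t \<le> poly T (env_size env)"
    using assms(1) unfolding ptime_def by blast
  obtain T' where T': "\<And>env v t. eval P env b v t \<Longrightarrow> t \<le> poly T' (env_size env)"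
    using assms(2) unfolding ptime_def by blast
  show ?thesis
  proof (rule ptimeI[where T = "[:2:] * (T + T') + [:2:]"])
    fix env v t assume "eval P env e v t"
    from assms(3)[OF this] obtain w s w' s' where
      "eval P env a w s" "eval P env b w' s'" "t \<le> 2 * (s + s') + 2" by blast
    with T[OF this(1)] T'[OF this(2)] show "t \<le> poly ([:2:] * (T + T') + [:2:]) (env_size env)"
      by (simp add: algebra_simps)
  qed
qed

lemma ptime_MkPair: "ptime P a \<Longrightarrow> ptime P b \<Longrightarrow> ptime P (MkPair a b)"
proof (erule (1) ptime_binary)
  fix env v t assume "eval P env (MkPair a b) v t"
  then obtain x y s s' where e: "eval P env a x s" "eval P env b y s'"
    and t: "t = s + s' + val_size (Node x y)" by (auto simp: eval_simps)
  have "t \<le> 2 * (s + s') + 2" using eval_size_le_time[OF e(1)] eval_size_le_time[OF e(2)] t by simp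
  with e show "\<exists>w s w' s'. eval P env a w s \<and> eval P env b w' s' \<and> t \<le> 2 * (s + s') + 2" by blast
qed

lemma ptime_arith:
  assumes "ptime P a" "ptime P b"
    and "\<And>env v t. eval P env e v t \<Longrightarrow> \<exists>i s j s'. eval P env a (Num i) s \<and> eval P env b (Num j) s' \<and>
      t \<le> s + s' + (val_size (Num i) + val_size (Num j))"
  shows "ptime P e"
proof (rule ptime_binary[OF assms(1,2)])
  fix env v t assume "eval P env e v t"
  from assms(3)[OF this] obtain i s j s' where e: "eval P env a (Num i) s" "eval P env b (Num j) s'"
    and t: "t \<le> s + s' + (val_size (Num i) + val_size (Num j))" by blast
  have "t \<le> 2 * (s + s') + 2" using eval_size_le_time[OF e(1)] eval_size_le_time[OF e(2)] t by simp
  with e show "\<exists>w s w' s'. eval P env a w s \<and> eval P env b w' s' \<and> t \<le> 2 * (s + s') + 2" by blast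
qed

lemma ptime_Plus: "ptime P a \<Longrightarrow> ptime P b \<Longrightarrow> ptime P (Plus a b)"
proof (erule (1) ptime_arith)
  fix env v t assume "eval P env (Plus a b) v t"
  then obtain i s j s' where "eval P env a (Num i) s" "eval P env b (Num j) s'"
    "t = s + s' + val_size (Num (i + j))" by (auto simp: eval_simps)
  with val_size_add[of i j] show "\<exists>i s j s'. eval P env a (Num i) s \<and> eval P env b (Num j) s' \<and>
      t \<le> s + s' + (val_size (Num i) + val_size (Num j))" by (metis add_left_mono)
qed

lemma ptime_Minus: "ptime P a \<Longrightarrow> ptime P b \<Longrightarrow> ptime P (Minus a b)"
proof (erule (1) ptime_arith)
  fix env v t assume "eval P env (Minus a b) v t"
  then obtain i s j s' where "eval P env a (Num i) s" "eval P env b (Num j) s'"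
    "t = s + s' + val_size (Num (i - j))" by (auto simp: eval_simps)
  with val_size_diff[of i j] show "\<exists>i s j s'. eval P env a (Num i) s \<and> eval P env b (Num j) s' \<and>
      t \<le> s + s' + (val_size (Num i) + val_size (Num j))" by (metis add_left_mono)
qed

lemma ptime_Times: "ptime P a \<Longrightarrow> ptime P b \<Longrightarrow> ptime P (Times a b)"
proof (erule (1) ptime_arith)
  fix env v t assume "eval P env (Times a b) v t"
  then obtain i s j s' where "eval P env a (Num i) s" "eval P env b (Num j) s'"
    "t = s + s' + val_size (Num (i * j))" by (auto simp: eval_simps)
  with val_size_mult[of i j] show "\<exists>i s j s'. eval P env a (Num i) s \<and> eval P env b (Num j) s' \<and>
      t \<le> s + s' + (val_size (Num i) + val_size (Num j))" by (metis add_left_mono)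
qed

lemma ptime_Div: "ptime P a \<Longrightarrow> ptime P b \<Longrightarrow> ptime P (Div a b)"
proof (erule (1) ptime_arith)
  fix env v t assume "eval P env (Div a b) v t"
  then obtain i s j s' where "eval P env a (Num i) s" "eval P env b (Num j) s'"
    "t = s + s' + val_size (Num (i div j))" by (auto simp: eval_simps)
  with val_size_div[of i j] show "\<exists>i s j s'. eval P env a (Num i) s \<and> eval P env b (Num j) s' \<and>
      t \<le> s + s' + (val_size (Num i) + val_size (Num j))" by (metis add_left_mono trans_le_add1)
qed

lemma ptime_Less: "ptime P a \<Longrightarrow> ptime P b \<Longrightarrow> ptime P (Less a b)"
proof (erule (1) ptime_arith)
  fix env v t assume "eval P env (Less a b) v t"
  then obtain i s j s' where "eval P env a (Num i) s" "eval P env b (Num j) s'"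
    "t = s + s' + 2" by (auto simp: eval_simps)
  moreover have "2 \<le> val_size (Num i) + val_size (Num j)" by simp
  ultimately show "\<exists>i s j s'. eval P env a (Num i) s \<and> eval P env b (Num j) s' \<and>
      t \<le> s + s' + (val_size (Num i) + val_size (Num j))" by (metis add_left_mono)
qed

lemma ptime_IfNonzero:
  assumes "ptime P a" "ptime P b" "ptime P c"
  shows "ptime P (IfNonzero a b c)"
proof -
  obtain T where T: "\<And>env v t. eval P env a v t \<Longrightarrow> t \<le> poly T (env_size env)"
    using assms(1) unfolding ptime_def by blast
  obtain T' where T': "\<And>env v t. eval P env b v t \<Longrightarrow> t \<le> poly T' (env_size env)"
    using assms(2) unfolding ptime_def by blast
  obtain T'' where T'': "\<And>env v t. eval P env c v t \<Longrightarrow> t \<le> poly T'' (env_size env)"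
    using assms(3) unfolding ptime_def by blast
  show ?thesis
  proof (rule ptimeI[where T = "T + T' + T'' + [:1:]"])
    fix env v t assume "eval P env (IfNonzero a b c) v t"
    then obtain w s s' where "eval P env a w s" "eval P env b v s' \<or> eval P env c v s'"
      "t = s + s' + 1"
      by (auto simp: eval_simps)
    with T[OF this(1)] T'[of env v s'] T''[of env v s']
    show "t \<le> poly (T + T' + T'' + [:1:]) (env_size env)" by auto
  qed
qed

text \<open>The bound value is at most as large as the time that produced it, so the polynomials
  compose.\<close>

lemma ptime_LetIn:
  assumes "ptime P a" "ptime P b"
  shows "ptime P (LetIn a b)"
proof -
  obtain T where T: "\<And>env v t. eval P env a v t \<Longrightarrow> t \<le> poly T (env_size env)"
    using assms(1) unfolding ptime_def by blast
  obtain T' where T': "\<And>env v t. eval P env b v t \<Longrightarrow> t \<le> poly T' (env_size env)"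
    using assms(2) unfolding ptime_def by blast
  show ?thesis
  proof (rule ptimeI[where T = "T + pcompose T' (T + [:0, 1:]) + [:1:]"])
    fix env v t assume "eval P env (LetIn a b) v t"
    then obtain w s s' where e: "eval P env a w s" "eval P (w # env) b v s'" "t = s + s' + 1"
      by (auto simp: eval_simps)
    have "env_size (w # env) \<le> poly (T + [:0, 1:]) (env_size env)"
      using eval_size_le_time[OF e(1)] T[OF e(1)] by (simp add: env_size_def)
    from order_trans[OF T'[OF e(2)] poly_nat_mono[OF this]] T[OF e(1)] e(3)
    show "t \<le> poly (T + pcompose T' (T + [:0, 1:]) + [:1:]) (env_size env)"
      by (simp add: poly_pcompose)
  qed
qed

lemma ptime_Call:
  assumes "ptime P a" "fun_ptime P f"
  shows "ptime P (Call f a)"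
proof -
  obtain T where T: "\<And>env v t. eval P env a v t \<Longrightarrow> t \<le> poly T (env_size env)"
    using assms(1) unfolding ptime_def by blast
  obtain T' where T': "\<And>x y t. eval P [x] (P ! f) y t \<Longrightarrow> t \<le> poly T' (val_size x)"
    using assms(2) unfolding fun_ptime_def by blast
  show ?thesis
  proof (rule ptimeI[where T = "T + pcompose T' T + [:1:]"])
    fix env v t assume "eval P env (Call f a) v t"
    then obtain w s s' where e: "eval P env a w s" "eval P [w] (P ! f) v s'" "t = s + s' + 1"
      by (auto simp: eval_simps)
    have "val_size w \<le> poly T (env_size env)"
      using eval_size_le_time[OF e(1)] T[OF e(1)] by simp
    from order_trans[OF T'[OF e(2)] poly_nat_mono[OF this]] T[OF e(1)] e(3)
    show "t \<le> poly (T + pcompose T' T + [:1:]) (env_size env)"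
      by (simp add: poly_pcompose)
  qed
qed

section \<open>Growth of accumulators and running time of loops\<close>

lemma ptime_loop_vars: "ptime P Ctx" "ptime P Acc" "ptime P Rest"
  unfolding Ctx_def Acc_def Rest_def by (intro ptime_Fst ptime_Snd ptime_Var)+

lemmas ptime_intros =
  ptime_loop_vars ptime_Var ptime_Lit ptime_MkPair ptime_Fst ptime_Snd ptime_IsPair
  ptime_Plus ptime_Minus ptime_Times ptime_Div ptime_Less ptime_IfNonzero ptime_LetIn ptime_Call

text \<open>
  The sizes of the accumulators of a loop stay polynomial if each step adds to the size an amount
  that does not depend on the accumulator.
\<close>

definition small :: "program \<Rightarrow> expr \<Rightarrow> bool" where
  "small P e \<longleftrightarrow> (\<exists>q :: nat poly. \<forall>c a l v t. eval P [Node c (Node a l)] e v t \<longrightarrow>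
     val_size v \<le> poly q (val_size c + val_size l))"

definition acc_additive :: "program \<Rightarrow> expr \<Rightarrow> bool" where
  "acc_additive P e \<longleftrightarrow> (\<exists>q :: nat poly. \<forall>c a l v t. eval P [Node c (Node a l)] e v t \<longrightarrow>
     val_size v \<le> val_size a + poly q (val_size c + val_size l))"

lemma smallI:
  assumes "\<And>c a l v t. eval P [Node c (Node a l)] e v t \<Longrightarrow> val_size v
      \<le> poly q (val_size c + val_size l)"
  shows "small P e"
  using assms unfolding small_def by blast

lemma acc_additiveI:
  assumes "\<And>c a l v t. eval P [Node c (Node a l)] e v t \<Longrightarrow>
    val_size v \<le> val_size a + poly q (val_size c + val_size l)"
  shows "acc_additive P e"
  using assms unfolding acc_additive_def by blast

lemma eval_loop_vars:
  "eval P [Node c (Node a l)] Ctx v t \<Longrightarrow> v = c"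
  "eval P [Node c (Node a l)] Acc v t \<Longrightarrow> v = a"
  "eval P [Node c (Node a l)] Rest v t \<Longrightarrow> v = l"
  by (auto simp: Ctx_def Acc_def Rest_def eval_simps)

lemma small_Ctx: "small P Ctx" and small_Rest: "small P Rest"
  by (rule smallI[where q = "[:0, 1:]"], auto dest: eval_loop_vars)+

lemma small_Lit: "small P (Lit i)"
  by (rule smallI[where q = "[:val_size (Num i):]"]) (auto simp: eval_simps)

lemma small_unary:
  assumes "small P a"
    and "\<And>env v t. eval P env e v t \<Longrightarrow> \<exists>w s. eval P env a w s \<and> val_size v \<le> val_size w"
  shows "small P e"
proof -
  obtain q where q: "\<And>c b l v t. eval P [Node c (Node b l)] a v t \<Longrightarrow>
    val_size v \<le> poly q (val_size c + val_size l)" using assms(1) unfolding small_def by blast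
  show ?thesis
  proof (rule smallI[where q = q])
    fix c b l v t assume "eval P [Node c (Node b l)] e v t"
    from assms(2)[OF this] obtain w s where "eval P [Node c (Node b l)] a w s"
      "val_size v \<le> val_size w"
      by blast
    with q[OF this(1)] show "val_size v \<le> poly q (val_size c + val_size l)" by simp
  qed
qed

lemma small_Fst: "small P a \<Longrightarrow> small P (Fst a)" and small_Snd: "small P a \<Longrightarrow> small P (Snd a)"
  by (erule small_unary, fastforce simp: eval_simps)+

lemma small_binary:
  assumes "small P a" "small P b"
    and "\<And>env v t. eval P env e v t \<Longrightarrow> \<exists>w s w' s'. eval P env a w s \<and> eval P env b w' s' \<and>
      val_size v \<le> 1 + val_size w + val_size w'"
  shows "small P e"
proof -
  obtain q where q: "\<And>c x l v t. eval P [Node c (Node x l)] a v t \<Longrightarrow>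
    val_size v \<le> poly q (val_size c + val_size l)" using assms(1) unfolding small_def by blast
  obtain q' where q': "\<And>c x l v t. eval P [Node c (Node x l)] b v t \<Longrightarrow>
    val_size v \<le> poly q' (val_size c + val_size l)" using assms(2) unfolding small_def by blast
  show ?thesis
  proof (rule smallI[where q = "q + q' + [:1:]"])
    fix c x l v t assume "eval P [Node c (Node x l)] e v t"
    from assms(3)[OF this] obtain w s w' s' where "eval P [Node c (Node x l)] a w s"
      "eval P [Node c (Node x l)] b w' s'" "val_size v \<le> 1 + val_size w + val_size w'" by blast
    with q[OF this(1)] q'[OF this(2)]
    show "val_size v \<le> poly (q + q' + [:1:]) (val_size c + val_size l)" by simp
  qed
qed

lemma small_MkPair: "small P a \<Longrightarrow> small P b \<Longrightarrow> small P (MkPair a b)"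
  by (erule (1) small_binary) (force simp: eval_simps)

lemma small_Times: "small P a \<Longrightarrow> small P b \<Longrightarrow> small P (Times a b)"
proof (erule (1) small_binary)
  fix env v t assume "eval P env (Times a b) v t"
  then obtain i s j s' where "eval P env a (Num i) s" "eval P env b (Num j) s'" "v = Num (i * j)"
    unfolding eval_simps by blast
  with val_size_mult[of i j] show "\<exists>w s w' s'. eval P env a w s \<and> eval P env b w' s' \<and>
      val_size v \<le> 1 + val_size w + val_size w'" by (metis add.assoc le_add2 order_trans)
qed

lemma small_IfNonzero:
  assumes "small P b" "small P d"
  shows "small P (IfNonzero a b d)"
proof -
  obtain q where q: "\<And>c x l v t. eval P [Node c (Node x l)] b v t \<Longrightarrow>
    val_size v \<le> poly q (val_size c + val_size l)" using assms(1) unfolding small_def by blast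
  obtain q' where q': "\<And>c x l v t. eval P [Node c (Node x l)] d v t \<Longrightarrow>
    val_size v \<le> poly q' (val_size c + val_size l)" using assms(2) unfolding small_def by blast
  show ?thesis
    by (rule smallI[where q = "q + q'"]) (auto simp: eval_simps dest!: q q')
qed

lemma small_Call:
  assumes "small P a" "fun_ptime P f"
  shows "small P (Call f a)"
proof -
  obtain q where q: "\<And>c x l v t. eval P [Node c (Node x l)] a v t \<Longrightarrow>
    val_size v \<le> poly q (val_size c + val_size l)" using assms(1) unfolding small_def by blast
  obtain T where T: "\<And>x y t. eval P [x] (P ! f) y t \<Longrightarrow> t \<le> poly T (val_size x)"
    using assms(2) unfolding fun_ptime_def by blast
  show ?thesis
  proof (rule smallI[where q = "pcompose T q"])
    fix c x l v t assume "eval P [Node c (Node x l)] (Call f a) v t"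
    then obtain w s s' where e: "eval P [Node c (Node x l)] a w s" "eval P [w] (P ! f) v s'"
      by (auto simp: eval_simps)
    from eval_size_le_time[OF e(2)] T[OF e(2)] poly_nat_mono[OF q[OF e(1)], of T]
    show "val_size v \<le> poly (pcompose T q) (val_size c + val_size l)" by (simp add: poly_pcompose)
  qed
qed

lemma acc_additive_small:
  assumes "small P e"
  shows "acc_additive P e"
proof -
  obtain q where q: "\<And>c x l v t. eval P [Node c (Node x l)] e v t \<Longrightarrow>
    val_size v \<le> poly q (val_size c + val_size l)" using assms unfolding small_def by blast
  show ?thesis by (rule acc_additiveI[where q = q]) (simp add: q trans_le_add2)
qed

lemma acc_additive_Acc: "acc_additive P Acc"
  by (rule acc_additiveI[where q = 0]) (auto dest: eval_loop_vars)

lemma acc_additive_Lit: "acc_additive P (Lit i)"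
  by (intro acc_additive_small small_Lit)

text \<open>The test may inspect the accumulator freely, because it affects the size only through
  the choice of the branch.\<close>

lemma acc_additive_IfNonzero:
  assumes "acc_additive P b" "acc_additive P d"
  shows "acc_additive P (IfNonzero a b d)"
proof -
  obtain q where q: "\<And>c x l v t. eval P [Node c (Node x l)] b v t \<Longrightarrow>
    val_size v \<le> val_size x + poly q (val_size c + val_size l)"
        using assms(1) unfolding acc_additive_def by blast
  obtain q' where q': "\<And>c x l v t. eval P [Node c (Node x l)] d v t \<Longrightarrow>
    val_size v \<le> val_size x + poly q' (val_size c + val_size l)"
        using assms(2) unfolding acc_additive_def by blast
  show ?thesis
    by (rule acc_additiveI[where q = "q + q'"]) (auto simp: eval_simps dest!: q q')
qed

lemma acc_additive_binary:
  assumes "small P a" "acc_additive P b"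
    and "\<And>env v t. eval P env e v t \<Longrightarrow> \<exists>w s w' s'. eval P env a w s \<and> eval P env b w' s' \<and>
      val_size v \<le> 1 + val_size w + val_size w'"
  shows "acc_additive P e"
proof -
  obtain q where q: "\<And>c x l v t. eval P [Node c (Node x l)] a v t \<Longrightarrow>
    val_size v \<le> poly q (val_size c + val_size l)" using assms(1) unfolding small_def by blast
  obtain q' where q': "\<And>c x l v t. eval P [Node c (Node x l)] b v t \<Longrightarrow>
    val_size v \<le> val_size x + poly q' (val_size c + val_size l)"
        using assms(2) unfolding acc_additive_def by blast
  show ?thesis
  proof (rule acc_additiveI[where q = "q + q' + [:1:]"])
    fix c x l v t assume "eval P [Node c (Node x l)] e v t"
    from assms(3)[OF this] obtain w s w' s' where "eval P [Node c (Node x l)] a w s"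
      "eval P [Node c (Node x l)] b w' s'" "val_size v \<le> 1 + val_size w + val_size w'" by blast
    with q[OF this(1)] q'[OF this(2)]
    show "val_size v \<le> val_size x + poly (q + q' + [:1:]) (val_size c + val_size l)" by simp
  qed
qed

lemma acc_additive_MkPair: "small P a \<Longrightarrow> acc_additive P b \<Longrightarrow> acc_additive P (MkPair a b)"
  by (erule (1) acc_additive_binary) (force simp: eval_simps)

lemma acc_additive_Plus: "small P a \<Longrightarrow> acc_additive P b \<Longrightarrow> acc_additive P (Plus a b)"
proof (erule (1) acc_additive_binary)
  fix env v t assume "eval P env (Plus a b) v t"
  then obtain i s j s' where "eval P env a (Num i) s" "eval P env b (Num j) s'" "v = Num (i + j)"
    unfolding eval_simps by blast
  with val_size_add[of i j] show "\<exists>w s w' s'. eval P env a w s \<and> eval P env b w' s' \<and>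
      val_size v \<le> 1 + val_size w + val_size w'" by (metis add.assoc le_add2 order_trans)
qed

text \<open>Multiplying by a small factor only adds bits, so a running product such as the common
  denominator is admissible.\<close>

lemma acc_additive_Times: "small P a \<Longrightarrow> acc_additive P b \<Longrightarrow> acc_additive P (Times a b)"
proof (erule (1) acc_additive_binary)
  fix env v t assume "eval P env (Times a b) v t"
  then obtain i s j s' where "eval P env a (Num i) s" "eval P env b (Num j) s'" "v = Num (i * j)"
    unfolding eval_simps by blast
  with val_size_mult[of i j] show "\<exists>w s w' s'. eval P env a w s \<and> eval P env b w' s' \<and>
      val_size v \<le> 1 + val_size w + val_size w'" by (metis add.assoc le_add2 order_trans)
qed

lemmas acc_additive_intros = acc_additive_Acc acc_additive_Lit acc_additive_IfNonzero
  acc_additive_MkPair acc_additive_Plus acc_additive_Times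

lemmas small_intros = small_Ctx small_Rest small_Lit small_Fst small_Snd small_MkPair small_Times
  small_IfNonzero small_Call

text \<open>In \<open>bound\<close>, \<open>m\<close> covers the current sizes plus a reserve of one
  growth term of \<open>q\<close> per unit of list size. Reading a list node releases enough reserve
  for one step, so \<open>m\<close> stays valid through the recursion. An iteration then costs at
  most \<open>G m\<close>, and there are at most \<open>val_size l\<close> of them.\<close>

lemma fun_ptime_loop:
  assumes P: "P ! f = loop f step" and step: "ptime P step" "acc_additive P step"
  shows "fun_ptime P f"
proof -
  let ?test = "IsPair Rest" and ?next = "MkPair Ctx (MkPair step (Snd Rest))"
  have "ptime P ?test" "ptime P ?next" "ptime P Acc" using step(1) by (auto intro: ptime_intros)
  then obtain T1 T2 T3 where
    T1: "\<And>env v t. eval P env ?test v t \<Longrightarrow> t \<le> poly T1 (env_size env)" and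
    T2: "\<And>env v t. eval P env ?next v t \<Longrightarrow> t \<le> poly T2 (env_size env)" and
    T3: "\<And>env v t. eval P env Acc v t \<Longrightarrow> t \<le> poly T3 (env_size env)"
    unfolding ptime_def by blast
  obtain q where q: "\<And>c a l v t. eval P [Node c (Node a l)] step v t \<Longrightarrow>
    val_size v \<le> val_size a + poly q (val_size c + val_size l)"
        using step(2) unfolding acc_additive_def by blast
  define G where "G m = poly T1 (m + 2) + poly T2 (m + 2) + poly T3 (m + 2) + 2" for m
  have bound: "t \<le> val_size l * G m"
    if "eval P [Node c (Node a l)] (loop f step) y t"
      "val_size c + val_size a + val_size l
        + val_size l * poly q (val_size c + val_size l) \<le> m"
    for c a l y t m
    using that
  proof (induction l arbitrary: a t)
    case (Num i)
    let ?env = "[Node c (Node a (Num i))]"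
    obtain s s' where e: "eval P ?env ?test (Num 0) s" "eval P ?env Acc y s'" "t = s + s' + 1"
      using Num.prems(1) by (auto simp: loop_def eval_simps dest: eval_loop_vars)
    have "env_size ?env \<le> m + 2" using Num.prems(2) by (simp add: env_size_def)
    then have "t \<le> G m"
      using T1[OF e(1)] T3[OF e(2)] poly_nat_mono[of "env_size ?env" "m + 2" T1]
        poly_nat_mono[of "env_size ?env" "m + 2" T3] e(3)
      unfolding G_def by linarith
    also have "\<dots> \<le> val_size (Num i) * G m" using val_size_pos[of "Num i"] by simp
    finally show ?case .
  next
    case (Node h l)
    let ?env = "[Node c (Node a (Node h l))]"
    obtain i s r' where i: "eval P ?env ?test (Num i) s" "t = s + r' + 1"
        "(i \<noteq> 0 \<and> eval P ?env (Call f ?next) y r') \<or> (i = 0 \<and> eval P ?env Acc y r')"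
      using Node.prems(1) unfolding loop_def eval_simps(12) by fastforce
    from i(1) have "i = 1" by (auto simp: eval_simps dest!: eval_loop_vars)
    with i(3) obtain x s' r where "eval P ?env ?next x s'" "eval P [x] (P ! f) y r"
      "r' = s' + r + 1"
      unfolding eval_simps(14) by auto
    with i have e: "eval P ?env ?test (Num i) s" "eval P ?env ?next x s'"
        "eval P [x] (P ! f) y r" "t = s + (s' + r + 1) + 1" by auto
    obtain a' t' where x: "x = Node c (Node a' l)" and a': "eval P ?env step a' t'"
      using e(2) by (auto simp: eval_simps dest!: eval_loop_vars)
    let ?Q = "poly q (val_size c + val_size (Node h l))"
    have size: "val_size l + 1 \<le> val_size (Node h l)" by simp
    have "poly q (val_size c + val_size l) \<le> ?Q" by (rule poly_nat_mono) simp
    then have "val_size l * poly q (val_size c + val_size l) \<le> val_size l * ?Q"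
        by (rule mult_le_mono2)
    moreover have "?Q + val_size l * ?Q \<le> val_size (Node h l) * ?Q" by (simp add: add_mult_distrib)
    ultimately have "val_size c + val_size a' + val_size l
        + val_size l * poly q (val_size c + val_size l) \<le> m"
      using q[OF a'] Node.prems(2) size by linarith
    then have r: "r \<le> val_size l * G m" using Node.IH(2) e(3) x P by auto
    have env: "env_size ?env \<le> m + 2" using Node.prems(2) by (simp add: env_size_def)
    have "s + s' + 2 \<le> G m"
      using T1[OF e(1)] T2[OF e(2)] poly_nat_mono[OF env, of T1] poly_nat_mono[OF env, of T2]
      unfolding G_def by linarith
    then have "t \<le> G m + val_size l * G m" using r e(4) by simp
    also have "\<dots> \<le> val_size (Node h l) * G m" by (simp add: add_mult_distrib)
    finally show ?case .
  qed
  \<comment> \<open>For an input of size \<open>n\<close>, sizes and reserve together are at most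
    \<open>n + n * q n\<close>.\<close>
  define M where "M = [:0, 1:] + [:0, 1:] * q"
  define T where "T = [:0, 1:] * pcompose (T1 + T2 + T3 + [:2:]) (M + [:2:])"
  have "t \<le> poly T (val_size x)" if "eval P [x] (P ! f) y t" for x y t
  proof -
    from that obtain i s where "eval P [x] ?test (Num i) s"
      unfolding P loop_def eval_simps(12) by blast
    then obtain c a l where x: "x = Node c (Node a l)"
      by (auto simp: Rest_def eval_simps)
    let ?n = "val_size x"
    have "val_size l * poly q (val_size c + val_size l) \<le> ?n * poly q ?n"
      by (intro mult_le_mono poly_nat_mono) (simp_all add: x)
    then have "val_size c + val_size a + val_size l
        + val_size l * poly q (val_size c + val_size l) \<le> poly M ?n"
      by (simp add: M_def x)
    from bound[OF _ this] that have "t \<le> val_size l * G (poly M ?n)" by (simp add: x P)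
    also have "\<dots> \<le> ?n * G (poly M ?n)" by (rule mult_le_mono1) (simp add: x)
    also have "\<dots> = poly T ?n" by (simp add: T_def G_def poly_pcompose)
    finally show ?thesis .
  qed
  then show ?thesis unfolding fun_ptime_def by blast
qed


section \<open>The program\<close>

type_synonym item = "edge \<times> (nat \<times> nat) \<times> (nat \<times> int)"

text \<open>
  \<open>Some v\<close> is the resource of the vertex \<open>v\<close> and \<open>None\<close> stands for the bound \<open>k * C\<close> on the number
  of probed edges; in the program \<open>None\<close> is the number \<open>-1\<close>.
\<close>

fun resources :: "item \<Rightarrow> nat option set" where
  "resources ((u, v), _) = {None, Some u, Some v}"

fun item_size :: "nat option \<Rightarrow> item \<Rightarrow> int" where
  "item_size None ((u, v), (su, sv), (sz, c)) = int sz"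
| "item_size (Some w) ((u, v), (su, sv), (sz, c)) =
     (if w = u then int su else if w = v then int sv else 0)"

definition item_value :: "item \<Rightarrow> int" where
  "item_value = (\<lambda>(_, _, _, c). c)"

definition "f_lookup = (1::nat)"
definition "f_bound = (2::nat)"
definition "f_scale = (3::nat)"
definition "f_item = (4::nat)"
definition "f_items = (5::nat)"
definition "f_uses = (6::nat)"
definition "f_size = (7::nat)"
definition "f_amount = (8::nat)"
definition "f_load = (9::nat)"
definition "f_gain = (10::nat)"
definition "f_stack = (11::nat)"
definition "f_selection = (12::nat)"
definition "f_touch = (13::nat)"
definition "f_touches = (14::nat)"
definition "f_blocked = (15::nat)"
definition "f_meets = (16::nat)"
definition "f_length = (17::nat)"
definition "f_greedy = (18::nat)"

lemmas f_defs = f_lookup_def f_bound_def f_scale_def f_item_def f_items_def f_uses_def f_size_def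
  f_amount_def f_load_def f_gain_def f_stack_def f_selection_def f_touch_def f_touches_def
  f_blocked_def f_meets_def f_length_def f_greedy_def

definition call2 :: "nat \<Rightarrow> expr \<Rightarrow> expr \<Rightarrow> expr" where
  "call2 f a b = Call f (MkPair a b)"
definition run :: "nat \<Rightarrow> expr \<Rightarrow> expr \<Rightarrow> expr \<Rightarrow> expr" where
  "run f c a l = Call f (MkPair c (MkPair a l))"

text \<open>The accumulator counts the index down to \<open>0\<close>, then it holds the entry found, as a pair.\<close>

definition lookup_step :: expr where
  "lookup_step = IfNonzero (IsPair Acc) Acc
     (IfNonzero Acc (Plus (Lit (-1)) Acc) (MkPair Head (Lit 0)))"

definition bound_body :: expr where
  "bound_body = LetIn (Fst (run f_lookup (Lit 0) (Snd (Var 0)) (Fst (Fst (Var 0)))))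
     (IfNonzero (Less (Var 0) (Snd (Fst (Var 1)))) (Var 0) (Snd (Fst (Var 1))))"

definition scale_step :: expr where
  "scale_step = Times (Times
       (Times (Snd (Fst (Snd Head))) (Snd (Snd (Snd Head))))
       (Times (call2 f_bound Ctx (Fst (Fst Head))) (call2 f_bound Ctx (Snd (Fst Head))))) Acc"

text \<open>The argument packs \<open>D\<close>, the pair of patiences and rounds, \<open>k * C\<close>, and an encoded edge.\<close>

definition item_body :: expr where
  "item_body =
     (let D = Fst (Fst (Var 0)); pk = Fst (Snd (Fst (Var 0))); kC = Snd (Snd (Fst (Var 0)));
          e = Fst (Snd (Var 0)); w = Fst (Snd (Snd (Var 0))); p = Snd (Snd (Snd (Var 0)));
          Dp = Div (Times D (Fst p)) (Snd p)
      in MkPair e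
         (MkPair (MkPair (Plus Dp (Div D (call2 f_bound pk (Fst e))))
                         (Plus Dp (Div D (call2 f_bound pk (Snd e)))))
                 (MkPair (Div D kC)
                         (Div (Times (Times (Lit 2) D) (Times (Fst w) (Fst p))) (Times (Snd w)
                             (Snd p))))))"

text \<open>The difference of the two truth values vanishes exactly if the edge belongs to the class
  chosen by the coin, so the second branch is the one that keeps the edge.\<close>

definition items_step :: expr where
  "items_step =
     IfNonzero (Minus (Less (Snd (Snd (Snd Head))) (Times (Lit 8) (Fst (Snd (Snd Head)))))
         (Snd Ctx))
       Acc (MkPair (call2 f_item (Fst Ctx) Head) Acc)"

definition uses_body :: expr where
  "uses_body =
     (let r = Fst (Var 0); e = Fst (Snd (Var 0))
      in IfNonzero (Less r (Lit 0)) (Lit 1)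
          (IfNonzero (Minus r (Fst e)) (IfNonzero (Minus r (Snd e)) (Lit 0) (Lit 1)) (Lit 1)))"

definition size_body :: expr where
  "size_body =
     (let r = Fst (Var 0); e = Fst (Snd (Var 0)); s = Snd (Snd (Var 0))
      in IfNonzero (Less r (Lit 0)) (Fst (Snd s))
          (IfNonzero (Minus r (Fst e)) (IfNonzero (Minus r (Snd e)) (Lit 0) (Snd (Fst s)))
              (Fst (Fst s))))"

definition amount_step :: expr where
  "amount_step = Plus (IfNonzero (call2 f_uses Ctx (Fst Head)) (Snd Head) (Lit 0)) Acc"

definition load_step :: expr where
  "load_step = Plus (call2 f_size Ctx Head) Acc"

text \<open>The result 0 signals that nothing is to be pushed, which is unambiguous because pushed
  gains are positive.\<close>

definition gain_body :: expr where
  "gain_body =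
     (let D = Fst (Var 0); acc = Fst (Snd (Var 0)); i = Snd (Snd (Var 0));
          c = Snd (Snd (Snd i));
          part = (\<lambda>r. Times (run f_amount r (Lit 0) acc) (call2 f_size r i))
      in LetIn (Div (Minus (Times D c)
                  (Plus (part (Lit (-1))) (Plus (part (Fst (Fst i))) (part (Snd (Fst i)))))) D)
          (IfNonzero (Less (Lit 0) (Var 0))
             (IfNonzero (Less (Snd (Snd (Snd (Snd (Snd (Var 1)))))) (Var 0)) (Lit 0) (Var 0))
                 (Lit 0)))"

definition stack_step :: expr where
  "stack_step =
     (let g = call2 f_gain Ctx (MkPair Acc Head)
      in IfNonzero g (MkPair (MkPair Head g) Acc) Acc)"

definition selection_step :: expr where
  "selection_step =
     (let i = Fst Head; light = (\<lambda>r. Less (Times (Lit 8) (run f_load r (Lit 0) Acc)) Ctx)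
      in IfNonzero (light (Lit (-1)))
          (IfNonzero (light (Fst (Fst i)))
            (IfNonzero (light (Snd (Fst i))) (MkPair i Acc) Acc) Acc) Acc)"

text \<open>The flag selects the relation: sharing an endpoint if it is nonzero, equality of the
  edges otherwise. History entries supply their answer as the flag.\<close>

definition touch_body :: expr where
  "touch_body =
     (let u = Fst (Fst (Var 0)); v = Snd (Fst (Var 0));
          x = Fst (Fst (Snd (Var 0))); y = Snd (Fst (Snd (Var 0)))
      in IfNonzero (Snd (Snd (Var 0)))
          (IfNonzero (Minus u x) (IfNonzero (Minus u y) (IfNonzero (Minus v x)
            (IfNonzero (Minus v y) (Lit 0) (Lit 1)) (Lit 1)) (Lit 1)) (Lit 1))
          (IfNonzero (Minus u x) (Lit 0) (IfNonzero (Minus v y) (Lit 0) (Lit 1))))"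

definition touches_step :: expr where
  "touches_step = IfNonzero Acc (Lit 1) (call2 f_touch Ctx Head)"

definition blocked_step :: expr where
  "blocked_step = IfNonzero Acc (Lit 1) (run f_touches Ctx (Lit 0) Head)"

definition meets_step :: expr where
  "meets_step = IfNonzero Acc (Lit 1) (call2 f_touch Ctx (MkPair Head (Lit 1)))"

definition length_step :: expr where
  "length_step = Plus (Lit 1) Acc"

definition greedy_step :: expr where
  "greedy_step =
     IfNonzero (run f_blocked (Fst Head) (Lit 0) (Fst Ctx)) Acc
       (IfNonzero (run f_meets (Fst Head) (Lit 0) Acc) Acc
         (IfNonzero (Less (run f_length (Lit 0) (Lit 0) Acc) (Snd Ctx))
             (MkPair (Fst Head) Acc) Acc))"

text \<open>The accessors take the input as a parameter since its de Bruijn index is 0 outside and 1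
  inside the \<open>LetIn\<close> that binds the common denominator.\<close>

definition main_body :: expr where
  "main_body =
     (let es = (\<lambda>X. Fst (Snd (Fst X))); pat = (\<lambda>X. Fst (Snd (Snd (Fst X))));
          k = (\<lambda>X. Fst (Snd (Snd (Snd (Fst X))))); C = (\<lambda>X. Snd (Snd (Snd (Snd (Fst X)))));
          coin = (\<lambda>X. Fst (Fst (Snd X))); h = (\<lambda>X. Snd (Snd X)); pk = (\<lambda>X. MkPair (pat X) (k X))
      in LetIn (run f_scale (pk (Var 0)) (Times (k (Var 0)) (C (Var 0))) (es (Var 0)))
          (run f_greedy (MkPair (h (Var 1)) (C (Var 1))) (Lit 0)
            (run f_selection (Var 0) (Lit 0)
              (run f_stack (Var 0) (Lit 0)
                (run f_items
                  (MkPair (MkPair (Var 0) (MkPair (pk (Var 1)) (Times (k (Var 1)) (C (Var 1)))))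
                      (coin (Var 1)))
                  (Lit 0) (es (Var 1)))))))"

definition matcher :: program where
  "matcher =
    [main_body, loop f_lookup lookup_step, bound_body, loop f_scale scale_step, item_body,
     loop f_items items_step, uses_body, size_body, loop f_amount amount_step,
     loop f_load load_step, gain_body, loop f_stack stack_step, loop f_selection selection_step,
     touch_body, loop f_touches touches_step, loop f_blocked blocked_step, loop f_meets meets_step,
     loop f_length length_step, loop f_greedy greedy_step]"

lemma matcher_nth [simp]:
  "matcher ! 0 = main_body"
  "matcher ! f_lookup = loop f_lookup lookup_step"
  "matcher ! f_bound = bound_body"
  "matcher ! f_scale = loop f_scale scale_step"
  "matcher ! f_item = item_body"
  "matcher ! f_items = loop f_items items_step"
  "matcher ! f_uses = uses_body"
  "matcher ! f_size = size_body"
  "matcher ! f_amount = loop f_amount amount_step"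
  "matcher ! f_load = loop f_load load_step"
  "matcher ! f_gain = gain_body"
  "matcher ! f_stack = loop f_stack stack_step"
  "matcher ! f_selection = loop f_selection selection_step"
  "matcher ! f_touch = touch_body"
  "matcher ! f_touches = loop f_touches touches_step"
  "matcher ! f_blocked = loop f_blocked blocked_step"
  "matcher ! f_meets = loop f_meets meets_step"
  "matcher ! f_length = loop f_length length_step"
  "matcher ! f_greedy = loop f_greedy greedy_step"
  by (simp_all add: matcher_def f_defs)

lemma matcher_length [simp]:
  "f_lookup < length matcher" "f_bound < length matcher" "f_scale < length matcher"
  "f_item < length matcher" "f_items < length matcher" "f_uses < length matcher"
  "f_size < length matcher" "f_amount < length matcher" "f_load < length matcher"
  "f_gain < length matcher" "f_stack < length matcher" "f_selection < length matcher"
  "f_touch < length matcher" "f_touches < length matcher" "f_blocked < length matcher"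
  "f_meets < length matcher" "f_length < length matcher" "f_greedy < length matcher"
  by (simp_all add: matcher_def f_defs)

section \<open>Polynomial running time of every function\<close>

lemma ptime_lookup: "fun_ptime matcher f_lookup"
  by (rule fun_ptime_loop[of _ _ lookup_step], simp)
     (auto simp: lookup_step_def intro!: ptime_intros acc_additive_intros small_intros)

lemma ptime_bound: "fun_ptime matcher f_bound"
  by (rule fun_ptimeI) (auto simp: bound_body_def run_def intro!: ptime_intros ptime_lookup)

lemma ptime_scale: "fun_ptime matcher f_scale"
  by (rule fun_ptime_loop[of _ _ scale_step], simp)
     (auto simp: scale_step_def call2_def
         intro!: ptime_intros ptime_bound acc_additive_intros small_intros)

lemma ptime_item: "fun_ptime matcher f_item"
  by (rule fun_ptimeI) (auto simp: item_body_def call2_def Let_def intro!: ptime_intros ptime_bound)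

lemma ptime_items: "fun_ptime matcher f_items"
  by (rule fun_ptime_loop[of _ _ items_step], simp)
     (auto simp: items_step_def call2_def
         intro!: ptime_intros ptime_item acc_additive_intros small_intros)

lemma ptime_uses: "fun_ptime matcher f_uses"
  by (rule fun_ptimeI) (auto simp: uses_body_def Let_def intro!: ptime_intros)

lemma ptime_size: "fun_ptime matcher f_size"
  by (rule fun_ptimeI) (auto simp: size_body_def Let_def intro!: ptime_intros)

lemma ptime_amount: "fun_ptime matcher f_amount"
  by (rule fun_ptime_loop[of _ _ amount_step], simp)
     (auto simp: amount_step_def call2_def
         intro!: ptime_intros ptime_uses acc_additive_intros small_intros)

lemma ptime_load: "fun_ptime matcher f_load"
  by (rule fun_ptime_loop[of _ _ load_step], simp)
     (auto simp: load_step_def call2_def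
         intro!: ptime_intros ptime_size acc_additive_intros small_intros)

lemma ptime_gain: "fun_ptime matcher f_gain"
  by (rule fun_ptimeI)
     (auto simp: gain_body_def run_def call2_def Let_def
         intro!: ptime_intros ptime_size ptime_amount)

text \<open>This is where clamping the gain to the value of the item is essential.\<close>

lemma small_gain: "small matcher (call2 f_gain Ctx (MkPair Acc Head))"
proof (rule smallI[where q = "[:2, 1:]"])
  fix c a l v t
  assume "eval matcher [Node c (Node a l)] (call2 f_gain Ctx (MkPair Acc Head)) v t"
  then obtain x s s' where x: "eval matcher [Node c (Node a l)] (MkPair Ctx (MkPair Acc Head)) x s"
    and v: "eval matcher [x] gain_body v s'"
    unfolding call2_def eval_simps(14) by auto
  from x obtain i m where x: "x = Node c (Node a i)" "l = Node i m"
    by (auto simp: eval_simps dest!: eval_loop_vars)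
  from v obtain g t' where
    v: "eval matcher [g, x] (IfNonzero (Less (Lit 0) (Var 0))
       (IfNonzero (Less (Snd (Snd (Snd (Snd (Snd (Var 1)))))) (Var 0)) (Lit 0) (Var 0))
           (Lit 0)) v t'"
    unfolding gain_body_def Let_def eval_simps(13) by blast
  then consider "v = Num 0" | e' s' sz c' g' where "i = Node e' (Node s' (Node sz (Num c')))"
      "v = Num g'" "0 < g'" "g' \<le> c'"
    by (auto simp: x eval_simps split: if_splits)
  then have "val_size v \<le> val_size i + 2"
  proof cases
    case 2
    have "val_size (Num g') \<le> val_size (Num c')" by (rule val_size_mono) (use 2 in simp)
    then show ?thesis by (simp add: 2)
  qed (simp add: floorlog_def)
  then show "val_size v \<le> poly [:2, 1:] (val_size c + val_size l)" by (simp add: x)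
qed

lemma ptime_stack: "fun_ptime matcher f_stack"
proof (rule fun_ptime_loop[of _ _ stack_step])
  show "ptime matcher stack_step"
    by (auto simp: stack_step_def call2_def Let_def intro!: ptime_intros ptime_gain)
  show "acc_additive matcher stack_step"
    unfolding stack_step_def Let_def
    by (intro acc_additive_IfNonzero acc_additive_MkPair acc_additive_Acc small_MkPair small_gain
        small_Fst small_Rest)
qed simp

lemma ptime_selection: "fun_ptime matcher f_selection"
  by (rule fun_ptime_loop[of _ _ selection_step], simp)
     (auto simp: selection_step_def run_def Let_def
         intro!: ptime_intros ptime_load acc_additive_intros small_intros)

lemma ptime_touch: "fun_ptime matcher f_touch"
  by (rule fun_ptimeI) (auto simp: touch_body_def Let_def intro!: ptime_intros)

lemma ptime_touches: "fun_ptime matcher f_touches"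
  by (rule fun_ptime_loop[of _ _ touches_step], simp)
     (auto simp: touches_step_def call2_def
         intro!: ptime_intros ptime_touch acc_additive_small small_intros)

lemma ptime_blocked: "fun_ptime matcher f_blocked"
  by (rule fun_ptime_loop[of _ _ blocked_step], simp)
     (auto simp: blocked_step_def run_def
         intro!: ptime_intros ptime_touches acc_additive_small small_intros)

lemma ptime_meets: "fun_ptime matcher f_meets"
  by (rule fun_ptime_loop[of _ _ meets_step], simp)
     (auto simp: meets_step_def call2_def
         intro!: ptime_intros ptime_touch acc_additive_small small_intros)

lemma ptime_length: "fun_ptime matcher f_length"
  by (rule fun_ptime_loop[of _ _ length_step], simp)
     (auto simp: length_step_def intro!: ptime_intros acc_additive_intros small_intros)

lemma ptime_greedy: "fun_ptime matcher f_greedy"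
  by (rule fun_ptime_loop[of _ _ greedy_step], simp)
     (auto simp: greedy_step_def run_def
         intro!: ptime_intros ptime_blocked ptime_meets ptime_length acc_additive_intros
             small_intros)

lemma ptime_matcher: "fun_ptime matcher 0"
  by (rule fun_ptimeI)
     (auto simp: main_body_def run_def Let_def
        intro!: ptime_intros ptime_scale ptime_items ptime_stack ptime_selection ptime_greedy)


section \<open>Correctness of the program\<close>

interpretation packing: sparse_packing resources item_size item_value D for D .

lemmas calls_bodies =
  call_value_nonloop[OF matcher_length(2) matcher_nth(3)]
  call_value_nonloop[OF matcher_length(4) matcher_nth(5)]
  call_value_nonloop[OF matcher_length(6) matcher_nth(7)]
  call_value_nonloop[OF matcher_length(7) matcher_nth(8)]
  call_value_nonloop[OF matcher_length(10) matcher_nth(11)]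
  call_value_nonloop[OF matcher_length(13) matcher_nth(14)]

lemma value_of_call2 [simp]:
  "value_of P env (call2 f a b) =
     Option.bind (value_of P env a) (\<lambda>x. Option.bind (value_of P env b)
         (\<lambda>y. call_value P f (Node x y)))"
  by (simp add: call2_def)

lemma value_of_run [simp]:
  "value_of P env (run f c a l) =
     Option.bind (value_of P env c) (\<lambda>x. Option.bind (value_of P env a) (\<lambda>y.
       Option.bind (value_of P env l) (\<lambda>z. call_value P f (Node x (Node y z)))))"
  by (simp add: run_def)

lemma calls_lookup:
  assumes "v < length xs"
  shows "call_value matcher f_lookup (Node c (Node (Num (int v))
      (enc_list (\<lambda>w. enc_nat (t w)) xs))) = Some (Node (enc_nat (t (xs ! v))) (Num 0))"
proof -
  let ?g = "\<lambda>a x. case a of Node p q \<Rightarrow> a | Num i \<Rightarrow>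
    if i \<noteq> 0 then Num (-1 + i) else Node (enc_nat (t x)) (Num 0)"
  have step: "value_of matcher [Node c (Node (id a) (Node (enc_nat (t x)) l))] lookup_step
      = Some (id (?g a x))"
    for a x l by (cases a) (auto simp: lookup_step_def)
  have found: "foldl ?g (Node p q) xs = Node p q" for p q xs
    by (induction xs) auto
  have "foldl ?g (Num (int v)) xs = Node (enc_nat (t (xs ! v))) (Num 0)"
    using assms
  proof (induction xs arbitrary: v)
    case (Cons x xs)
    then show ?case by (cases v) (simp_all add: found)
  qed simp
  with call_value_loop[of f_lookup matcher lookup_step xs c id "\<lambda>w. enc_nat (t w)" ?g
      "Num (int v)"] step
  show ?thesis by simp
qed

text \<open>A vertex is probed at most once per round, so the number of rounds limits its probes
  just as its patience does.\<close>

definition bound :: "matching_instance \<Rightarrow> nat \<Rightarrow> nat" where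
  "bound I v = min (patience I v) (rounds I)"

definition enc_bounds :: "matching_instance \<Rightarrow> val" where
  "enc_bounds I
      = Node (enc_list (\<lambda>v. enc_nat (patience I v)) [0..<num_verts I]) (enc_nat (rounds I))"

lemma calls_bound:
  assumes "v < num_verts I"
  shows "call_value matcher f_bound (Node (enc_bounds I) (Num (int v)))
      = Some (Num (int (bound I v)))"
  unfolding calls_bodies enc_bounds_def
  using assms
  by (auto simp: bound_body_def calls_lookup[unfolded enc_nat_def] bound_def enc_nat_def)

definition enc_raw :: "matching_instance \<Rightarrow> edge \<Rightarrow> val" where
  "enc_raw I e = Node (enc_edge e) (Node (enc_rat (weight I e)) (enc_rat (present_prob I e)))"

abbreviation "numer q \<equiv> fst (quotient_of q)"
abbreviation "denom q \<equiv> snd (quotient_of q)"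

text \<open>A plain product of denominators suffices: it makes the divisions in \<open>item\<close>
  exact for the edges of a valid instance and keeps the number of bits polynomial.\<close>

definition scale_factor :: "matching_instance \<Rightarrow> edge \<Rightarrow> int" where
  "scale_factor I e = denom (weight I e) * denom (present_prob I e)
     * (int (bound I (fst e)) * int (bound I (snd e)))"

definition scale :: "matching_instance \<Rightarrow> int" where
  "scale I = foldl (\<lambda>a e. scale_factor I e * a) (int (rounds I) * int (capacity I)) (edges I)"

definition good_edge :: "matching_instance \<Rightarrow> edge \<Rightarrow> bool" where
  "good_edge I e \<longleftrightarrow> fst e < snd e \<and> snd e < num_verts I \<and> 0 \<le> present_prob I e"

lemma good_edges: "valid_instance I \<Longrightarrow> e \<in> set (edges I) \<Longrightarrow> good_edge I e"
  by (fastforce simp: valid_instance_def good_edge_def)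

lemma scale_nonneg: "0 \<le> scale I"
proof -
  have "0 \<le> foldl (\<lambda>a e. scale_factor I e * a) a es" if "0 \<le> a" for a es
    using that
    by (induction es arbitrary: a)
        (auto simp: scale_factor_def less_imp_le[OF quotient_of_denom_pos'])
  then show ?thesis by (simp add: scale_def)
qed

lemma calls_scale:
  assumes "\<And>e. e \<in> set es \<Longrightarrow> good_edge I e"
  shows "call_value matcher f_scale (Node (enc_bounds I) (Node (Num a) (enc_list (enc_raw I) es)))
      = Some (Num (foldl (\<lambda>a e. scale_factor I e * a) a es))"
proof (rule call_value_loop[where ea = Num])
  fix a e l assume "e \<in> set es"
  then have "good_edge I e" by (rule assms)
  then show "value_of matcher [Node (enc_bounds I) (Node (Num a)
      (Node (enc_raw I e) l))] scale_step = Some (Num (scale_factor I e * a))"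
    by (simp add: scale_step_def enc_raw_def enc_edge_def enc_rat_def calls_bound good_edge_def
        enc_nat_def scale_factor_def)
qed simp_all

text \<open>Sizes are fractions of \<open>D\<close>. At a vertex the normalised constraints on
  \<open>p\<close> and on the number of probes are added, so a fractional solution uses at most
  \<open>2 * D\<close> there. The factor 2 in the value makes every nonzero value at least 2, as the
  rounding argument of weak duality requires, and \<open>nat\<close> makes all sizes nonnegative by
  type.\<close>

definition item :: "matching_instance \<Rightarrow> int \<Rightarrow> edge \<Rightarrow> item" where
  "item I D e =
     (let x = D * numer (present_prob I e) div denom (present_prob I e)
      in (e, (nat (x + D div int (bound I (fst e))), nat (x + D div int (bound I (snd e)))),
          (nat (D div (int (rounds I) * int (capacity I))),
           2 * D * (numer (weight I e) * numer (present_prob I e))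
             div (denom (weight I e) * denom (present_prob I e)))))"

definition enc_item :: "item \<Rightarrow> val" where
  "enc_item = (\<lambda>(e, (su, sv), (sz, c)).
     Node (enc_edge e) (Node (Node (enc_nat su) (enc_nat sv)) (Node (enc_nat sz) (Num c))))"

definition enc_globals :: "matching_instance \<Rightarrow> int \<Rightarrow> val" where
  "enc_globals I D = Node (Num D) (Node (enc_bounds I) (Num (int (rounds I) * int (capacity I))))"

lemma numer_nonneg: "0 \<le> q \<Longrightarrow> 0 \<le> numer q"
  using quotient_of_div[of q] quotient_of_denom_pos'[of q]
  by (metis (no_types, lifting) prod.collapse of_int_0_le_iff of_int_pos zero_le_divide_iff not_less
      order.strict_iff_order)

lemma denom_pos: "0 < denom q"
  by (rule quotient_of_denom_pos')

lemma calls_item: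
  assumes "good_edge I e" "0 \<le> D"
  shows "call_value matcher f_item (Node (enc_globals I D) (enc_raw I e))
      = Some (enc_item (item I D e))"
proof -
  have "0 \<le> D * numer (present_prob I e) div denom (present_prob I e)"
    using assms numer_nonneg denom_pos[of "present_prob I e"]
    by (subst pos_imp_zdiv_nonneg_iff) (auto simp: good_edge_def)
  moreover have "0 \<le> D div int m" for m
    using assms(2) by (cases "m = 0") (auto simp: pos_imp_zdiv_nonneg_iff)
  from this this[of "rounds I * capacity I"]
  have "0 \<le> D div int m" "0 \<le> D div (int (rounds I) * int (capacity I))" for m by simp_all
  ultimately show ?thesis
    unfolding calls_bodies using assms
    by (simp add: item_body_def Let_def enc_globals_def enc_raw_def enc_edge_def enc_rat_def
        calls_bound good_edge_def enc_nat_def item_def enc_item_def)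
qed

definition heavy :: "matching_instance \<Rightarrow> edge \<Rightarrow> bool" where
  "heavy I e \<longleftrightarrow> denom (present_prob I e) < 8 * numer (present_prob I e)"

definition items :: "matching_instance \<Rightarrow> bool \<Rightarrow> item list" where
  "items I b = foldl (\<lambda>a e. if heavy I e = b then item I (scale I) e # a else a) [] (edges I)"

lemma calls_items:
  assumes "\<And>e. e \<in> set es \<Longrightarrow> good_edge I e" "0 \<le> D"
  shows "call_value matcher f_items (Node (Node (enc_globals I D) (truth_val b)) (Node (Num 0)
      (enc_list (enc_raw I) es)))
          = Some (enc_list enc_item
      (foldl (\<lambda>a e. if heavy I e = b then item I D e # a else a) [] es))"
proof -
  let ?g = "\<lambda>a e. if heavy I e = b then item I D e # a else a"
  have step: "value_of matcher [Node (Node (enc_globals I D) (truth_val b))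
      (Node (enc_list enc_item a)
      (Node (enc_raw I e) l))] items_step
          = Some (enc_list enc_item (?g a e))" if "e \<in> set es" for a e l
  proof -
    have "\<exists>p. enc_raw I e
        = Node (enc_edge e) (Node p (Node (Num (numer (present_prob I e)))
            (Num (denom (present_prob I e)))))"
      by (simp add: enc_raw_def enc_rat_def)
    then show ?thesis
      using calls_item[OF assms(1)[OF that] assms(2)]
      by (auto simp: items_step_def heavy_def)
  qed
  from call_value_loop[of f_items matcher items_step es _ "enc_list enc_item" "enc_raw I" ?g "[]",
      OF _ _ step]
  show ?thesis by simp
qed

definition enc_resource :: "nat option \<Rightarrow> val" where
  "enc_resource r = (case r of None \<Rightarrow> Num (-1) | Some w \<Rightarrow> Num (int w))"

lemma enc_resource_simps [simp]:
  "enc_resource None = Num (-1)"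
  "enc_resource (Some w) = Num (int w)"
  by (simp_all add: enc_resource_def)

lemma calls_uses:
  "call_value matcher f_uses (Node (enc_resource r) (enc_item i))
      = Some (truth_val (r \<in> resources i))"
  by (cases i; cases r)
     (auto simp: calls_bodies uses_body_def Let_def enc_item_def enc_edge_def enc_nat_def)

lemma calls_size:
  "call_value matcher f_size (Node (enc_resource r) (enc_item i)) = Some (Num (item_size r i))"
  by (cases i; cases r)
     (auto simp: calls_bodies size_body_def Let_def enc_item_def enc_edge_def enc_nat_def)

definition enc_pair :: "item \<times> int \<Rightarrow> val" where
  "enc_pair p = Node (enc_item (fst p)) (Num (snd p))"

lemma calls_amount:
  "call_value matcher f_amount (Node (enc_resource r) (Node (Num a) (enc_list enc_pair acc)))
      = Some (Num (a + packing.amount acc r))"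
proof -
  let ?g = "\<lambda>a p. (if r \<in> resources (fst p) then snd p else 0) + a"
  have "foldl ?g a acc = a + packing.amount acc r" for a
    by (induction acc arbitrary: a) auto
  moreover have "value_of matcher [Node (enc_resource r) (Node (Num a)
      (Node (enc_pair p) l))] amount_step = Some (Num (?g a p))"
    for a p l by (simp add: amount_step_def enc_pair_def calls_uses)
  ultimately show ?thesis
    using call_value_loop[of f_amount matcher amount_step acc _ Num enc_pair ?g a] by simp
qed

lemma calls_load:
  "call_value matcher f_load (Node (enc_resource r) (Node (Num a) (enc_list enc_item S)))
      = Some (Num (a + packing.load S r))"
proof -
  let ?g = "\<lambda>a i. item_size r i + a"
  have none: "item_size r i = 0" if "r \<notin> resources i" for i
    using that by (cases i; cases r) auto
  have "foldl ?g a S = a + packing.load S r" for a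
    by (induction S arbitrary: a) (auto simp: none)
  moreover have "value_of matcher [Node (enc_resource r) (Node (Num a)
      (Node (enc_item i) l))] load_step = Some (Num (?g a i))"
    for a i l by (simp add: load_step_def calls_size)
  ultimately show ?thesis
    using call_value_loop[of f_load matcher load_step S _ Num enc_item ?g a] by simp
qed

text \<open>The program adds three prices; this agrees with the sum over the set
  \<open>resources i\<close> if the two endpoints differ.\<close>

definition proper_item :: "item \<Rightarrow> bool" where
  "proper_item i \<longleftrightarrow> fst (fst i) \<noteq> snd (fst i)"

lemma price_eq:
  assumes "proper_item i"
  shows "packing.price acc i =
    packing.amount acc None * item_size None i
    + (packing.amount acc (Some (fst (fst i))) * item_size (Some (fst (fst i))) i
       + packing.amount acc (Some (snd (fst i))) * item_size (Some (snd (fst i))) i)"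
proof -
  obtain u v s where i: "i = ((u, v), s)" by (metis surj_pair)
  have "u \<noteq> v" using assms by (simp add: proper_item_def i)
  then show ?thesis by (simp add: packing.price_def i)
qed

lemma enc_item_edge:
  "\<exists>s. enc_item i = Node (Node (Num (int (fst (fst i)))) (Num (int (snd (fst i))))) s"
  by (cases i) (auto simp: enc_item_def enc_edge_def enc_nat_def)

lemma calls_gain:
  assumes "proper_item i"
  shows "call_value matcher f_gain (Node (Num D) (Node (enc_list enc_pair acc) (enc_item i)))
      = Some (Num (if 0 < packing.gain D acc i \<and> packing.gain D acc i \<le> item_value i
          then packing.gain D acc i else 0))"
proof -
  obtain u v su sv sz c where i: "i = ((u, v), (su, sv), (sz, c))" by (metis surj_pair)
  let ?e = "enc_item i"
  have e: "?e
      = Node (Node (Num (int u)) (Num (int v))) (Node (Node (Num (int su)) (Num (int sv)))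
          (Node (Num (int sz)) (Num c)))"
    by (simp add: i enc_item_def enc_edge_def enc_nat_def)
  have amount: "call_value matcher f_amount (Node (Num (-1)) (Node (Num 0)
      (enc_list enc_pair acc))) = Some (Num (packing.amount acc None))"
    "call_value matcher f_amount (Node (Num (int w)) (Node (Num 0) (enc_list enc_pair acc)))
        = Some (Num (packing.amount acc (Some w)))" for w
    using calls_amount[of None 0 acc] calls_amount[of "Some w" 0 acc] by simp_all
  have size: "call_value matcher f_size (Node (Num (-1)) ?e) = Some (Num (item_size None i))"
    "call_value matcher f_size (Node (Num (int w)) ?e) = Some (Num (item_size (Some w) i))" for w
    using calls_size[of None i] calls_size[of "Some w" i] by simp_all
  have "item_value i = c" by (simp add: i item_value_def)
  moreover have "packing.gain D acc i = (D * c - (packing.amount acc None * item_size None i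
      + (packing.amount acc (Some u) * item_size (Some u) i
          + packing.amount acc (Some v) * item_size (Some v) i))) div D"
    by (simp only: packing.gain_def price_eq[OF assms]) (simp add: i item_value_def)
  ultimately show ?thesis
    by (simp add: calls_bodies(5) gain_body_def Let_def amount size[unfolded e] e
        del: item_size.simps)
qed

lemma calls_stack:
  assumes "\<And>i. i \<in> set is \<Longrightarrow> proper_item i"
  shows "call_value matcher f_stack (Node (Num D) (Node (Num 0) (enc_list enc_item is)))
      = Some (enc_list enc_pair (packing.stack D is))"
proof -
  have step: "value_of matcher [Node (Num D) (Node (enc_list enc_pair acc)
      (Node (enc_item i) l))] stack_step
          = Some (enc_list enc_pair (packing.push D acc i))" if "i \<in> set is" for acc i l
    by (auto simp: stack_step_def Let_def calls_gain[OF assms[OF that]] packing.push_def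
        enc_pair_def)
  from call_value_loop[of f_stack matcher stack_step "is" _ "enc_list enc_pair"
      enc_item "packing.push D" "[]", OF _ _ step]
  show ?thesis by (simp add: packing.stack_def)
qed

lemma calls_selection:
  "call_value matcher f_selection (Node (Num D) (Node (Num 0) (enc_list enc_pair acc)))
      = Some (enc_list enc_item (foldl (packing.pick D) [] acc))"
proof -
  have step: "value_of matcher [Node (Num D) (Node (enc_list enc_item S)
      (Node (enc_pair p) l))] selection_step
          = Some (enc_list enc_item (packing.pick D S p))" for S p l
  proof -
    obtain u v s g where p: "p = (((u, v), s), g)" by (metis surj_pair)
    obtain s' where s': "enc_item ((u, v), s) = Node (Node (Num (int u)) (Num (int v))) s'"
      using enc_item_edge[of "((u, v), s)"] by auto
    have load: "call_value matcher f_load (Node (Num (-1)) (Node (Num 0) (enc_list enc_item S)))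
        = Some (Num (packing.load S None))"
      "call_value matcher f_load (Node (Num (int w)) (Node (Num 0) (enc_list enc_item S)))
          = Some (Num (packing.load S (Some w)))" for w
      using calls_load[of None 0 S] calls_load[of "Some w" 0 S] by simp_all
    show ?thesis
      by (simp add: selection_step_def Let_def p enc_pair_def s' load packing.pick_def)
  qed
  from call_value_loop[of f_selection matcher selection_step acc _ "enc_list enc_item"
      enc_pair "packing.pick D" "[]", OF _ _ step]
  show ?thesis by simp
qed

definition enc_entry :: "edge \<times> bool \<Rightarrow> val" where
  "enc_entry = (\<lambda>(e, b). Node (enc_edge e) (truth_val b))"

lemma calls_touch:
  "call_value matcher f_touch (Node (enc_edge e) (Node (enc_edge f) (truth_val b)))
      = Some (truth_val (f = e \<or> b \<and> overlap e f))"
  by (cases e; cases f; cases b)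
     (auto simp: calls_bodies touch_body_def Let_def enc_edge_def enc_nat_def overlap_def
         endpoints_def)

lemma foldl_disj: "foldl (\<lambda>a x. a \<or> Q x) a xs = (a \<or> (\<exists>x\<in>set xs. Q x))"
  by (induction xs arbitrary: a) auto

lemma calls_touches:
  "call_value matcher f_touches (Node (enc_edge e) (Node (Num 0) (enc_list enc_entry xs)))
      = Some (truth_val (\<exists>(f, b)\<in>set xs. f = e \<or> b \<and> overlap e f))"
proof -
  let ?g = "\<lambda>a p. a \<or> (fst p = e \<or> snd p \<and> overlap e (fst p))"
  have "value_of matcher [Node (enc_edge e) (Node (truth_val a)
      (Node (enc_entry p) l))] touches_step = Some (truth_val (?g a p))"
    for a p l
    by (cases p) (simp add: touches_step_def enc_entry_def calls_touch)
  from call_value_loop[of f_touches matcher touches_step xs "enc_edge e" truth_val enc_entry ?g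
      False, OF _ _ this]
  show ?thesis by (simp add: foldl_disj case_prod_unfold)
qed

lemma calls_blocked:
  "call_value matcher f_blocked (Node (enc_edge e) (Node (Num 0) (enc_history h)))
      = Some (truth_val (blocked h e))"
proof -
  let ?g = "\<lambda>a xs. a \<or> (\<exists>(f, b)\<in>set xs. f = e \<or> b \<and> overlap e f)"
  have "value_of matcher [Node (enc_edge e) (Node (truth_val a)
      (Node (enc_list enc_entry xs) l))] blocked_step = Some (truth_val (?g a xs))" for a xs l
    by (simp add: blocked_step_def calls_touches)
  from call_value_loop[of f_blocked matcher blocked_step h "enc_edge e" truth_val
      "enc_list enc_entry" ?g False, OF _ _ this]
  show ?thesis by (simp add: foldl_disj blocked_def enc_history_def enc_entry_def)
qed

lemma calls_meets:
  "call_value matcher f_meets (Node (enc_edge e) (Node (Num 0) (enc_list enc_edge M)))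
      = Some (truth_val (\<exists>f\<in>set M. overlap e f))"
proof -
  let ?g = "\<lambda>a f. a \<or> overlap e f"
  have "value_of matcher [Node (enc_edge e) (Node (truth_val a) (Node (enc_edge f) l))] meets_step
      = Some (truth_val (?g a f))"
    for a f l
    using calls_touch[of e f True] overlap_refl[of e] by (auto simp: meets_step_def)
  from call_value_loop[of f_meets matcher meets_step M "enc_edge e" truth_val enc_edge ?g False,
      OF _ _ this]
  show ?thesis by (simp add: foldl_disj)
qed

lemma calls_length:
  "call_value matcher f_length (Node c (Node (Num 0) (enc_list enc_edge M)))
      = Some (Num (int (length M)))"
proof -
  have "foldl (\<lambda>a _. 1 + a) a M = a + int (length M)" for a by (induction M arbitrary: a) auto
  moreover have "value_of matcher [Node c (Node (Num a) (Node (enc_edge f) l))] length_step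
      = Some (Num (1 + a))" for a f l
    by (simp add: length_step_def)
  ultimately show ?thesis
    using call_value_loop[of f_length matcher length_step M c Num enc_edge "\<lambda>a _. 1 + a" 0] by simp
qed

lemma calls_greedy:
  "call_value matcher f_greedy (Node (Node (enc_history h) (Num (int C))) (Node (Num 0)
      (enc_list enc_item S))) = Some (enc_list enc_edge (greedy C (map fst S) h))"
proof -
  let ?g = "\<lambda>M i. extend h C M (fst i)"
  have step: "value_of matcher [Node (Node (enc_history h) (Num (int C)))
      (Node (enc_list enc_edge M) (Node (enc_item i) l))] greedy_step
          = Some (enc_list enc_edge (?g M i))" for M i l
  proof -
    obtain s where "enc_item i = Node (enc_edge (fst i)) s"
      by (cases i) (auto simp: enc_item_def)
    then show ?thesis
      by (auto simp: greedy_step_def calls_blocked calls_meets calls_length extend_def)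
  qed
  from call_value_loop[of f_greedy matcher greedy_step S _ "enc_list enc_edge" enc_item ?g "[]",
      OF _ _ step]
  show ?thesis by (simp add: greedy_def foldl_map)
qed

text \<open>It depends on the instance and the coin but not on the history, so recomputing it in
  each round always yields the same edges.\<close>

definition plan :: "matching_instance \<Rightarrow> bool \<Rightarrow> edge list" where
  "plan I b = map fst (packing.selection (scale I) (items I b))"

lemma set_items: "set (items I b) = item I (scale I) ` {e \<in> set (edges I). heavy I e = b}"
proof -
  have "set (foldl (\<lambda>a e. if heavy I e = b then item I (scale I) e # a else a) a es)
      = set a \<union> item I (scale I) ` {e \<in> set es. heavy I e = b}" for a es
    by (induction es arbitrary: a) auto
  from this[of "[]"] show ?thesis by (simp add: items_def)
qed

lemma proper_items:
  assumes "valid_instance I" "i \<in> set (items I b)"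
  shows "proper_item i"
  using assms(2) good_edges[OF assms(1)]
  by (force simp: set_items item_def proper_item_def Let_def good_edge_def)

lemma calls_main:
  assumes "valid_instance I"
  shows "call_value matcher 0 (enc_input I [b] h)
      = Some (enc_list enc_edge (greedy (capacity I) (plan I b) h))"
proof -
  have "enc_input I [b] h
      = Node (Node (enc_nat (num_verts I)) (Node (enc_list (enc_raw I) (edges I))
      (Node pat (Node (enc_nat (rounds I)) (enc_nat (capacity I)))))) (Node (Node (truth_val b)
          (Num 0)) (enc_history h))"
    if "pat = enc_list (\<lambda>v. enc_nat (patience I v)) [0..<num_verts I]" for pat
    using that by (simp add: enc_input_def enc_instance_def enc_raw_def[abs_def])
  note input = this[OF refl]
  note edges = good_edges[OF assms]
  have scale: "call_value matcher f_scale (Node (enc_bounds I)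
      (Node (Num (int (rounds I) * int (capacity I)))
      (enc_list (enc_raw I) (edges I)))) = Some (Num (scale I))"
    by (simp add: calls_scale[OF edges] scale_def)
  have items: "call_value matcher f_items (Node (Node (enc_globals I (scale I)) (truth_val b))
      (Node (Num 0)
      (enc_list (enc_raw I) (edges I)))) = Some (enc_list enc_item (items I b))"
    by (simp only: calls_items[OF edges scale_nonneg] items_def)
  note calls = scale[unfolded enc_bounds_def enc_nat_def]
    items[unfolded enc_globals_def enc_bounds_def enc_nat_def]
    calls_stack[OF proper_items[OF assms]] calls_selection calls_greedy
  have "0 < length matcher" by (simp add: matcher_def)
  from call_value_nonloop[OF this matcher_nth(1)] show ?thesis
    by (simp add: main_body_def Let_def input calls plan_def enc_nat_def packing.selection_def)
qed


section \<open>Approximation guarantee\<close>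

lemma packing_nonneg: "0 < D \<Longrightarrow> sparse_packing_nonneg resources item_size D"
proof
  show "finite (resources i)" for i by (cases i) auto
  show "0 \<le> item_size r i" for r i by (cases i; cases r) auto
qed simp

lemma bound_pos: "valid_instance I \<Longrightarrow> v < num_verts I \<Longrightarrow> 0 < bound I v"
  by (simp add: valid_instance_def bound_def)

lemma scale_eq:
  "scale I = int (rounds I) * int (capacity I) * prod_list (map (scale_factor I) (edges I))"
proof -
  have "foldl (\<lambda>a e. scale_factor I e * a) a es = a * prod_list (map (scale_factor I) es)" for a es
    by (induction es arbitrary: a) (auto simp: algebra_simps)
  then show ?thesis by (simp add: scale_def)
qed

lemma items_eq: "items I b = map (item I (scale I)) (rev (filter (\<lambda>e. heavy I e = b) (edges I)))"
proof -
  have "foldl (\<lambda>a e. if heavy I e = b then item I D e # a else a) a es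
      = map (item I D) (rev (filter (\<lambda>e. heavy I e = b) es)) @ a" for D a es
    by (induction es arbitrary: a) auto
  then show ?thesis by (simp add: items_def)
qed

lemma fst_item [simp]: "fst (item I D e) = e"
  by (simp add: item_def Let_def)

lemma None_in_resources [simp]: "None \<in> resources i"
  by (cases i) auto

lemma Some_in_resources [simp]: "Some v \<in> resources (item I D e) \<longleftrightarrow> e \<in> incident v"
  by (cases e) (auto simp: item_def Let_def incident_def endpoints_def)

lemma of_rat_quotient: "real_of_rat q = real_of_int (numer q) / real_of_int (denom q)"
proof -
  have "q = of_int (numer q) / of_int (denom q)" by (rule quotient_of_div) simp
  then have "real_of_rat q = real_of_rat (of_int (numer q) / of_int (denom q))" by simp
  then show ?thesis by (simp add: of_rat_divide)
qed

abbreviation edge_value :: "matching_instance \<Rightarrow> edge \<Rightarrow> real" where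
  "edge_value I e \<equiv> real_of_rat (weight I e * present_prob I e)"

section \<open>The scaled packing instance has exact sizes and values\<close>

locale scaled_instance =
  fixes I :: matching_instance and D :: int
  assumes valid: "valid_instance I"
  defines "D \<equiv> scale I"
begin

lemma kC_pos: "0 < rounds I * capacity I"
  using valid by (simp add: valid_instance_def)

lemma factor_pos:
  assumes "e \<in> set (edges I)"
  shows "0 < scale_factor I e"
proof -
  have "0 < bound I (fst e)" "0 < bound I (snd e)"
    using good_edges[OF valid assms] bound_pos[OF valid] by (auto simp: good_edge_def)
  then show ?thesis by (simp add: scale_factor_def denom_pos)
qed

lemma D_pos: "0 < D"
proof -
  have "0 < prod_list (map (scale_factor I) es)" if "set es \<subseteq> set (edges I)" for es
    using that factor_pos by (induction es) auto
  then show ?thesis using kC_pos by (simp add: D_def scale_eq)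
qed

lemma dvd_D:
  assumes "e \<in> set (edges I)"
  shows "denom (weight I e) * denom (present_prob I e) dvd D"
    "int (bound I (fst e)) dvd D" "int (bound I (snd e)) dvd D"
    "int (rounds I) * int (capacity I) dvd D"
proof -
  have "scale_factor I e dvd prod_list (map (scale_factor I) (edges I))"
    using assms by (intro prod_list_dvd) auto
  then have "scale_factor I e dvd D" by (simp add: D_def scale_eq)
  then show "denom (weight I e) * denom (present_prob I e) dvd D"
    "int (bound I (fst e)) dvd D" "int (bound I (snd e)) dvd D"
    by (auto simp: scale_factor_def elim!: dvd_trans[rotated] intro: dvd_mult dvd_mult2)
  show "int (rounds I) * int (capacity I) dvd D" by (simp add: D_def scale_eq)
qed

lemma size_None:
  assumes "e \<in> set (edges I)"
  shows "real_of_int (item_size None (item I D e)) = D / (real (rounds I) * real (capacity I))"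
proof -
  have "0 \<le> D div (int (rounds I) * int (capacity I))"
    using D_pos kC_pos by (subst pos_imp_zdiv_nonneg_iff) auto
  then have "item_size None (item I D e) = D div (int (rounds I) * int (capacity I))"
    by (cases e) (simp add: item_def Let_def)
  with dvd_D(4)[OF assms] show ?thesis by (simp add: real_of_int_div)
qed

lemma size_Some:
  assumes e: "e \<in> set (edges I)" and v: "e \<in> incident v"
  shows "real_of_int (item_size (Some v) (item I D e))
    = D * (real_of_rat (present_prob I e) + 1 / real (bound I v))"
proof -
  let ?p = "present_prob I e"
  let ?x = "D * numer ?p div denom ?p"
  have "denom ?p dvd D" using dvd_D(1)[OF e] by (rule dvd_mult_right)
  then have x: "real_of_int ?x = D * real_of_rat ?p"
    by (simp add: real_of_int_div of_rat_quotient)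
  have y: "real_of_int (D div int (bound I v)) = D / real (bound I v)"
    using dvd_D(2,3)[OF e] v by (auto simp: incident_def endpoints_def real_of_int_div)
  have "0 \<le> ?x"
    using good_edges[OF valid e] numer_nonneg denom_pos D_pos
    by (subst pos_imp_zdiv_nonneg_iff) (auto simp: good_edge_def)
  moreover have "0 \<le> D div int (bound I v)"
    using D_pos by (cases "bound I v = 0") (auto simp: pos_imp_zdiv_nonneg_iff)
  ultimately have "item_size (Some v) (item I D e) = ?x + D div int (bound I v)"
    using v by (cases e) (auto simp: item_def Let_def incident_def endpoints_def)
  then show ?thesis using x y by (simp add: distrib_left)
qed

lemma value_eq:
  assumes e: "e \<in> set (edges I)"
  shows "real_of_int (item_value (item I D e)) = 2 * D * edge_value I e"
    "item_value (item I D e) = 0 \<or> 2 \<le> item_value (item I D e)"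
proof -
  let ?w = "weight I e" and ?p = "present_prob I e"
  let ?d = "denom ?w * denom ?p"
  obtain m where m: "D = ?d * m" using dvd_D(1)[OF e] by (rule dvdE)
  have d: "0 < ?d" by (simp add: denom_pos)
  have "item_value (item I D e) = ?d * (2 * m * (numer ?w * numer ?p)) div ?d"
    by (simp add: item_value_def item_def Let_def m algebra_simps)
  also have "\<dots> = 2 * (m * (numer ?w * numer ?p))"
    using d by (subst nonzero_mult_div_cancel_left) auto
  finally have val: "item_value (item I D e) = 2 * (m * (numer ?w * numer ?p))" .
  show "real_of_int (item_value (item I D e)) = 2 * D * edge_value I e"
  proof -
    have "edge_value I e = real_of_int (numer ?w) / real_of_int (denom ?w)
        * (real_of_int (numer ?p) / real_of_int (denom ?p))"
      by (simp only: of_rat_mult of_rat_quotient[of ?w] of_rat_quotient[of ?p])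
    then show ?thesis
      unfolding val using denom_pos[of ?w] denom_pos[of ?p] by (simp add: m)
  qed
  have "0 < m" using D_pos d by (simp add: m zero_less_mult_iff)
  moreover have "0 \<le> numer ?w" "0 \<le> numer ?p"
    using valid e by (auto simp: valid_instance_def intro!: numer_nonneg)
  ultimately have "0 \<le> m * (numer ?w * numer ?p)" by simp
  moreover have "2 * k = 0 \<or> 2 \<le> 2 * k" if "0 \<le> k" for k :: int using that by presburger
  ultimately show "item_value (item I D e) = 0 \<or> 2 \<le> item_value (item I D e)"
    unfolding val by blast
qed

lemma heavy_iff: "heavy I e \<longleftrightarrow> 1 / 8 < real_of_rat (present_prob I e)"
proof -
  have "heavy I e
      \<longleftrightarrow> real_of_int (denom (present_prob I e)) < real_of_int (8 * numer (present_prob I e))"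
    unfolding heavy_def of_int_less_iff ..
  then show ?thesis
    using denom_pos[of "present_prob I e"] by (simp add: of_rat_quotient field_simps)
qed

sublocale packed: sparse_packing_nonneg resources item_size item_value D
  using D_pos by (rule packing_nonneg)

abbreviation members :: "bool \<Rightarrow> edge set" where
  "members b \<equiv> {e \<in> set (edges I). heavy I e = b}"

lemma set_items_D: "set (items I b) = item I D ` members b"
  unfolding D_def by (rule set_items)

section \<open>Sparsity of the planned edges\<close>

lemma inj_item: "inj_on (item I D) A"
  by (rule inj_on_inverseI[where g = fst]) simp

lemma distinct_items: "distinct (items I b)"
  using valid by (simp add: items_eq distinct_map inj_item[unfolded D_def] valid_instance_def)

lemma selection_eq: "packing.selection D (items I b) = map (item I D) (plan I b)"
proof -
  have "map (item I D) (map fst (packing.selection D (items I b)))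
      = packing.selection D (items I b)"
    using packed.selection_subset[OF distinct_items[of b]]
    by (auto simp: set_items_D intro!: map_idI)
  then show ?thesis by (simp add: plan_def D_def)
qed

lemma plan_subset: "set (plan I b) \<subseteq> members b"
  using packed.selection_subset[OF distinct_items[of b]] unfolding selection_eq set_items_D
  by (simp add: inj_on_image_subset_iff[OF inj_item[of UNIV]])

lemma plan_distinct: "distinct (plan I b)"
  using packed.selection_distinct[OF distinct_items[of b]] unfolding selection_eq
  by (simp add: distinct_map)

lemma load_plan:
  "real_of_int (packing.load (map (item I D) (plan I b)) r)
    = (\<Sum>e\<in>{e \<in> set (plan I b). r \<in> resources (item I D e)}. real_of_int (item_size r (item I D e)))"
proof -
  have "packing.load (map (item I D) (plan I b)) r
      = (\<Sum>e\<leftarrow>plan I b. if r \<in> resources (item I D e) then item_size r (item I D e) else 0)"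
    by (simp add: packing.load_def o_def)
  also have "\<dots>
      = (\<Sum>e\<in>set (plan I b). if r \<in> resources (item I D e) then item_size r (item I D e) else 0)"
    using plan_distinct by (rule sum_list_distinct_conv_sum_set)
  also have "\<dots> = (\<Sum>e\<in>{e \<in> set (plan I b). r \<in> resources (item I D e)}. item_size r (item I D e))"
    by (simp add: sum.inter_filter)
  finally show ?thesis by simp
qed

lemma plan_load:
  assumes "e \<in> set (plan I b)" "r \<in> resources (item I D e)"
  obtains f where "f \<in> set (plan I b)" "r \<in> resources (item I D f)"
    "8 * (\<Sum>e\<in>{e \<in> set (plan I b). r \<in> resources (item I D e)} - {f}.
        real_of_int (item_size r (item I D e))) < D"
proof -
  have "\<exists>i\<in>set (packing.selection D (items I b)). r \<in> resources i"
    using assms by (auto simp: selection_eq)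
  from packed.selection_load[OF this] obtain f where f: "f \<in> set (plan I b)"
      "r \<in> resources (item I D f)"
    "8 * (packing.load (map (item I D) (plan I b)) r - item_size r (item I D f)) < D"
    by (auto simp: selection_eq)
  from f(3) have "real_of_int (8 * (packing.load (map (item I D)
      (plan I b)) r - item_size r (item I D f))) < D"
    by (simp only: of_int_less_iff)
  with f(1,2) show ?thesis
    by (intro that[of f]) (simp_all add: load_plan sum_diff1)
qed

lemma plan_incident:
  assumes "e \<in> set (plan I b)" "e \<in> incident v"
  obtains f where "f \<in> set (plan I b) \<inter> incident v"
    "8 * (\<Sum>e\<in>set (plan I b) \<inter> incident v - {f}. real_of_rat (present_prob I e)
        + 1 / real (bound I v)) < 1"
proof -
  let ?P = "set (plan I b) \<inter> incident v"
  have eq: "{e \<in> set (plan I b). Some v \<in> resources (item I D e)} = ?P" by auto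
  have "Some v \<in> resources (item I D e)" using assms(2) by simp
  from plan_load[OF assms(1) this] obtain f where "f \<in> set (plan I b)"
    "Some v \<in> resources (item I D f)"
    and f': "8 * (\<Sum>e\<in>?P - {f}. real_of_int (item_size (Some v) (item I D e))) < D"
    unfolding eq by blast
  then have f: "f \<in> ?P" by simp
  have "(\<Sum>e\<in>?P - {f}. real_of_int (item_size (Some v) (item I D e)))
      = (\<Sum>e\<in>?P - {f}. D * (real_of_rat (present_prob I e) + 1 / real (bound I v)))"
    using plan_subset by (intro sum.cong refl size_Some) auto
  then have "D * (8 * (\<Sum>e\<in>?P - {f}. real_of_rat (present_prob I e) + 1 / real (bound I v)))
      < real_of_int D * 1"
    using f' by (simp add: sum_distrib_left algebra_simps)
  then show ?thesis using f D_pos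
      by (intro that[of f]) (simp_all only: mult_less_cancel_left_pos of_int_0_less_iff)
qed

lemma prob_nonneg: "e \<in> set (edges I) \<Longrightarrow> 0 \<le> real_of_rat (present_prob I e)"
  using valid by (auto simp: valid_instance_def)

lemma endpoint_less:
  "e \<in> set (edges I) \<Longrightarrow> e \<in> incident v \<Longrightarrow> v < num_verts I"
  using good_edges[OF valid] by (fastforce simp: good_edge_def incident_def endpoints_def)

text \<open>All edges at \<open>v\<close> except one, \<open>f\<close>, use less than
  \<open>D / 8\<close> together; this bounds both their number and their sum of probabilities. A
  second heavy edge would exceed an eighth by itself, while a light \<open>f\<close> adds at most
  1/8 to less than 1/8.\<close>

lemma incident_sums:
  assumes "e \<in> set (plan I b)" "e \<in> incident v"
  defines "P \<equiv> set (plan I b) \<inter> incident v"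
  shows "8 * card P < bound I v + 8"
    and "b \<Longrightarrow> P = {e}"
    and "\<not> b \<Longrightarrow> (\<Sum>f\<in>P. real_of_rat (present_prob I f)) \<le> 1 / 4"
proof -
  let ?p = "\<lambda>f. real_of_rat (present_prob I f)" and ?T = "real (bound I v)"
  have sub: "P \<subseteq> set (edges I)" using plan_subset by (auto simp: P_def)
  have "e \<in> set (edges I)" using assms(1) plan_subset by blast
  then have T: "0 < ?T" using bound_pos[OF valid endpoint_less] assms(2) by simp
  from plan_incident[OF assms(1,2)]
  obtain f where f: "f \<in> P" "8 * (\<Sum>e\<in>P - {f}. ?p e + 1 / ?T) < 1"
    unfolding P_def by blast
  have fin: "finite P" by (simp add: P_def)
  have card: "card P = Suc (card (P - {f}))"
    using fin f(1) by (rule card.remove)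
  have sum: "8 * (\<Sum>e\<in>P - {f}. ?p e) + 8 * real (card (P - {f})) / ?T < 1"
    using f(2) by (simp add: sum.distrib distrib_left)
  have nonneg: "0 \<le> (\<Sum>e\<in>P - {f}. ?p e)"
    using sub by (intro sum_nonneg prob_nonneg) auto
  then have "8 * real (card (P - {f})) / ?T < 1" using sum by linarith
  then have "8 * real (card (P - {f})) < ?T" using T by (simp add: divide_simps)
  then have "real (8 * card (P - {f})) < real (bound I v)" by simp
  then have "8 * card (P - {f}) < bound I v" by (simp only: of_nat_less_iff)
  then show "8 * card P < bound I v + 8" unfolding card by simp
  have small: "8 * (\<Sum>e\<in>P - {f}. ?p e) < 1"
  proof -
    have "0 \<le> 8 * real (card (P - {f})) / ?T" by simp
    with sum show ?thesis by linarith
  qed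
  show "P = {e}" if b
  proof -
    have "g = f" if "g \<in> P" for g
    proof (rule ccontr)
      assume "g \<noteq> f"
      have "?p g \<le> (\<Sum>e\<in>P - {f}. ?p e)"
        using \<open>g \<noteq> f\<close> that sub by (intro member_le_sum prob_nonneg) (auto simp: P_def)
      moreover have "1 / 8 < ?p g"
        using that \<open>b\<close> plan_subset[of b] by (auto simp: P_def heavy_iff)
      ultimately show False using small by linarith
    qed
    with f(1) assms show ?thesis unfolding P_def by blast
  qed
  show "(\<Sum>e\<in>P. ?p e) \<le> 1 / 4" if "\<not> b"
  proof -
    have "(\<Sum>e\<in>P. ?p e) = ?p f + (\<Sum>e\<in>P - {f}. ?p e)"
      using fin f(1) by (rule sum.remove)
    moreover have "?p f \<le> 1 / 8"
      using f(1) that plan_subset[of b] by (auto simp: P_def heavy_iff not_less)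
    ultimately show ?thesis using small by linarith
  qed
qed

text \<open>For heavy edges the plan is a matching and the sum over neighbours is empty; for light
  ones each endpoint contributes at most 1/4.\<close>

lemma sparse_schedule_plan: "sparse_schedule I (plan I b)"
proof
  let ?P = "set (plan I b)" and ?p = "\<lambda>f. real_of_rat (present_prob I f)"
  show "valid_instance I" by (rule valid)
  show "distinct (plan I b)" by (rule plan_distinct)
  show sub: "?P \<subseteq> set (edges I)" using plan_subset by blast
  show "8 * card (?P \<inter> incident v) < min (patience I v) (rounds I) + 8" if "v < num_verts I" for v
  proof (cases "?P \<inter> incident v = {}")
    case False
    then show ?thesis using incident_sums(1)[of _ b v] by (auto simp: bound_def)
  qed simp
  show "8 * length (plan I b) < rounds I * capacity I + 8"
  proof (cases "plan I b = []")
    case False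
    then obtain e where "e \<in> ?P" by (meson list.set_sel(1))
    from plan_load[OF this None_in_resources] obtain f where f: "f \<in> ?P"
      "8 * (\<Sum>e\<in>?P - {f}. real_of_int (item_size None (item I D e))) < D" by auto
    have "(\<Sum>e\<in>?P - {f}. real_of_int (item_size None (item I D e)))
        = (\<Sum>e\<in>?P - {f}. D / (real (rounds I) * real (capacity I)))"
      using sub by (intro sum.cong refl size_None) auto
    then have "D * (8 * real (card (?P - {f})) / real (rounds I * capacity I)) < real_of_int D * 1"
      using f(2) by (simp add: algebra_simps)
    then have "8 * real (card (?P - {f})) / real (rounds I * capacity I) < 1"
      using D_pos by (simp only: mult_less_cancel_left_pos of_int_0_less_iff)
    then have "8 * real (card (?P - {f})) < real (rounds I * capacity I)"
      using kC_pos by (simp only: divide_less_eq_1_pos of_nat_0_less_iff)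
    then have "real (8 * card (?P - {f})) < real (rounds I * capacity I)" by simp
    then have "8 * card (?P - {f}) < rounds I * capacity I" by (simp only: of_nat_less_iff)
    moreover have "length (plan I b) = Suc (card (?P - {f}))"
      using card.remove[OF finite_set f(1)] distinct_card[OF plan_distinct[of b]] by simp
    ultimately show ?thesis by simp
  qed simp
  show "(\<Sum>f\<in>{f \<in> ?P. f \<noteq> e \<and> overlap e f}. ?p f) \<le> 1 / 2" if e: "e \<in> ?P" for e
  proof -
    let ?N = "{f \<in> ?P. f \<noteq> e \<and> overlap e f}"
    let ?U = "?P \<inter> incident (fst e)" and ?V = "?P \<inter> incident (snd e)"
    have inc: "e \<in> incident (fst e)" "e \<in> incident (snd e)"
        by (auto simp: incident_def endpoints_def)
    have N: "?N \<subseteq> (?U \<union> ?V) - {e}" by (auto simp: overlap_iff)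
    show ?thesis
    proof (cases b)
      case True
      then have "?U = {e}" "?V = {e}" using incident_sums(2)[OF e] inc by blast+
      then have none: "?N = {}" using N by blast
      show ?thesis unfolding none by simp
    next
      case False
      have "(\<Sum>f\<in>?N. ?p f) \<le> (\<Sum>f\<in>?U \<union> ?V. ?p f)"
        using N sub by (intro sum_mono2 prob_nonneg) auto
      also have "\<dots> = (\<Sum>f\<in>?U. ?p f) + (\<Sum>f\<in>?V. ?p f) - (\<Sum>f\<in>?U \<inter> ?V. ?p f)"
        by (rule sum_Un) auto
      also have "\<dots> \<le> (\<Sum>f\<in>?U. ?p f) + (\<Sum>f\<in>?V. ?p f)"
      proof -
        have "0 \<le> (\<Sum>f\<in>?U \<inter> ?V. ?p f)" using sub by (intro sum_nonneg prob_nonneg) auto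
        then show ?thesis by simp
      qed
      also have "\<dots> \<le> 1 / 4 + 1 / 4"
        using incident_sums(3)[OF e inc(1) False] incident_sums(3)[OF e inc(2) False]
        by (rule add_mono)
      finally show ?thesis by simp
    qed
  qed
qed

section \<open>Comparison with the optimum\<close>

lemma probe_prob_le: "0 \<le> probe_prob I \<sigma> e \<and> probe_prob I \<sigma> e \<le> 1"
  by (simp add: probe_prob_def)

text \<open>The probing probabilities respect capacity \<open>2 * D\<close> at each vertex, one
  \<open>D\<close> for either of the added constraints, and \<open>D\<close> for the total. Hence
  the capacities of an item sum to 5, weak duality costs \<open>2 * (5 + 1)\<close>, the selection
  costs 8, and the product is 96.\<close>

lemma class_value:
  assumes "feasible I \<sigma>"
  shows "(\<Sum>e\<in>members b. edge_value I e * probe_prob I \<sigma> e)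
      \<le> 96 * (\<Sum>e\<in>set (plan I b). edge_value I e)"
proof -
  let ?x = "probe_prob I \<sigma>" and ?p = "\<lambda>f. real_of_rat (present_prob I f)"
  let ?cap = "\<lambda>r. case r of None \<Rightarrow> 1 | Some v \<Rightarrow> (2 :: real)"
  have mem: "i \<in> set (items I b) \<Longrightarrow> \<exists>e \<in> set (edges I). i = item I D e" for i
    by (auto simp: set_items_D)
  have reindex: "(\<Sum>i\<in>{i \<in> set (items I b). r \<in> resources i}.
        real_of_int (item_size r i) * ?x (fst i))
      = (\<Sum>e\<in>{e \<in> members b. r \<in> resources (item I D e)}.
            real_of_int (item_size r (item I D e)) * ?x e)" for r
  proof -
    have "{i \<in> set (items I b). r \<in> resources i}
        = item I D ` {e \<in> members b. r \<in> resources (item I D e)}"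
      by (auto simp: set_items_D)
    then show ?thesis by (simp add: sum.reindex[OF inj_item])
  qed
  have cap: "(\<Sum>i\<in>{i \<in> set (items I b). r \<in> resources i}. real_of_int (item_size r i) * ?x (fst i))
      \<le> ?cap r * D" for r
  proof (cases r)
    case None
    have "(\<Sum>e\<in>members b. real_of_int (item_size None (item I D e)) * ?x e)
        = (\<Sum>e\<in>members b. D / (real (rounds I) * real (capacity I)) * ?x e)"
      by (intro sum.cong refl) (simp add: size_None)
    also have "\<dots> \<le> (\<Sum>e\<in>set (edges I). D / (real (rounds I) * real (capacity I)) * ?x e)"
      using D_pos probe_prob_le by (intro sum_mono2) auto
    also have "\<dots> \<le> D / (real (rounds I) * real (capacity I)) * real (rounds I * capacity I)"
      unfolding sum_distrib_left[symmetric] using D_pos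
      by (intro mult_left_mono probe_prob_total assms) auto
    also have "\<dots> = D" using kC_pos by simp
    finally show ?thesis unfolding reindex by (simp add: None)
  next
    case (Some v)
    let ?E = "set (edges I) \<inter> incident v"
    show ?thesis
    proof (cases "?E = {}")
      case True
      then have empty: "{e \<in> members b. r \<in> resources (item I D e)} = {}" by (auto simp: Some)
      show ?thesis unfolding reindex empty using D_pos by (simp add: Some)
    next
      case False
      then have v: "v < num_verts I" using endpoint_less by auto
      then have T: "0 < real (bound I v)" using bound_pos[OF valid] by simp
      have "(\<Sum>e\<in>{e \<in> members b. r \<in> resources (item I D e)}.
            real_of_int (item_size r (item I D e)) * ?x e)
          = (\<Sum>e\<in>members b \<inter> incident v. D * (?p e + 1 / real (bound I v)) * ?x e)"
        by (intro sum.cong) (auto simp: Some size_Some)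
      also have "\<dots> \<le> (\<Sum>e\<in>?E. D * (?p e + 1 / real (bound I v)) * ?x e)"
        using D_pos probe_prob_le prob_nonneg
        by (intro sum_mono2 mult_nonneg_nonneg add_nonneg_nonneg) auto
      also have "\<dots> = D * ((\<Sum>e\<in>?E. ?p e * ?x e) + (\<Sum>e\<in>?E. ?x e) / real (bound I v))"
        by (simp add: sum_distrib_left sum_divide_distrib sum.distrib[symmetric] algebra_simps)
      also have "\<dots> \<le> real_of_int D * (1 + 1)"
      proof -
        have "(\<Sum>e\<in>?E. ?x e) / real (bound I v) \<le> 1"
          using probe_prob_incident[OF assms v] T by (simp add: bound_def)
        then show ?thesis
          using probe_prob_matched[OF valid assms, of v] D_pos
          by (intro mult_left_mono add_mono) auto
      qed
      finally show ?thesis unfolding reindex by (simp add: Some)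
    qed
  qed
  have five: "(\<Sum>r\<in>resources i. ?cap r) \<le> 5" if "i \<in> set (items I b)" for i
  proof -
    obtain u v s where i: "i = ((u, v), s)" by (metis surj_pair)
    have "u \<noteq> v" using proper_items[OF valid that] by (simp add: i proper_item_def)
    then show ?thesis by (simp add: i)
  qed
  have dual: "(\<Sum>i\<in>set (items I b). ?x (fst i) * real_of_int (item_value i))
      \<le> 2 * (5 + 1) * real_of_int (packing.total (packing.stack D (items I b)))"
  proof (rule packed.fractional_value_le[where cap = ?cap and x = "\<lambda>i. ?x (fst i)"])
    show "0 \<le> ?x (fst i) \<and> ?x (fst i) \<le> 1" for i :: item by (rule probe_prob_le)
    show "item_value i = 0 \<or> 2 \<le> item_value i" if "i \<in> set (items I b)" for i
      using mem[OF that] value_eq(2) by blast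
  qed (rule cap, erule five)
  have lhs: "(\<Sum>i\<in>set (items I b). ?x (fst i) * real_of_int (item_value i))
      = 2 * D * (\<Sum>e\<in>members b. edge_value I e * ?x e)"
  proof -
    have "(\<Sum>i\<in>set (items I b). ?x (fst i) * real_of_int (item_value i))
        = (\<Sum>e\<in>members b. ?x e * real_of_int (item_value (item I D e)))"
      unfolding set_items_D by (simp add: sum.reindex[OF inj_item])
    also have "\<dots> = (\<Sum>e\<in>members b. 2 * D * (edge_value I e * ?x e))"
    proof (rule sum.cong[OF refl])
      fix e assume "e \<in> members b"
      then have "real_of_int (item_value (item I D e)) = 2 * D * edge_value I e"
          by (intro value_eq(1)) simp
      then show "?x e * real_of_int (item_value (item I D e)) = 2 * D * (edge_value I e * ?x e)"
        by (simp only: mult_ac)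
    qed
    finally show ?thesis by (simp only: sum_distrib_left)
  qed
  have rhs: "real_of_int (\<Sum>i\<leftarrow>packing.selection D (items I b). item_value i)
      = 2 * D * (\<Sum>e\<in>set (plan I b). edge_value I e)"
  proof -
    have "(\<Sum>i\<leftarrow>packing.selection D (items I b). item_value i)
        = (\<Sum>e\<leftarrow>plan I b. item_value (item I D e))"
      by (simp only: selection_eq map_map o_def)
    also have "\<dots> = (\<Sum>e\<in>set (plan I b). item_value (item I D e))"
      by (rule sum_list_distinct_conv_sum_set[OF plan_distinct])
    finally have "real_of_int (\<Sum>i\<leftarrow>packing.selection D (items I b). item_value i)
        = (\<Sum>e\<in>set (plan I b). real_of_int (item_value (item I D e)))" by simp
    also have "\<dots> = (\<Sum>e\<in>set (plan I b). 2 * D * edge_value I e)"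
      by (rule sum.cong[OF refl], rule value_eq(1)) (use plan_subset in blast)
    finally show ?thesis by (simp only: sum_distrib_left)
  qed
  have "real_of_int (packing.total (packing.stack D (items I b)))
      \<le> real_of_int (8 * (\<Sum>i\<leftarrow>packing.selection D (items I b). item_value i))"
    using packed.selection_value[of "items I b"] by (simp only: of_int_le_iff)
  then have "2 * D * (\<Sum>e\<in>members b. edge_value I e * ?x e)
      \<le> 2 * D * (96 * (\<Sum>e\<in>set (plan I b). edge_value I e))"
    using dual rhs unfolding lhs by simp
  moreover have "0 < 2 * real_of_int D" using D_pos by simp
  ultimately show ?thesis by (simp only: mult_le_cancel_left_pos)
qed

lemma feasible_plan: "feasible I (greedy (capacity I) (plan I b))"
  by (rule sparse_schedule.feasible_greedy[OF sparse_schedule_plan])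

text \<open>The weight of a strategy is linear in its probing probabilities and splits into the two
  classes. Each class loses 96 in the packing and 2 in the schedule.\<close>

lemma optimum_le:
  "optimum I \<le> 192 * (expected_weight I (greedy (capacity I) (plan I True))
    + expected_weight I (greedy (capacity I) (plan I False)))"
  unfolding optimum_def
proof (rule cSUP_least)
  show "{\<sigma>. feasible I \<sigma>} \<noteq> {}" using feasible_stop by blast
  fix \<sigma> assume "\<sigma> \<in> {\<sigma>. feasible I \<sigma>}"
  then have \<sigma>: "feasible I \<sigma>" by simp
  have by_class: "(\<Sum>e\<in>members b. edge_value I e * probe_prob I \<sigma> e)
      \<le> 192 * expected_weight I (greedy (capacity I) (plan I b))" for b
    using class_value[OF \<sigma>, of b] sparse_schedule.expected_weight_greedy[OF sparse_schedule_plan,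
        of b]
    by linarith
  have "set (edges I) = members True \<union> members False" by auto
  then have "expected_weight I \<sigma>
      = (\<Sum>e\<in>members True \<union> members False. edge_value I e * probe_prob I \<sigma> e)"
    by (simp only: expected_weight_eq[OF valid \<sigma>])
  also have "\<dots> = (\<Sum>e\<in>members True. edge_value I e * probe_prob I \<sigma> e)
      + (\<Sum>e\<in>members False. edge_value I e * probe_prob I \<sigma> e)"
    by (rule sum.union_disjoint) auto
  also have "\<dots> \<le> 192 * expected_weight I (greedy (capacity I) (plan I True))
      + 192 * expected_weight I (greedy (capacity I) (plan I False))"
    by (intro add_mono by_class)
  finally show "expected_weight I \<sigma> \<le> 192 * (expected_weight I (greedy (capacity I) (plan I True))
    + expected_weight I (greedy (capacity I) (plan I False)))" by simp
qed

end

section \<open>Coins and sizes of inputs\<close>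

lemma runs_matcher:
  assumes "valid_instance I"
  shows "\<exists>t. runs matcher (enc_input I [b] h) (enc_list enc_edge (greedy (capacity I)
      (plan I b) h)) t"
proof -
  have "0 < length matcher" by (simp add: matcher_def)
  then have "\<exists>t. eval matcher [enc_input I [b] h] (matcher ! 0)
      (enc_list enc_edge (greedy (capacity I) (plan I b) h)) t"
    using calls_main[OF assms, of b h]
    by (simp add: call_value_def value_of_eq_Some del: matcher_nth)
  with \<open>0 < length matcher\<close> show ?thesis by (auto simp: runs_def)
qed

lemma strategy_of_matcher:
  "valid_instance I \<Longrightarrow> strategy_of matcher I [b] = greedy (capacity I) (plan I b)"
  using runs_matcher strategy_of_eqI by blast

lemma coin_seqs_one: "coin_seqs [:1:] I = {[True], [False]}"
proof -
  have "length r = 1 \<longleftrightarrow> r = [True] \<or> r = [False]" for r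
    by (cases r; cases "hd r") auto
  then show ?thesis by (auto simp: coin_seqs_def)
qed

lemma val_size_enc_list: "val_size (enc_list f xs) = 1 + floorlog 2 0 + (\<Sum>x\<leftarrow>xs. 1 + val_size (f x))"
  by (induction xs) auto

lemma sum_list_concat_map: "(\<Sum>x\<leftarrow>concat xss. f x) = (\<Sum>xs\<leftarrow>xss. \<Sum>x\<leftarrow>xs. f x)" for f :: "'a \<Rightarrow> nat"
  by (induction xss) auto

text \<open>Besides its edge an entry costs at most 4: list node, pair node, and up to 2 for the
  answer. A round costs 2 more, its list node and its terminator, which are charged to one of its
  entries; nonempty rounds make this possible.\<close>

lemma val_size_enc_history:
  assumes "[] \<notin> set h"
  shows "val_size (enc_history h) \<le> 1 + (\<Sum>p\<leftarrow>concat h. 6 + val_size (enc_edge (fst p)))"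
proof -
  let ?e = "\<lambda>(e, b). Node (enc_edge e) (truth_val b)"
  have entry: "1 + val_size (?e p) \<le> 4 + val_size (enc_edge (fst p))" for p
    by (cases p) (auto simp: floorlog_def of_bool_def)
  have "1 + val_size (enc_list ?e xs) \<le> (\<Sum>p\<leftarrow>xs. 6 + val_size (enc_edge (fst p)))" if "xs \<noteq> []"
      for xs
    using that
  proof (induction xs rule: list_nonempty_induct)
    case (single p)
    then show ?case using entry[of p] by (simp add: floorlog_def)
  next
    case (cons p xs)
    then show ?case using entry[of p] by simp
  qed
  then have "(\<Sum>xs\<leftarrow>h. 1 + val_size (enc_list ?e xs))
      \<le> (\<Sum>xs\<leftarrow>h. \<Sum>p\<leftarrow>xs. 6 + val_size (enc_edge (fst p)))"
    using assms by (intro sum_list_mono) metis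
  then show ?thesis
    by (simp add: enc_history_def val_size_enc_list sum_list_concat_map floorlog_def
        del: sum_list_addf)
qed

text \<open>A probed edge occurs once in the history and its encoding already occurs in the
  instance, so the history is linear in the instance even when the number of rounds is
  exponential.\<close>

lemma val_size_enc_input:
  assumes "valid_instance I" "fair_history I j h"
  shows "val_size (enc_input I [b] h) \<le> 8 + 7 * instance_size I"
proof -
  have h: "distinct (map fst (concat h))" "[] \<notin> set h" "set (map fst (concat h)) \<subseteq> set (edges I)"
    using assms(2) by (auto simp: fair_history_def probed_edges_def)
  have "(\<Sum>p\<leftarrow>concat h. 6 + val_size (enc_edge (fst p)))
      = (\<Sum>e\<leftarrow>map fst (concat h). 6 + val_size (enc_edge e))"
    by (simp add: o_def)
  also have "\<dots> = (\<Sum>e\<in>set (map fst (concat h)). 6 + val_size (enc_edge e))"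
    by (rule sum_list_distinct_conv_sum_set[OF h(1)])
  also have "\<dots> \<le> (\<Sum>e\<in>set (edges I). 6 + val_size (enc_edge e))"
    using h(3) by (intro sum_mono2) auto
  also have "\<dots> = (\<Sum>e\<leftarrow>edges I. 6 + val_size (enc_edge e))"
    using assms(1)
    by (intro sum_list_distinct_conv_sum_set[symmetric]) (simp add: valid_instance_def)
  also have "\<dots> \<le> (\<Sum>e\<leftarrow>edges I. 6 * (1 + val_size (Node (enc_edge e)
      (Node (enc_rat (weight I e)) (enc_rat (present_prob I e))))))"
    by (intro sum_list_mono) simp
  also have "\<dots> = 6 * (\<Sum>e\<leftarrow>edges I. 1 + val_size (Node (enc_edge e)
      (Node (enc_rat (weight I e)) (enc_rat (present_prob I e)))))"
    by (rule sum_list_const_mult)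
  also have "\<dots> \<le> 6 * instance_size I"
    by (simp add: instance_size_def enc_instance_def val_size_enc_list)
  finally have "val_size (enc_history h) \<le> 1 + 6 * instance_size I"
    using val_size_enc_history[OF h(2)] by simp
  moreover have "val_size (truth_val b) \<le> 2" by (simp add: floorlog_def of_bool_def)
  ultimately show ?thesis
    by (simp add: enc_input_def instance_size_def floorlog_def)
qed

theorem theorem6:
  shows "\<exists>\<alpha>::real. \<alpha> \<ge> 1 \<and> (\<exists>P Q. polynomial_time P Q \<and> approximation_algorithm \<alpha> P Q)"
proof -
  have feasible: "feasible I (strategy_of matcher I [b])" if "valid_instance I" for I b
    using scaled_instance.feasible_plan[of I b] that
    by (simp add: strategy_of_matcher scaled_instance_def)
  obtain T where T: "\<And>x y t. eval matcher [x] (matcher ! 0) y t \<Longrightarrow> t \<le> poly T (val_size x)"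
    using ptime_matcher unfolding fun_ptime_def by blast
  have "\<exists>M t. runs matcher (enc_input I r h) (enc_list enc_edge M) t
      \<and> t \<le> poly (pcompose T [:8, 7:]) (instance_size I)"
    if I: "valid_instance I" and r: "r \<in> coin_seqs [:1:] I"
      and h: "h \<in> reachable I (strategy_of matcher I r)"
    for I r h
  proof -
    obtain b where b: "r = [b]" using r unfolding coin_seqs_one by auto
    obtain M t where run: "runs matcher (enc_input I [b] h) (enc_list enc_edge M) t"
      using runs_matcher[OF I] by blast
    obtain X j where
      "h = play (strategy_of matcher I r) X j" "X \<in> set_pmf (edge_pmf I)" "j < rounds I"
      using h by (auto simp: reachable_def)
    then have "fair_history I j h"
      using fair_history_play[OF feasible[OF I, of b]] b by simp
    then have size: "val_size (enc_input I [b] h) \<le> poly [:8, 7:] (instance_size I)"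
      using val_size_enc_input[OF I] by (simp add: mult.commute)
    have "t \<le> poly T (val_size (enc_input I [b] h))" using run T unfolding runs_def by blast
    also have "\<dots> \<le> poly (pcompose T [:8, 7:]) (instance_size I)"
      using poly_nat_mono[OF size] by (simp add: poly_pcompose)
    finally show ?thesis using run b by blast
  qed
  then have poly: "polynomial_time matcher [:1:]" unfolding polynomial_time_def by blast
  \<comment> \<open>The coin averages the expected weights of the two plans, which doubles the
    constant 192 of \<open>optimum_le\<close>.\<close>
  have "approximation_algorithm 384 matcher [:1:]"
    unfolding approximation_algorithm_def
  proof (intro allI impI conjI ballI)
    fix I assume I: "valid_instance I"
    show "feasible I (strategy_of matcher I r)" if "r \<in> coin_seqs [:1:] I" for r
      using that feasible[OF I] unfolding coin_seqs_one by auto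
    have "optimum I \<le> 192 * (expected_weight I (greedy (capacity I) (plan I True))
      + expected_weight I (greedy (capacity I) (plan I False)))"
      by (rule scaled_instance.optimum_le) (simp add: scaled_instance_def I)
    then show "(1 / 384) * optimum I \<le> measure_pmf.expectation (pmf_of_set (coin_seqs [:1:] I))
        (\<lambda>r. expected_weight I (strategy_of matcher I r))"
      unfolding coin_seqs_one by (simp add: integral_pmf_of_set strategy_of_matcher[OF I])
  qed
  with poly show ?thesis by (intro exI[of _ 384] conjI exI[of _ matcher] exI[of _ "[:1:]"]) auto
qed

end
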